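(* Let $d \in \{5,6,7\}$ and let $\psi \in C([0,1];\mathbb{R}) \cap C^\infty((0,1];\mathbb{R})$ with $\psi(0)=0$ be a solution on $(0,1)$ of $$\begin{aligned}\psi^{(4)} &= 6(\psi')^2\psi'' + \frac{2(d-1)}{r}\left((\psi')^3-\psi^{(3)}\right) - \frac{d-1}{r^2}\left((d-\cos(2\psi)-4)\psi'' + \sin(2\psi)(\psi')^2\right)\\ &\quad + \frac{(d-3)(d-1)}{r^3}(\cos(2\psi)+2)\psi' - \frac{3(d-3)(d-1)}{2r^4}\sin(2\psi).\end{aligned}$$ Let $u = \Upsilon(\psi) \in C(\overline{B^d(0,1)};S^d)\cap C^\infty(\overline{B^d(0,1)}\setminus\{0\};S^d)$. Then $u \in C^\infty(\overline{B^d(0,1)};S^d)$ and $u$ is biharmonic.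
   Context: $B^d(0,1)\subset\mathbb{R}^d$ is the open unit ball centred at the origin and $S^d=\{y\in\mathbb{R}^{d+1}: |y|=1\}$. For a function $\psi$ of the radius with $\psi(0)=0$, the map $\Upsilon(\psi)$ is defined by $\Upsilon(\psi)(x) = \left(\frac{x}{|x|}\sin\psi(|x|),\cos\psi(|x|)\right)\in\mathbb{R}^d\times\mathbb{R}$ for $x\neq 0$, and $\Upsilon(\psi)(0)=\hat e_{d+1}=(0,\dots,0,1)$. A (extrinsic) biharmonic map $u:B^d(0,1)\to S^d\subset\mathbb{R}^{d+1}$ is a critical point of $E_2[u]=\int |\Delta u|^2\,dx$ among $S^d$-valued maps (with fixed boundary data for $u$ and its first derivatives), i.e. a solution of the Euler–Lagrange equation $\Delta^2u(x)\perp T_{u(x)}S^d$ in $B^d(0,1)$ (in the distributional sense for $u \in H^2$; pointwise for smooth $u$). *)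

theory Defs
  imports "HOL-Analysis.Analysis"
begin

text \<open>
  Differentiability of order \<open>k\<close> up to the part of the boundary contained in \<open>S\<close>: derivatives are
  taken within \<open>S\<close>, hence one-sided at boundary points. The definition is intended for sets such as
  balls, closed balls (possibly punctured) and nondegenerate intervals, where every point of \<open>S\<close>
  determines the derivative within \<open>S\<close> uniquely. There, it says that all partial derivatives of
  order at most \<open>k\<close> exist in the interior and extend continuously to \<open>S\<close>.
\<close>

primrec C_k_on :: "nat \<Rightarrow> 'a::euclidean_space set \<Rightarrow> ('a \<Rightarrow> 'b::euclidean_space) \<Rightarrow> bool" where
  "C_k_on 0 S f \<longleftrightarrow> continuous_on S f"
| "C_k_on (Suc k) S f \<longleftrightarrow>
     (\<exists>f'. (\<forall>x\<in>S. (f has_derivative f' x) (at x within S)) \<and> (\<forall>v. C_k_on k S (\<lambda>x. f' x v)))"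

definition C_infinity_on :: "'a::euclidean_space set \<Rightarrow> ('a \<Rightarrow> 'b::euclidean_space) \<Rightarrow> bool" where
  "C_infinity_on S f \<longleftrightarrow> (\<forall>k. C_k_on k S f)"

definition partial_deriv :: "'a::euclidean_space \<Rightarrow> ('a \<Rightarrow> 'b::euclidean_space) \<Rightarrow> 'a \<Rightarrow> 'b" where
  "partial_deriv b f x = vector_derivative (\<lambda>t. f (x + t *\<^sub>R b)) (at 0)"

definition laplacian :: "('a::euclidean_space \<Rightarrow> 'b::euclidean_space) \<Rightarrow> 'a \<Rightarrow> 'b" where
  "laplacian f x = (\<Sum>b\<in>Basis. partial_deriv b (partial_deriv b f) x)"

definition tangent_sphere :: "'b::euclidean_space \<Rightarrow> 'b set" where
  "tangent_sphere y = {w. y \<bullet> w = 0}"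

text \<open>
  Smooth extrinsically biharmonic maps into the unit sphere, i.e. smooth solutions of the
  Euler--Lagrange equation of the energy \<open>\<integral> |\<Delta>u|\<^sup>2\<close>. For smooth maps
  this equation is understood pointwise.
\<close>

definition biharmonic_map_on :: "'a::euclidean_space set \<Rightarrow> ('a \<Rightarrow> 'b::euclidean_space) \<Rightarrow> bool" where
  "biharmonic_map_on \<Omega> u \<longleftrightarrow>
     open \<Omega> \<and> C_infinity_on \<Omega> u \<and> u \<in> \<Omega> \<rightarrow> sphere 0 1 \<and>
     (\<forall>x\<in>\<Omega>. \<forall>w\<in>tangent_sphere (u x). laplacian (laplacian u) x \<bullet> w = 0)"

text \<open>
  The target \<open>\<real>\<^sup>d \<times> \<real>\<close> is the product type, whose norm is the Euclidean one.
\<close>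

definition Upsilon :: "(real \<Rightarrow> real) \<Rightarrow> real ^ 'n \<Rightarrow> (real ^ 'n) \<times> real" where
  "Upsilon \<psi> x =
     (if x = 0 then (0, 1)
      else (sin (\<psi> (norm x)) *\<^sub>R (x /\<^sub>R norm x), cos (\<psi> (norm x))))"

end

theory Submission
  imports Defs
begin

text \<open>
  In the variable \<open>t = ln r\<close> the equation is autonomous, and its linearization at \<open>0\<close> has the
  exponents \<open>1, 3, 1 - d, 3 - d\<close>. Since the nonlinearity is scaling invariant, interpolation shows that
  the derivatives of a solution tending to \<open>0\<close> as \<open>t \<rightarrow> - \<infinity>\<close> tend to \<open>0\<close> as well. The solution then
  lies on the unstable manifold of the hyperbolic fixed point \<open>0\<close>, so that
  \<open>\<psi> r = r \<phi> (r\<^sup>2)\<close> with \<open>\<phi>\<close> differentiable at \<open>0\<close>. In terms of \<open>s = r\<^sup>2\<close> the equation becomes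
  \<open>16 (\<theta> + d/2 + 2) (\<theta> + d/2 + 1) \<phi>'' = RHS (s, \<phi>, \<phi>', s \<phi>'')\<close> with \<open>\<theta> = s d/ds\<close> and smooth right-hand side,
  and inverting the two Euler operators gains regularity, so \<open>\<phi>\<close> is smooth up to \<open>s = 0\<close>.
  Hence \<open>u x = (G (|x|\<^sup>2) x, H (|x|\<^sup>2))\<close> with smooth \<open>G\<close> and \<open>H\<close>; its bilaplacian has the same form, and
  its tangential part vanishes by the equation for \<open>\<psi>\<close>.
\<close>

section \<open>Functions of class $C^k$\<close>

text \<open>Two obstacles shape the argument. The profile is only continuous at
  \<open>r = 0\<close>, so nothing is known about its derivatives there, and the term
  \<open>v1^2 * v2\<close> is critical for interpolation: it has the same weight as
  \<open>v4\<close> and can be absorbed only because \<open>v0\<close> itself is small. The second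
  obstacle is resonance: a cubic term in the leading mode \<open>r\<close> excites exactly the
  exponent \<open>3\<close> and would give \<open>r^3 ln r\<close>. It is harmless here because the
  pure cubic terms cancel. The variable \<open>s = r^2\<close> suits the two admissible exponents:
  with \<open>D = r d/dr\<close>, the factors \<open>(D - 1) (D - 3)\<close> turn
  \<open>r \<phi>(s)\<close> into \<open>4 r^5 \<phi>''(s)\<close>, so that the modes
  \<open>r\<close> and \<open>r^3\<close> disappear into the values of \<open>\<phi>\<close> and
  \<open>\<phi>'\<close> at \<open>0\<close>. Only the two factors with negative exponents are left;
  in \<open>s\<close> they become Euler operators with positive shift, whose homogeneous solutions
  are negative powers of \<open>s\<close> and are excluded by the decay. Since
  \<open>\<phi>''\<close> is not controlled at \<open>0\<close> at the start, but
  \<open>s \<phi>''\<close> is, the regularity induction runs over the triple \<open>\<phi>\<close>,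
  \<open>\<phi>'\<close>, \<open>s \<phi>''\<close>.\<close>

lemma C_k_on_cong:
  assumes "C_k_on k S f" and "\<And>x. x \<in> S \<Longrightarrow> f x = g x"
  shows "C_k_on k S g"
proof (cases k)
  case 0
  then show ?thesis using assms continuous_on_cong[of S S f g] by simp
next
  case (Suc n)
  then obtain f' where f': "\<forall>x\<in>S. (f has_derivative f' x) (at x within S)"
    "\<forall>v. C_k_on n S (\<lambda>x. f' x v)" using assms(1) by auto
  have "\<forall>x\<in>S. (g has_derivative f' x) (at x within S)"
  proof
    fix x assume "x \<in> S"
    with f'(1) assms(2) show "(g has_derivative f' x) (at x within S)"
      by (auto intro: has_derivative_transform[of x S g f])
  qed
  then show ?thesis using f'(2) Suc by auto
qed

lemma C_k_on_continuous: "C_k_on k S f \<Longrightarrow> continuous_on S f"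
  by (cases k) (auto simp: continuous_on_eq_continuous_within intro: has_derivative_continuous)

lemma C_k_on_SucD: "C_k_on (Suc k) S f \<Longrightarrow> C_k_on k S f"
proof (induction k arbitrary: f)
  case 0
  show ?case using C_k_on_continuous[OF 0] by simp
next
  case (Suc k)
  obtain f' where f': "\<forall>x\<in>S. (f has_derivative f' x) (at x within S)"
    "\<forall>v. C_k_on (Suc k) S (\<lambda>x. f' x v)"
    using Suc.prems unfolding C_k_on.simps(2)[of "Suc k"] by auto
  show ?case unfolding C_k_on.simps(2)[of k] using f' Suc.IH by blast
qed

lemma C_k_on_subset:
  assumes "C_k_on k S f" and "T \<subseteq> S"
  shows "C_k_on k T f"
  using assms(1)
proof (induction k arbitrary: f)
  case 0
  then show ?case using assms(2) by (auto intro: continuous_on_subset)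
next
  case (Suc k)
  then obtain f' where f': "\<And>x. x \<in> S \<Longrightarrow> (f has_derivative f' x) (at x within S)"
    "\<And>v. C_k_on k S (\<lambda>x. f' x v)" by auto
  have "(f has_derivative f' x) (at x within T)" if "x \<in> T" for x
    using f'(1)[of x] that assms(2) by (auto intro: has_derivative_subset)
  moreover have "C_k_on k T (\<lambda>x. f' x v)" for v
    using f'(2) by (rule Suc.IH)
  ultimately show ?case by auto
qed

lemma C_k_on_const: "C_k_on k S (\<lambda>x. c)"
proof (induction k arbitrary: c)
  case (Suc k)
  then show ?case unfolding C_k_on.simps by (intro exI[of _ "\<lambda>x v. 0"]) auto
qed simp

lemma C_k_on_bounded_linear: "bounded_linear f \<Longrightarrow> C_k_on k S f"
proof (cases k)
  case (Suc n)
  assume "bounded_linear f"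
  then show ?thesis unfolding Suc C_k_on.simps
    by (intro exI[of _ "\<lambda>x. f"]) (auto intro: C_k_on_const bounded_linear_imp_has_derivative)
qed (simp add: linear_continuous_on)

lemma C_k_on_add: "C_k_on k S f \<Longrightarrow> C_k_on k S g \<Longrightarrow> C_k_on k S (\<lambda>x. f x + g x)"
proof (induction k arbitrary: f g)
  case (Suc k)
  obtain f' where f: "\<forall>x\<in>S. (f has_derivative f' x) (at x within S)"
    "\<forall>v. C_k_on k S (\<lambda>x. f' x v)" using Suc by auto
  obtain g' where g: "\<forall>x\<in>S. (g has_derivative g' x) (at x within S)"
    "\<forall>v. C_k_on k S (\<lambda>x. g' x v)" using Suc by auto
  show ?case unfolding C_k_on.simps
    using f g Suc.IH by (intro exI[of _ "\<lambda>x v. f' x v + g' x v"]) (auto intro: has_derivative_add)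
qed (auto intro: continuous_on_add)

lemma C_k_on_bilinear:
  fixes pr :: "'a::euclidean_space \<Rightarrow> 'b::euclidean_space \<Rightarrow> 'c::euclidean_space"
  assumes pr: "bounded_bilinear pr"
  shows "C_k_on k S f \<Longrightarrow> C_k_on k S g \<Longrightarrow> C_k_on k S (\<lambda>x. pr (f x) (g x))"
proof (induction k arbitrary: f g)
  case 0
  then show ?case by (simp add: bounded_bilinear.continuous_on[OF pr])
next
  case (Suc k)
  obtain f' where f: "\<forall>x\<in>S. (f has_derivative f' x) (at x within S)"
    "\<forall>v. C_k_on k S (\<lambda>x. f' x v)" using Suc by auto
  obtain g' where g: "\<forall>x\<in>S. (g has_derivative g' x) (at x within S)"
    "\<forall>v. C_k_on k S (\<lambda>x. g' x v)" using Suc by auto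
  have "C_k_on k S f" "C_k_on k S g" using Suc.prems C_k_on_SucD by auto
  with f g Suc.IH show ?case unfolding C_k_on.simps
    by (intro exI[of _ "\<lambda>x v. pr (f x) (g' x v) + pr (f' x v) (g x)"])
       (auto intro!: bounded_bilinear.FDERIV[OF pr] C_k_on_add)
qed

lemmas C_k_on_mult = C_k_on_bilinear[OF bounded_bilinear_mult]
lemmas C_k_on_scaleR = C_k_on_bilinear[OF bounded_bilinear_scaleR]
lemmas C_k_on_inner = C_k_on_bilinear[OF bounded_bilinear_inner]

lemma C_k_on_power: "C_k_on k S f \<Longrightarrow> C_k_on k S (\<lambda>x. f x ^ n :: real)"
  by (induction n) (auto intro: C_k_on_mult C_k_on_const)

lemma C_k_on_ident: "C_k_on k S (\<lambda>x. x)"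
  by (rule C_k_on_bounded_linear) (rule bounded_linear_ident)

lemma C_k_on_diff: "C_k_on k S f \<Longrightarrow> C_k_on k S g \<Longrightarrow> C_k_on k S (\<lambda>x. f x - g x)"
  using C_k_on_add[of k S f "\<lambda>x. (-1) *\<^sub>R g x"] 
    C_k_on_scaleR[OF C_k_on_const[of k S "-1"], of g] by simp

lemma C_k_on_Pair:
  "C_k_on k S f \<Longrightarrow> C_k_on k S g \<Longrightarrow> C_k_on k S (\<lambda>x. (f x, g x))"
proof (induction k arbitrary: f g)
  case (Suc k)
  obtain f' where f: "\<forall>x\<in>S. (f has_derivative f' x) (at x within S)"
    "\<forall>v. C_k_on k S (\<lambda>x. f' x v)" using Suc by auto
  obtain g' where g: "\<forall>x\<in>S. (g has_derivative g' x) (at x within S)"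
    "\<forall>v. C_k_on k S (\<lambda>x. g' x v)" using Suc by auto
  show ?case unfolding C_k_on.simps
    using f g Suc.IH by (intro exI[of _ "\<lambda>x v. (f' x v, g' x v)"]) (auto intro: has_derivative_Pair)
qed (auto intro: continuous_on_Pair)

text \<open>The outer function has a real variable, so \<open>g' y w = w *\<^sub>R g' y 1\<close>.
  The chain rule then yields a product of two functions of class \<open>C_k_on k\<close>, the second
  again a composition, to which the induction hypothesis applies.\<close>

lemma C_k_on_compose:
  fixes g :: "real \<Rightarrow> 'b::euclidean_space"
  assumes "C_k_on k T g" "C_k_on k S f" "f ` S \<subseteq> T"
  shows "C_k_on k S (\<lambda>x. g (f x))"
  using assms
proof (induction k arbitrary: g)
  case 0
  then show ?case by (auto intro: continuous_on_compose2)
next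
  case (Suc k)
  obtain f' where f: "\<forall>x\<in>S. (f has_derivative f' x) (at x within S)"
    "\<forall>v. C_k_on k S (\<lambda>x. f' x v)" using Suc by auto
  obtain g' where g: "\<forall>x\<in>T. (g has_derivative g' x) (at x within T)"
    "\<forall>v. C_k_on k T (\<lambda>x. g' x v)" using Suc by auto
  have *: "g' y w = w *\<^sub>R g' y 1" if "y \<in> T" for y w
    using linear_scale[OF has_derivative_linear, of g "g' y" "at y within T" w 1] g(1) that by auto
  have "((\<lambda>x. g (f x)) has_derivative (\<lambda>v. f' x v *\<^sub>R g' (f x) 1)) (at x within S)" if "x \<in> S" for x
  proof -
    have fx: "f x \<in> T" using that Suc.prems by auto
    have "((\<lambda>x. g (f x)) has_derivative (\<lambda>v. g' (f x) (f' x v))) (at x within S)"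
      using that f(1) g(1) Suc.prems(3) by (blast intro: has_derivative_in_compose2)
    moreover have "(\<lambda>v. g' (f x) (f' x v)) = (\<lambda>v. f' x v *\<^sub>R g' (f x) 1)"
      using *[OF fx] by (rule ext)
    ultimately show ?thesis by (simp only:)
  qed
  moreover have "C_k_on k S (\<lambda>x. f' x v *\<^sub>R g' (f x) 1)" for v
    by (rule C_k_on_scaleR[OF f(2)[rule_format]
      Suc.IH[OF g(2)[rule_format] C_k_on_SucD[OF Suc.prems(2)] Suc.prems(3)]])
  ultimately show ?case unfolding C_k_on.simps
    by (intro exI[of _ "\<lambda>x v. f' x v *\<^sub>R g' (f x) 1"]) simp
qed

lemma C_k_on_SucI_real:
  fixes f :: "real \<Rightarrow> real"
  assumes "\<And>x. x \<in> S \<Longrightarrow> (f has_real_derivative f' x) (at x within S)" "C_k_on k S f'"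
  shows "C_k_on (Suc k) S f"
  unfolding C_k_on.simps using assms
  by (intro exI[of _ "\<lambda>x v. f' x * v"]) (auto simp: has_field_derivative_def intro: C_k_on_mult C_k_on_const)

lemma C_k_on_SucE_real:
  fixes f :: "real \<Rightarrow> real"
  assumes "C_k_on (Suc k) S f"
  obtains f' where "\<And>x. x \<in> S \<Longrightarrow> (f has_real_derivative f' x) (at x within S)" "C_k_on k S f'"
proof -
  obtain F where F: "\<forall>x\<in>S. (f has_derivative F x) (at x within S)"
    "\<forall>v. C_k_on k S (\<lambda>x. F x v)" using assms by auto
  have "F x v = F x 1 * v" if "x \<in> S" for x v
    using linear_scale[OF has_derivative_linear, of f "F x" "at x within S" v 1] F(1) that by auto
  then have "F x = (*) (F x 1)" if "x \<in> S" for x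
    using that by blast
  then have "(f has_real_derivative F x 1) (at x within S)" if "x \<in> S" for x
    using F(1) that by (metis has_field_derivative_def)
  then show thesis using F(2) that[of "\<lambda>x. F x 1"] by blast
qed

text \<open>Each order \<open>k\<close> supplies its own witness for the derivative. Because no
  point of \<open>S\<close> is isolated, derivatives within \<open>S\<close> are unique, so all
  these witnesses agree and one function serves every order.\<close>

lemma C_infinity_on_real_derivative:
  fixes f :: "real \<Rightarrow> real"
  assumes "C_infinity_on S f" and S: "\<And>x. x \<in> S \<Longrightarrow> at x within S \<noteq> bot"
  shows "\<exists>f'. (\<forall>x\<in>S. (f has_real_derivative f' x) (at x within S)) \<and> C_infinity_on S f'"
proof -
  have f: "C_k_on k S f" for k
    using assms(1) by (simp add: C_infinity_on_def)
  obtain f' where f': "\<And>x. x \<in> S \<Longrightarrow> (f has_real_derivative f' x) (at x within S)"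
    using C_k_on_SucE_real[OF f[of "Suc 0"]] by blast
  have "C_k_on k S f'" for k
  proof -
    obtain g where g: "\<And>x. x \<in> S \<Longrightarrow> (f has_real_derivative g x) (at x within S)" "C_k_on k S g"
      using C_k_on_SucE_real[OF f[of "Suc k"]] by blast
    have "g x = f' x" if "x \<in> S" for x
      using vector_derivative_unique_within[OF S[OF that]] f'[OF that] g(1)[OF that]
      by (simp add: has_real_derivative_iff_has_vector_derivative)
    with g(2) show ?thesis by (rule C_k_on_cong)
  qed
  with f' show ?thesis by (auto simp: C_infinity_on_def)
qed

lemma C_infinity_on_derivative_chain:
  fixes f :: "real \<Rightarrow> real"
  assumes "C_infinity_on S f" and S: "\<And>x. x \<in> S \<Longrightarrow> at x within S \<noteq> bot"
  shows "\<exists>F. F 0 = f \<and> (\<forall>k. \<forall>x\<in>S. (F k has_real_derivative F (Suc k) x) (at x within S))"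
proof -
  let ?Q = "\<lambda>g h. \<forall>x\<in>S. (g has_real_derivative h x) (at x within S)"
  have "\<exists>h. C_infinity_on S h \<and> ?Q g h" if "C_infinity_on S g" for g
    using C_infinity_on_real_derivative[OF that S] by blast
  then obtain D where D: "C_infinity_on S (D g)" "?Q g (D g)" if "C_infinity_on S g" for g
    by metis
  define F where "F k = (D ^^ k) f" for k
  have "C_infinity_on S (F k)" for k
    by (induction k) (auto simp: F_def assms(1) D)
  then show ?thesis
    using D(2) by (intro exI[of _ F]) (auto simp: F_def)
qed

text \<open>Termwise differentiation gives the everywhere convergent series with coefficients
  \<open>diffs c\<close>, so the induction runs over all coefficient sequences.\<close>

lemma C_k_on_powser:
  fixes c :: "nat \<Rightarrow> real"
  assumes "\<And>x. summable (\<lambda>n. c n * x ^ n)"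
  shows "C_k_on k UNIV (\<lambda>x. \<Sum>n. c n * x ^ n)"
  using assms
proof (induction k arbitrary: c)
  case 0
  show ?case using termdiffs_strong_converges_everywhere[OF 0]
    by (auto intro!: continuous_at_imp_continuous_on DERIV_isCont)
next
  case (Suc k)
  show ?case
    using termdiffs_strong_converges_everywhere[OF Suc.prems] Suc.IH[of "diffs c"]
      termdiff_converges_all[OF Suc.prems]
    by (intro C_k_on_SucI_real) auto
qed

text \<open>Up to sign and finitely many Taylor terms, \<open>cos x\<close> and \<open>sin x\<close> are \<open>x^k * trig_ser k (x\<^sup>2)\<close>; this makes
  the dependence of the nonlinearity on \<open>r\<^sup>2\<close> explicit.\<close>

definition trig_ser :: "nat \<Rightarrow> real \<Rightarrow> real" where
  "trig_ser k x = (\<Sum>n. (-1) ^ n / fact (2 * n + k) * x ^ n)"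

lemma summable_trig_ser: "summable (\<lambda>n. (-1) ^ n / fact (2 * n + k) * (x::real) ^ n)"
proof (rule summable_comparison_test')
  show "summable (\<lambda>n. \<bar>x\<bar> ^ n /\<^sub>R fact n)" using summable_exp_generic[of "\<bar>x\<bar>"] .
  show "norm ((-1) ^ n / fact (2 * n + k) * x ^ n) \<le> \<bar>x\<bar> ^ n /\<^sub>R fact n" if "n \<ge> 0" for n
    using fact_mono[of n "2 * n + k", where 'a = real]
    by (simp add: abs_mult power_abs divide_simps mult_left_mono)
qed

lemma trig_ser_rec: "trig_ser k x = 1 / fact k - x * trig_ser (k + 2) x"
proof -
  have "trig_ser k x = 1 / fact k + (\<Sum>n. (-1) ^ Suc n / fact (2 * Suc n + k) * x ^ Suc n)"
    unfolding trig_ser_def using suminf_split_head[OF summable_trig_ser[of k x]] by simp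
  also have "(\<Sum>n. (-1) ^ Suc n / fact (2 * Suc n + k) * x ^ Suc n) =
      (\<Sum>n. (- x) * ((-1) ^ n / fact (2 * n + (k + 2)) * x ^ n))"
    by (simp add: algebra_simps)
  also have "\<dots> = - x * trig_ser (k + 2) x"
    unfolding trig_ser_def using summable_trig_ser by (intro suminf_mult)
  finally show ?thesis by simp
qed

lemma C_k_on_trig_ser: "C_k_on k S (trig_ser j)"
  using C_k_on_subset[OF C_k_on_powser[OF summable_trig_ser]] by (simp add: trig_ser_def[abs_def])

lemma cos_eq_trig_ser: "cos x = trig_ser 0 (x\<^sup>2)"
  unfolding trig_ser_def using cos_paired[of x] by (simp add: sums_iff power_mult)

lemma sin_eq_trig_ser: "sin x = x * trig_ser 1 (x\<^sup>2)"
proof -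
  have "sin x = (\<Sum>n. x * ((-1) ^ n / fact (2 * n + 1) * (x\<^sup>2) ^ n))"
    using sin_paired[of x] by (simp add: sums_iff mult_ac flip: power_mult)
  also have "\<dots> = x * trig_ser 1 (x\<^sup>2)"
    unfolding trig_ser_def using summable_trig_ser by (intro suminf_mult)
  finally show ?thesis .
qed

lemma C_k_on_powr: "C_k_on k {0<..1} (\<lambda>s::real. s powr a)"
proof (induction k arbitrary: a)
  case 0
  then show ?case by (auto intro!: continuous_intros)
next
  case (Suc k)
  show ?case
    by (rule C_k_on_SucI_real[OF _ C_k_on_mult[OF C_k_on_const[of k _ a] Suc[of "a - 1"]]])
       (auto intro!: derivative_eq_intros)
qed

text \<open>Each function is expanded to two orders: the short forms serve where another small
  factor is present, the long ones where the cubic terms have to be seen to cancel.\<close>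

lemma trig_ser_taylor:
  "1 - cos x = x^2 * trig_ser 2 (x^2)"
  "x - sin x = x^3 * trig_ser 3 (x^2)"
  "cos x - 1 + x^2 / 2 = x^4 * trig_ser 4 (x^2)"
  "sin x - x + x^3 / 6 = x^5 * trig_ser 5 (x^2)"
proof -
  have c: "cos x = 1 - x^2 * trig_ser 2 (x^2)" "trig_ser 2 (x^2) = 1 / 2 - x^2 * trig_ser 4 (x^2)"
    using cos_eq_trig_ser[of x] trig_ser_rec[of 0 "x^2"] trig_ser_rec[of 2 "x^2"]
    by (simp_all del: add_2_eq_Suc add_2_eq_Suc')
  have s: "sin x = x * (1 - x^2 * trig_ser 3 (x^2))" "trig_ser 3 (x^2) = 1 / 6 - x^2 * trig_ser 5 (x^2)"
    using sin_eq_trig_ser[of x] trig_ser_rec[of 1 "x^2"] trig_ser_rec[of 3 "x^2"]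
    by (simp_all add: fact_numeral del: add_2_eq_Suc add_2_eq_Suc')
  show "1 - cos x = x^2 * trig_ser 2 (x^2)" using c by simp
  show "x - sin x = x^3 * trig_ser 3 (x^2)" using s(1) by (simp add: algebra_simps eval_nat_numeral)
  show "cos x - 1 + x^2 / 2 = x^4 * trig_ser 4 (x^2)"
    unfolding c(1) c(2) by (simp add: algebra_simps eval_nat_numeral)
  show "sin x - x + x^3 / 6 = x^5 * trig_ser 5 (x^2)"
    unfolding s(1) s(2) by (simp add: algebra_simps eval_nat_numeral)
qed

section \<open>Estimates for small solutions on the cylinder\<close>

lemma taylor4_remainder:
  fixes v0 v1 v2 v3 v4 :: "real \<Rightarrow> real"
  assumes der: "\<And>t. t \<in> {a..b} \<Longrightarrow> (v0 has_real_derivative v1 t) (at t)"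
    "\<And>t. t \<in> {a..b} \<Longrightarrow> (v1 has_real_derivative v2 t) (at t)"
    "\<And>t. t \<in> {a..b} \<Longrightarrow> (v2 has_real_derivative v3 t) (at t)"
    "\<And>t. t \<in> {a..b} \<Longrightarrow> (v3 has_real_derivative v4 t) (at t)"
    and A: "\<And>t. t \<in> {a..b} \<Longrightarrow> \<bar>v4 t\<bar> \<le> A"
    and c: "c \<in> {a..b}" "c + x \<in> {a..b}"
  shows "\<bar>v0 (c + x) - (v0 c + v1 c * x + v2 c / 2 * x^2 + v3 c / 6 * x^3)\<bar> \<le> A / 24 * x^4"
proof (cases "x = 0")
  case False
  define D where "D m = (if m = 0 then v0 else if m = Suc 0 then v1 else if m = 2 then v2
    else if m = 3 then v3 else v4)" for m :: nat
  have "\<forall>m t. m < 4 \<and> a \<le> t \<and> t \<le> b \<longrightarrow> (D m has_real_derivative D (Suc m) t) (at t)"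
  proof (intro allI impI)
    fix m t assume "m < (4::nat) \<and> a \<le> t \<and> t \<le> b"
    moreover from this have "m = 0 \<or> m = 1 \<or> m = 2 \<or> m = 3" by auto
    ultimately show "(D m has_real_derivative D (Suc m) t) (at t)"
      using der[of t] by (auto simp: D_def)
  qed
  with Taylor[of 4 D v0 a b c "c + x"] c False obtain t where
    t: "if c + x < c then c + x < t \<and> t < c else c < t \<and> t < c + x"
    and eq: "v0 (c + x) = (\<Sum>m<4. D m c / fact m * (c + x - c)^m) + D 4 t / fact 4 * (c + x - c)^4"
    by (auto simp: D_def)
  have "t \<in> {a..b}" using t c by (auto split: if_splits)
  then have "\<bar>v4 t / 24 * x^4\<bar> \<le> A / 24 * x^4"
    using A by (auto simp: abs_mult intro!: mult_right_mono)
  moreover have "v0 (c + x) - (v0 c + v1 c * x + v2 c / 2 * x^2 + v3 c / 6 * x^3) = v4 t / 24 * x^4"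
    unfolding eq by (simp add: D_def eval_nat_numeral)
  ultimately show ?thesis by (simp only:)
qed simp

text \<open>Taylor expansion at the offsets \<open>h\<close>, \<open>-h\<close>,
  \<open>2 * h\<close>, \<open>-2 * h\<close> expresses differences of \<open>v0\<close> through the
  rescaled derivatives at \<open>t\<close>, up to a remainder of size \<open>A * h^4\<close>; the
  odd and the even combinations can be solved for them.\<close>

lemma interpolation4:
  fixes v0 v1 v2 v3 v4 :: "real \<Rightarrow> real"
  assumes h: "h > 0"
    and der: "\<And>s. s \<in> {t-2*h..t+2*h} \<Longrightarrow> (v0 has_real_derivative v1 s) (at s)"
    "\<And>s. s \<in> {t-2*h..t+2*h} \<Longrightarrow> (v1 has_real_derivative v2 s) (at s)"
    "\<And>s. s \<in> {t-2*h..t+2*h} \<Longrightarrow> (v2 has_real_derivative v3 s) (at s)"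
    "\<And>s. s \<in> {t-2*h..t+2*h} \<Longrightarrow> (v3 has_real_derivative v4 s) (at s)"
    and A: "\<And>s. s \<in> {t-2*h..t+2*h} \<Longrightarrow> \<bar>v4 s\<bar> \<le> A"
    and \<epsilon>: "\<And>s. s \<in> {t-2*h..t+2*h} \<Longrightarrow> \<bar>v0 s\<bar> \<le> \<epsilon>"
  shows "h * \<bar>v1 t\<bar> \<le> 4 * (\<epsilon> + A * h^4)" "h^2 * \<bar>v2 t\<bar> \<le> 4 * (\<epsilon> + A * h^4)"
    "h^3 * \<bar>v3 t\<bar> \<le> 4 * (\<epsilon> + A * h^4)"
proof -
  define p where "p = v1 t * h"
  define q where "q = v2 t * h^2"
  define s where "s = v3 t * h^3"
  define B where "B = A * h^4"
  have B: "B \<ge> 0" using A[of t] h by (auto simp: B_def)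
  have T: "v0 (t + c * h) - (v0 t + c * p + c^2 * q / 2 + c^3 * s / 6) \<le> c^4 * B / 24"
    "- (v0 (t + c * h) - (v0 t + c * p + c^2 * q / 2 + c^3 * s / 6)) \<le> c^4 * B / 24"
    if "c \<in> {-2..2}" for c
  proof -
    have "c * h \<ge> (-2) * h" "c * h \<le> 2 * h"
      using that h mult_right_mono[of "-2" c h] mult_right_mono[of c 2 h] by auto
    then have "t + c * h \<in> {t-2*h..t+2*h}" "t \<in> {t-2*h..t+2*h}" using h by auto
    from taylor4_remainder[of _ _ v0 v1 v2 v3 v4, OF der A this(2,1)]
    have "\<bar>v0 (t + c * h) - (v0 t + c * p + c^2 * q / 2 + c^3 * s / 6)\<bar> \<le> c^4 * B / 24"
      by (simp add: p_def q_def s_def B_def power_mult_distrib algebra_simps)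
    then show "v0 (t + c * h) - (v0 t + c * p + c^2 * q / 2 + c^3 * s / 6) \<le> c^4 * B / 24"
      "- (v0 (t + c * h) - (v0 t + c * p + c^2 * q / 2 + c^3 * s / 6)) \<le> c^4 * B / 24"
      unfolding abs_le_iff by blast+
  qed
  have E: "v0 (t + c * h) \<le> \<epsilon>" "- v0 (t + c * h) \<le> \<epsilon>" if "c \<in> {-2..2}" for c
  proof -
    have "c * h \<ge> (-2) * h" "c * h \<le> 2 * h"
      using that h mult_right_mono[of "-2" c h] mult_right_mono[of c 2 h] by auto
    then show "v0 (t + c * h) \<le> \<epsilon>" "- v0 (t + c * h) \<le> \<epsilon>"
      using \<epsilon>[of "t + c * h"] by auto
  qed
  \<comment> \<open>All these inequalities are linear in \<open>p\<close>, \<open>q\<close>,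
    \<open>s\<close>, \<open>B\<close>, \<open>\<epsilon>\<close> and the five sampled values, so
    linear arithmetic finds the finite difference combinations.\<close>
  note TE = T[of 1] T[of "-1"] T[of 2] T[of "-2"] E[of 1] E[of "-1"] E[of 2] E[of "-2"] E[of 0]
  have "\<bar>p\<bar> \<le> 4 * (\<epsilon> + B)" "\<bar>q\<bar> \<le> 4 * (\<epsilon> + B)" "\<bar>s\<bar> \<le> 4 * (\<epsilon> + B)"
    using TE B by (simp_all add: abs_le_iff)
  then show "h * \<bar>v1 t\<bar> \<le> 4 * (\<epsilon> + A * h^4)" "h^2 * \<bar>v2 t\<bar> \<le> 4 * (\<epsilon> + A * h^4)"
    "h^3 * \<bar>v3 t\<bar> \<le> 4 * (\<epsilon> + A * h^4)"
    using h by (simp_all add: p_def q_def s_def B_def abs_mult mult.commute)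
qed

text \<open>Let \<open>M\<close> be the maximum of \<open>\<delta>\<^sup>4 \<bar>v4\<bar>\<close>, where \<open>\<delta>\<close> is the distance to the boundary of the
  interval. Interpolation on the scale \<open>\<mu> \<delta> / 4\<close> with \<open>\<mu>\<^sup>4 M = \<epsilon>\<close> bounds every term of the scaling
  invariant equation by a small multiple of \<open>M\<close> unless \<open>M\<close> is of order \<open>\<epsilon>\<close>.\<close>

lemma small_solution_estimate:
  fixes v0 v1 v2 v3 v4 :: "real \<Rightarrow> real"
  assumes C: "C \<ge> 1" and \<epsilon>: "\<epsilon> > 0" and L: "L = 2 * C * 170000" and L\<epsilon>: "L * \<epsilon> \<le> 1"
    and der: "\<And>s. s \<in> {T-1..T+1} \<Longrightarrow> (v0 has_real_derivative v1 s) (at s)"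
    "\<And>s. s \<in> {T-1..T+1} \<Longrightarrow> (v1 has_real_derivative v2 s) (at s)"
    "\<And>s. s \<in> {T-1..T+1} \<Longrightarrow> (v2 has_real_derivative v3 s) (at s)"
    "\<And>s. s \<in> {T-1..T+1} \<Longrightarrow> (v3 has_real_derivative v4 s) (at s)"
    and cont: "continuous_on {T-1..T+1} v4"
    and small: "\<And>s. s \<in> {T-1..T+1} \<Longrightarrow> \<bar>v0 s\<bar> \<le> \<epsilon>"
    and bd: "\<And>s. s \<in> {T-1..T+1} \<Longrightarrow> \<bar>v4 s\<bar> \<le> C * (\<bar>v1 s\<bar>^2 * \<bar>v2 s\<bar> + \<bar>v1 s\<bar>^3 + \<bar>v3 s\<bar> + \<bar>v2 s\<bar>
      + \<bar>v1 s\<bar>^2 + \<bar>v1 s\<bar> + \<bar>v0 s\<bar>)"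
  shows "\<bar>v1 T\<bar> \<le> 256 * (1 + L^4) * \<epsilon>" "\<bar>v2 T\<bar> \<le> 256 * (1 + L^4) * \<epsilon>"
    "\<bar>v3 T\<bar> \<le> 256 * (1 + L^4) * \<epsilon>"
proof -
  define \<delta> where "\<delta> s = 1 - \<bar>s - T\<bar>" for s
  let ?w = "\<lambda>s. \<delta> s ^ 4 * \<bar>v4 s\<bar>"
  have "continuous_on {T-1..T+1} ?w"
    unfolding \<delta>_def by (intro continuous_intros cont)
  then obtain t where t: "t \<in> {T-1..T+1}" and max: "\<And>s. s \<in> {T-1..T+1} \<Longrightarrow> ?w s \<le> ?w t"
    using continuous_attains_sup[of "{T-1..T+1}" ?w] by auto
  define M where "M = ?w t"
  have M0: "M \<ge> 0" by (simp add: M_def)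
  have L1: "L \<ge> 1" using C L by simp
  \<comment> \<open>Within distance \<open>\<delta> r / 2\<close> of \<open>r\<close> the function
    \<open>\<delta>\<close> loses at most a factor 2, which costs \<open>2^4 = 16\<close>.\<close>
  have near: "s \<in> {T-1..T+1}" "\<bar>v4 s\<bar> \<le> 16 * M / \<delta> r ^ 4"
    if "r \<in> {T-1<..<T+1}" "s \<in> {r - \<delta> r / 2..r + \<delta> r / 2}" for r s
  proof -
    have \<delta>r: "\<delta> r > 0" using that by (auto simp: \<delta>_def)
    have "\<bar>s - r\<bar> \<le> \<delta> r / 2" using that(2) unfolding atLeastAtMost_iff by linarith
    then have "\<delta> s \<ge> \<delta> r / 2" using abs_triangle_ineq[of "s - r" "r - T"] by (simp add: \<delta>_def)
    then have "\<bar>s - T\<bar> \<le> 1" using \<delta>r by (simp add: \<delta>_def)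
    then show s: "s \<in> {T-1..T+1}" by (auto simp: abs_le_iff)
    have "(\<delta> r / 2) ^ 4 \<le> \<delta> s ^ 4" using \<open>\<delta> s \<ge> \<delta> r / 2\<close> \<delta>r by (intro power_mono) auto
    then have "(\<delta> r / 2) ^ 4 * \<bar>v4 s\<bar> \<le> \<delta> s ^ 4 * \<bar>v4 s\<bar>" by (intro mult_right_mono) auto
    also have "\<dots> \<le> M" unfolding M_def using s by (rule max)
    finally show "\<bar>v4 s\<bar> \<le> 16 * M / \<delta> r ^ 4" using \<delta>r by (simp add: field_simps)
  qed
  have M: "M \<le> L^4 * \<epsilon>"
  \<comment> \<open>If \<open>M\<close> exceeds \<open>\<epsilon>\<close>, then
    \<open>\<mu> \<le> 1\<close>, which is what keeps the interpolation scale inside the half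
    window.\<close>
  proof (cases "M \<le> \<epsilon>")
    case True
    have "1 \<le> L^4" using L1 by simp
    then have "1 * \<epsilon> \<le> L^4 * \<epsilon>" using \<epsilon> by (intro mult_right_mono) auto
    with True show ?thesis by simp
  next
    case False
    then have Mpos: "M > 0" using \<epsilon> by simp
    define \<mu> where "\<mu> = root 4 (\<epsilon> / M)"
    have \<mu>0: "\<mu> > 0" using \<epsilon> Mpos by (simp add: \<mu>_def)
    have \<mu>4: "\<mu>^4 = \<epsilon> / M" using \<epsilon> Mpos by (simp add: \<mu>_def)
    have \<mu>1: "\<mu> \<le> 1" using False \<epsilon> Mpos by (simp add: \<mu>_def)
    have \<epsilon>eq: "\<epsilon> = \<mu>^4 * M" using \<mu>4 Mpos by simp
    define d where "d = \<delta> t"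
    have "d \<noteq> 0" using Mpos by (auto simp: M_def d_def)
    moreover have "d \<ge> 0" using t by (auto simp: \<delta>_def d_def)
    ultimately have d0: "d > 0" by simp
    have d1: "d \<le> 1" by (simp add: d_def \<delta>_def)
    have tin: "t \<in> {T-1<..<T+1}" using d0 by (auto simp: d_def \<delta>_def)
    define h where "h = \<mu> * d / 4"
    have h: "h > 0" using \<mu>0 d0 by (simp add: h_def)
    have "\<mu> * d \<le> d" using \<mu>1 d0 by (simp add: mult_left_le_one_le)
    then have near_t: "s \<in> {t - \<delta> t / 2..t + \<delta> t / 2}" if "s \<in> {t-2*h..t+2*h}" for s
      using that by (auto simp: h_def d_def)
    have sub: "s \<in> {T-1..T+1}" "\<bar>v4 s\<bar> \<le> 16 * M / d ^ 4" if "s \<in> {t-2*h..t+2*h}" for s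
      using near[OF tin near_t[OF that]] unfolding d_def by blast+
    note int = interpolation4[OF h, of t v0 v1 v2 v3 v4 "16 * M / d^4" \<epsilon>,
        OF der[OF sub(1)] sub(2) small[OF sub(1)]]
    have "16 * M / d^4 * h^4 = \<epsilon> / 16"
      using d0 by (simp add: h_def \<epsilon>eq field_simps)
    then have int': "h * \<bar>v1 t\<bar> \<le> 8 * \<epsilon>" "h^2 * \<bar>v2 t\<bar> \<le> 8 * \<epsilon>" "h^3 * \<bar>v3 t\<bar> \<le> 8 * \<epsilon>"
      using int \<epsilon> by auto
    define p1 p2 p3 where "p1 = d * \<bar>v1 t\<bar>" and "p2 = d^2 * \<bar>v2 t\<bar>" and "p3 = d^3 * \<bar>v3 t\<bar>"
    have p0: "p1 \<ge> 0" "p2 \<ge> 0" "p3 \<ge> 0" using d0 by (auto simp: p1_def p2_def p3_def)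
    have "\<mu> * p1 \<le> \<mu> * (32 * \<mu>^3 * M)" "\<mu>^2 * p2 \<le> \<mu>^2 * (128 * \<mu>^2 * M)" "\<mu>^3 * p3 \<le> \<mu>^3 * (512 * \<mu> * M)"
      using int' by (simp_all add: h_def p1_def p2_def p3_def \<epsilon>eq power_mult_distrib
          power_divide eval_nat_numeral mult_ac)
    then have p: "p1 \<le> 32 * \<mu>^3 * M" "p2 \<le> 128 * \<mu>^2 * M" "p3 \<le> 512 * \<mu> * M"
      using \<mu>0 by (simp_all add: mult_le_cancel_left_pos)
    have \<mu>le: "\<mu>^n * x \<le> \<mu> * x" if "n \<ge> 1" "x \<ge> 0" for n x
      using \<mu>0 \<mu>1 that power_decreasing[of 1 n \<mu>] by (auto intro: mult_right_mono)
    have dle: "d^n * x \<le> x" if "x \<ge> 0" for n x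
      using d0 d1 that power_le_one[of d n] by (auto intro: mult_left_le_one_le)
    have "1 * \<epsilon> \<le> L * \<epsilon>" using L1 \<epsilon> by (intro mult_right_mono) auto
    with L\<epsilon> have \<epsilon>1: "\<epsilon> \<le> 1" by simp
    have \<epsilon>2: "\<epsilon>^2 \<le> \<epsilon>" using \<epsilon> \<epsilon>1 by (simp add: power2_eq_square mult_left_le_one_le)
    \<comment> \<open>With \<open>\<mu>^4 * M = \<epsilon>\<close> the powers of
      \<open>\<mu>\<close> and \<open>M\<close> in each term can be counted. The critical term
      \<open>p1^2 * p2\<close> has no power of \<open>\<mu>\<close> to spare and is small only
      through \<open>\<epsilon>\<close>; the linear terms and the quadratic one gain a factor
      \<open>\<mu>\<close>.\<close>
    have "p1^2 \<le> (32 * \<mu>^3 * M)^2" using p p0 by (intro power_mono)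
    then have "p1^2 * p2 \<le> (32 * \<mu>^3 * M)^2 * (128 * \<mu>^2 * M)"
      using p p0 by (intro mult_mono) auto
    also have "\<dots> = 131072 * \<epsilon>^2 * M" by (simp add: \<epsilon>eq eval_nat_numeral)
    also have "\<dots> \<le> 131072 * \<epsilon> * M" using \<epsilon>2 Mpos by simp
    finally have b1: "p1^2 * p2 \<le> 131072 * \<epsilon> * M" .
    have "d * p1^3 \<le> p1^3" using dle[of "p1^3" 1] p0 by simp
    also have "p1^3 \<le> (32 * \<mu>^3 * M)^3" using p p0 by (intro power_mono)
    also have "\<dots> = \<mu> * (32768 * \<epsilon>^2 * M)" by (simp add: \<epsilon>eq eval_nat_numeral)
    also have "\<dots> \<le> 1 * (32768 * \<epsilon> * M)" using \<mu>1 \<mu>0 \<epsilon>2 \<epsilon> Mpos by (intro mult_mono) auto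
    finally have b2: "d * p1^3 \<le> 32768 * \<epsilon> * M" by simp
    have "d * p3 \<le> p3" using dle[of p3 1] p0 by simp
    with p have b3: "d * p3 \<le> 512 * \<mu> * M" by simp
    have "d^2 * p2 \<le> p2" using dle p0 by simp
    also have "\<dots> \<le> \<mu>^2 * (128 * M)" using p by simp
    also have "\<dots> \<le> \<mu> * (128 * M)" using \<mu>le[of 2 "128 * M"] M0 by simp
    finally have b4: "d^2 * p2 \<le> 128 * \<mu> * M" by simp
    have "d^2 * p1^2 \<le> p1^2" using dle p0 by simp
    also have "p1^2 \<le> (32 * \<mu>^3 * M)^2" using p p0 by (intro power_mono)
    also have "\<dots> = \<epsilon> * (\<mu>^2 * (1024 * M))" by (simp add: \<epsilon>eq eval_nat_numeral)
    also have "\<dots> \<le> 1 * (\<mu> * (1024 * M))" using \<epsilon>1 \<epsilon> M0 \<mu>0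
      by (intro mult_mono \<mu>le) auto
    finally have b5: "d^2 * p1^2 \<le> 1024 * \<mu> * M" by simp
    have "d^3 * p1 \<le> p1" using dle p0 by simp
    also have "\<dots> \<le> \<mu>^3 * (32 * M)" using p by simp
    also have "\<dots> \<le> \<mu> * (32 * M)" using \<mu>le[of 3 "32 * M"] M0 by simp
    finally have b6: "d^3 * p1 \<le> 32 * \<mu> * M" by simp
    have "d^4 * \<bar>v0 t\<bar> \<le> \<bar>v0 t\<bar>" using dle by simp
    also have "\<dots> \<le> \<mu>^4 * M" using small[OF t] \<epsilon>eq by simp
    also have "\<dots> \<le> \<mu> * M" using \<mu>le[of 4 M] M0 by simp
    finally have b7: "d^4 * \<bar>v0 t\<bar> \<le> \<mu> * M" .
    have "M = d^4 * \<bar>v4 t\<bar>" by (simp add: M_def d_def)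
    also have "\<dots> \<le> d^4 * (C * (\<bar>v1 t\<bar>^2 * \<bar>v2 t\<bar> + \<bar>v1 t\<bar>^3 + \<bar>v3 t\<bar> + \<bar>v2 t\<bar>
      + \<bar>v1 t\<bar>^2 + \<bar>v1 t\<bar> + \<bar>v0 t\<bar>))"
      using bd[OF t] d0 by (intro mult_left_mono) auto
    also have "\<dots> = C * (p1^2 * p2 + d * p1^3 + d * p3 + d^2 * p2 + d^2 * p1^2 + d^3 * p1 + d^4 * \<bar>v0 t\<bar>)"
      unfolding p1_def p2_def p3_def by algebra
    \<comment> \<open>The coefficients of \<open>\<epsilon> * M\<close> add up to 163840 and those
      of \<open>\<mu> * M\<close> to 1697; 170000 covers both.\<close>
    also have "\<dots> \<le> C * (170000 * (\<epsilon> + \<mu>) * M)"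
    proof (intro mult_left_mono)
      have "\<epsilon> * M \<ge> 0" "\<mu> * M \<ge> 0" using \<epsilon> \<mu>0 M0 by auto
      with b1 b2 b3 b4 b5 b6 b7
      show "p1^2 * p2 + d * p1^3 + d * p3 + d^2 * p2 + d^2 * p1^2 + d^3 * p1 + d^4 * \<bar>v0 t\<bar>
        \<le> 170000 * (\<epsilon> + \<mu>) * M" by (simp add: algebra_simps)
    qed (use C in simp)
    \<comment> \<open>Dividing by \<open>M\<close> bounds \<open>\<mu>\<close> from below:
      \<open>L * \<epsilon> \<le> 1\<close> takes up half of the inequality and leaves
      \<open>L * \<mu> \<ge> 1\<close>, that is, \<open>M \<le> L^4 * \<epsilon>\<close>.\<close>
    finally have "1 * M \<le> (L / 2 * (\<epsilon> + \<mu>)) * M" by (simp add: L mult_ac)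
    then have "1 \<le> L / 2 * (\<epsilon> + \<mu>)" using Mpos by (simp only: mult_le_cancel_right_pos)
    with L\<epsilon> have "1 \<le> L * \<mu>" by (simp add: algebra_simps)
    then have "1 \<le> (L * \<mu>)^4" by simp
    then have "M * 1 \<le> M * (L * \<mu>)^4" using M0 by (intro mult_left_mono)
    then show ?thesis by (simp add: \<epsilon>eq power_mult_distrib mult_ac)
  qed
  define X where "X = L^4 * \<epsilon>"
  have X: "X \<ge> 0" "M \<le> X" using \<epsilon> L1 M by (simp_all add: X_def)
  have sub: "s \<in> {T-1..T+1}" "\<bar>v4 s\<bar> \<le> 16 * X" if "s \<in> {T-2*(1/4)..T+2*(1/4)}" for s
    using that near[of T s] X by (auto simp: \<delta>_def)
  \<comment> \<open>At the centre \<open>\<delta> T = 1\<close>, so \<open>h = 1/4\<close> is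
    allowed; the factor 256 is \<open>4 / h^3\<close>, the loss for the third derivative.\<close>
  note int = interpolation4[of "1/4" T v0 v1 v2 v3 v4 "16 * X" \<epsilon>,
      OF _ der[OF sub(1)] sub(2) small[OF sub(1)]]
  have "256 * (1 + L^4) * \<epsilon> = 256 * \<epsilon> + 256 * X" by (simp add: X_def algebra_simps)
  with int X \<epsilon> show "\<bar>v1 T\<bar> \<le> 256 * (1 + L^4) * \<epsilon>" "\<bar>v2 T\<bar> \<le> 256 * (1 + L^4) * \<epsilon>"
    "\<bar>v3 T\<bar> \<le> 256 * (1 + L^4) * \<epsilon>"
    by (simp_all add: power_divide)
qed

text \<open>The local estimate is linear in the bound for \<open>v0\<close> and has a constant
  independent of the window, so it is applied on unit windows moving to
  \<open>-\<infinity>\<close>.\<close>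

lemma derivatives_tendsto_zero:
  fixes v0 v1 v2 v3 v4 :: "real \<Rightarrow> real"
  assumes C: "C \<ge> 1"
    and der: "\<And>t. t < 0 \<Longrightarrow> (v0 has_real_derivative v1 t) (at t)"
    "\<And>t. t < 0 \<Longrightarrow> (v1 has_real_derivative v2 t) (at t)"
    "\<And>t. t < 0 \<Longrightarrow> (v2 has_real_derivative v3 t) (at t)"
    "\<And>t. t < 0 \<Longrightarrow> (v3 has_real_derivative v4 t) (at t)"
    and cont: "continuous_on {..<0} v4"
    and lim: "(v0 \<longlongrightarrow> 0) at_bot"
    and bd: "\<And>t. t < 0 \<Longrightarrow> \<bar>v4 t\<bar> \<le> C * (\<bar>v1 t\<bar>^2 * \<bar>v2 t\<bar> + \<bar>v1 t\<bar>^3 + \<bar>v3 t\<bar> + \<bar>v2 t\<bar>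
      + \<bar>v1 t\<bar>^2 + \<bar>v1 t\<bar> + \<bar>v0 t\<bar>)"
  shows "(v1 \<longlongrightarrow> 0) at_bot" "(v2 \<longlongrightarrow> 0) at_bot" "(v3 \<longlongrightarrow> 0) at_bot"
proof -
  define L where "L = 2 * C * 170000"
  have L: "L > 0" using C by (simp add: L_def)
  have ev: "eventually (\<lambda>t. \<bar>v1 t\<bar> < e \<and> \<bar>v2 t\<bar> < e \<and> \<bar>v3 t\<bar> < e) at_bot" if e: "e > 0" for e
  proof -
    \<comment> \<open>The first entry is the smallness threshold of the local estimate; the second
      makes its right-hand side at most \<open>e / 2\<close>.\<close>
    define \<epsilon> where "\<epsilon> = min (1 / L) (e / (512 * (1 + L^4)))"
    have L4: "1 + L^4 > 0" using L by (simp add: add_pos_pos)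
    have \<epsilon>: "\<epsilon> > 0" using L L4 e by (simp add: \<epsilon>_def)
    have "\<epsilon> \<le> 1 / L" by (simp add: \<epsilon>_def)
    then have L\<epsilon>: "L * \<epsilon> \<le> 1" using L by (simp add: field_simps)
    have "\<epsilon> \<le> e / (512 * (1 + L^4))" by (simp add: \<epsilon>_def)
    then have "512 * (1 + L^4) * \<epsilon> \<le> e" using L4 by (simp add: field_simps)
    then have e': "256 * (1 + L^4) * \<epsilon> < e" using e by (simp add: algebra_simps)
    have "eventually (\<lambda>t. \<bar>v0 t\<bar> < \<epsilon>) at_bot"
      using lim \<epsilon> by (simp add: tendsto_iff dist_real_def)
    then obtain N where N: "\<And>t. t \<le> N \<Longrightarrow> \<bar>v0 t\<bar> < \<epsilon>" by (auto simp: eventually_at_bot_linorder)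
    show ?thesis
      unfolding eventually_at_bot_linorder
    proof (intro exI allI impI)
      fix T assume T: "T \<le> min (N - 1) (-2)"
      have s: "s < 0" "\<bar>v0 s\<bar> \<le> \<epsilon>" if "s \<in> {T-1..T+1}" for s
        using that T N[of s] by auto
      have "continuous_on {T-1..T+1} v4"
        using cont by (rule continuous_on_subset) (use s(1) in auto)
      note small_solution_estimate[OF C \<epsilon> L_def L\<epsilon> der[OF s(1)] this s(2) bd[OF s(1)]]
      with e' show "\<bar>v1 T\<bar> < e \<and> \<bar>v2 T\<bar> < e \<and> \<bar>v3 T\<bar> < e" by linarith
    qed
  qed
  show "(v1 \<longlongrightarrow> 0) at_bot" "(v2 \<longlongrightarrow> 0) at_bot" "(v3 \<longlongrightarrow> 0) at_bot"
    unfolding tendsto_iff dist_real_def by (auto intro: eventually_mono[OF ev])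
qed

section \<open>Scalar linear equations on a half line ending at \<open>-\<infinity>\<close>, treated
  by monotonicity\<close>

lemma tendsto_exp_at_bot: "a > 0 \<Longrightarrow> ((\<lambda>t::real. exp (a * t)) \<longlongrightarrow> 0) at_bot"
  by (rule filterlim_compose[OF exp_at_bot])
     (simp add: filterlim_tendsto_pos_mult_at_bot[OF tendsto_const _ filterlim_ident])

lemma nondecreasing_nonneg:
  fixes f :: "real \<Rightarrow> real"
  assumes der: "\<And>t. t \<le> T \<Longrightarrow> (f has_real_derivative f' t) (at t)"
    and nonneg: "\<And>t. t \<le> T \<Longrightarrow> f' t \<ge> 0" and lim: "(f \<longlongrightarrow> 0) at_bot" and "t \<le> T"
  shows "f t \<ge> 0"
proof (rule tendsto_upperbound[OF lim])
  show "\<forall>\<^sub>F s in at_bot. f s \<le> f t"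
    unfolding eventually_at_bot_linorder
  proof (intro exI allI impI)
    fix s assume "s \<le> t"
    then show "f s \<le> f t"
    proof (rule DERIV_nonneg_imp_nondecreasing)
      fix x assume "x \<le> t"
      then have "x \<le> T" using \<open>t \<le> T\<close> by simp
      then show "\<exists>y. (f has_real_derivative y) (at x) \<and> 0 \<le> y" using der nonneg by blast
    qed
  qed
qed simp

text \<open>\<open>A * exp (\<alpha> * t)\<close> with \<open>A = C / (\<alpha> + b)\<close> is a
  supersolution, and the integrating factor \<open>exp (b * t)\<close> makes its difference to
  \<open>f\<close> nondecreasing from \<open>0\<close>. The limit hypothesis rules out the
  homogeneous solution \<open>exp (- b * t)\<close>, which blows up at
  \<open>-\<infinity>\<close>.\<close>

lemma damped_decay:
  fixes f g :: "real \<Rightarrow> real"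
  assumes b: "b > 0" and \<alpha>: "\<alpha> > 0"
    and der: "\<And>t. t \<le> T \<Longrightarrow> (f has_real_derivative - b * f t + g t) (at t)"
    and g: "\<And>t. t \<le> T \<Longrightarrow> \<bar>g t\<bar> \<le> C * exp (\<alpha> * t)" and lim: "(f \<longlongrightarrow> 0) at_bot" and t: "t \<le> T"
  shows "\<bar>f t\<bar> \<le> C / (\<alpha> + b) * exp (\<alpha> * t)"
proof -
  define A where "A = C / (\<alpha> + b)"
  have C: "C = A * (\<alpha> + b)" using b \<alpha> by (simp add: A_def)
  have *: "f t \<le> A * exp (\<alpha> * t)"
    if der: "\<And>t. t \<le> T \<Longrightarrow> (f has_real_derivative - b * f t + g t) (at t)"
      and g: "\<And>t. t \<le> T \<Longrightarrow> g t \<le> C * exp (\<alpha> * t)" and lim: "(f \<longlongrightarrow> 0) at_bot" for f g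
  proof -
    have "exp (b * t) * (A * exp (\<alpha> * t) - f t) \<ge> 0"
    proof (rule nondecreasing_nonneg[OF _ _ _ t])
      fix s assume s: "s \<le> T"
      show "((\<lambda>t. exp (b * t) * (A * exp (\<alpha> * t) - f t)) has_real_derivative
          exp (b * s) * (C * exp (\<alpha> * s) - g s)) (at s)"
        by (auto intro!: derivative_eq_intros der[OF s] simp: C algebra_simps)
      show "exp (b * s) * (C * exp (\<alpha> * s) - g s) \<ge> 0" using g[OF s] by simp
    next
      have "((\<lambda>t. exp (b * t) * (A * exp (\<alpha> * t) - f t)) \<longlongrightarrow> 0 * (A * 0 - 0)) at_bot"
        by (intro tendsto_intros tendsto_exp_at_bot b \<alpha> lim)
      then show "((\<lambda>t. exp (b * t) * (A * exp (\<alpha> * t) - f t)) \<longlongrightarrow> 0) at_bot" by simp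
    qed
    then show ?thesis by (simp add: zero_le_mult_iff)
  qed
  have "f t \<le> A * exp (\<alpha> * t)"
    by (rule *[OF der _ lim]) (use g in \<open>auto simp: abs_le_iff\<close>)
  moreover have "- f t \<le> A * exp (\<alpha> * t)"
  proof (rule *[of "\<lambda>t. - f t" "\<lambda>t. - g t"])
    show "((\<lambda>t. - f t) has_real_derivative - b * - f t + - g t) (at t)" if "t \<le> T" for t
      using der[OF that] by (auto intro!: derivative_eq_intros)
    show "- g t \<le> C * exp (\<alpha> * t)" if "t \<le> T" for t using g[OF that] by simp
    show "((\<lambda>t. - f t) \<longlongrightarrow> 0) at_bot" using tendsto_minus[OF lim] by simp
  qed
  ultimately show ?thesis by (simp add: A_def)
qed

text \<open>For \<open>\<alpha> < c\<close> the homogeneous solution \<open>exp (c * t)\<close> is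
  itself dominated by \<open>exp (\<alpha> * t)\<close> as \<open>t\<close> tends to
  \<open>-\<infinity>\<close>, so no limit of \<open>f\<close> is assumed; the value at
  \<open>T\<close> enters the constant instead.\<close>

lemma growing_decay:
  fixes f g :: "real \<Rightarrow> real"
  assumes \<alpha>: "\<alpha> < c" and T: "T \<le> 0"
    and der: "\<And>t. t \<le> T \<Longrightarrow> (f has_real_derivative c * f t + g t) (at t)"
    and g: "\<And>t. t \<le> T \<Longrightarrow> \<bar>g t\<bar> \<le> C * exp (\<alpha> * t)"
  shows "\<exists>C'. \<forall>t\<le>T. \<bar>f t\<bar> \<le> C' * exp (\<alpha> * t)"
proof -
  define A where "A = C / (c - \<alpha>)"
  have C: "C = A * (c - \<alpha>)" using \<alpha> by (simp add: A_def)
  have *: "\<exists>C'. \<forall>t\<le>T. f t \<le> C' * exp (\<alpha> * t)"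
    if der: "\<And>t. t \<le> T \<Longrightarrow> (f has_real_derivative c * f t + g t) (at t)"
      and g: "\<And>t. t \<le> T \<Longrightarrow> - g t \<le> C * exp (\<alpha> * t)" for f g
  proof -
    define F where "F t = exp (- c * t) * f t - A * exp ((\<alpha> - c) * t)" for t
    have "f t \<le> (\<bar>F T\<bar> + A) * exp (\<alpha> * t)" if "t \<le> T" for t
    proof -
      have "F t \<le> F T"
        using that
      proof (rule DERIV_nonneg_imp_nondecreasing)
        fix s assume "t \<le> s" "s \<le> T"
        have "exp ((\<alpha> - c) * s) = exp (- c * s) * exp (\<alpha> * s)"
          by (simp add: exp_add[symmetric] algebra_simps)
        then have "(F has_real_derivative exp (- c * s) * (g s + C * exp (\<alpha> * s))) (at s)"
          unfolding F_def C
          by (auto intro!: derivative_eq_intros der[OF \<open>s \<le> T\<close>] simp: algebra_simps)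
        moreover have "exp (- c * s) * (g s + C * exp (\<alpha> * s)) \<ge> 0"
          using g[OF \<open>s \<le> T\<close>] by simp
        ultimately show "\<exists>y. (F has_real_derivative y) (at s) \<and> 0 \<le> y" by blast
      qed
      then have "exp (c * t) * F t \<le> exp (c * t) * \<bar>F T\<bar>" by simp
      also have "\<dots> \<le> exp (\<alpha> * t) * \<bar>F T\<bar>"
        using that T \<alpha> by (intro mult_right_mono) (auto simp: mult_right_mono_neg)
      also have "exp (c * t) * F t = f t - A * exp (\<alpha> * t)"
        unfolding F_def by (simp add: right_diff_distrib mult.left_commute[of _ A] left_diff_distrib flip: exp_add)
      finally show ?thesis by (simp add: algebra_simps)
    qed
    then show ?thesis by blast
  qed
  obtain C1 where C1: "\<And>t. t \<le> T \<Longrightarrow> f t \<le> C1 * exp (\<alpha> * t)"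
  proof -
    have "\<exists>C'. \<forall>t\<le>T. f t \<le> C' * exp (\<alpha> * t)"
    proof (rule *[OF der])
      show "- g t \<le> C * exp (\<alpha> * t)" if "t \<le> T" for t using g[OF that] by (simp add: abs_le_iff)
    qed
    with that show thesis by blast
  qed
  have "\<exists>C'. \<forall>t\<le>T. - f t \<le> C' * exp (\<alpha> * t)"
  proof (rule *[of "\<lambda>t. - f t" "\<lambda>t. - g t"])
    show "((\<lambda>t. - f t) has_real_derivative c * - f t + - g t) (at t)" if "t \<le> T" for t
      using der[OF that] by (auto intro!: derivative_eq_intros)
    show "- (- g t) \<le> C * exp (\<alpha> * t)" if "t \<le> T" for t using g[OF that] by simp
  qed
  then obtain C2 where C2: "\<And>t. t \<le> T \<Longrightarrow> - f t \<le> C2 * exp (\<alpha> * t)" by blast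
  have "\<bar>f t\<bar> \<le> max C1 C2 * exp (\<alpha> * t)" if "t \<le> T" for t
  proof -
    have "C1 * exp (\<alpha> * t) \<le> max C1 C2 * exp (\<alpha> * t)" "C2 * exp (\<alpha> * t) \<le> max C1 C2 * exp (\<alpha> * t)"
      by (auto intro: mult_right_mono)
    with C1[OF that] C2[OF that] show ?thesis unfolding abs_le_iff by linarith
  qed
  then show ?thesis by blast
qed

text \<open>Adding and subtracting \<open>C / \<alpha> * exp (\<alpha> * t)\<close> turns
  \<open>f\<close> into a nondecreasing and a nonincreasing function. The first lies above the
  second, hence is bounded below and converges to its infimum, and the correction vanishes in the
  limit.\<close>

lemma convergent_at_bot:
  fixes f g :: "real \<Rightarrow> real"
  assumes \<alpha>: "\<alpha> > 0" and T: "T \<le> 0"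
    and der: "\<And>t. t \<le> T \<Longrightarrow> (f has_real_derivative g t) (at t)"
    and g: "\<And>t. t \<le> T \<Longrightarrow> \<bar>g t\<bar> \<le> C * exp (\<alpha> * t)"
  shows "\<exists>l. (f \<longlongrightarrow> l) at_bot"
proof -
  define F where "F t = f t + C / \<alpha> * exp (\<alpha> * t)" for t
  define G where "G t = f t - C / \<alpha> * exp (\<alpha> * t)" for t
  have C0: "C \<ge> 0" using order_trans[OF abs_ge_zero g[of T]] by (simp add: zero_le_mult_iff)
  have F: "F s \<le> F t" if "s \<le> t" "t \<le> T" for s t
    using that(1)
  proof (rule DERIV_nonneg_imp_nondecreasing)
    fix r assume "s \<le> r" "r \<le> t"
    then have r: "r \<le> T" using that by simp
    have "(F has_real_derivative g r + C * exp (\<alpha> * r)) (at r)"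
      unfolding F_def using \<alpha> by (auto intro!: derivative_eq_intros der[OF r])
    moreover have "g r + C * exp (\<alpha> * r) \<ge> 0" using g[OF r] by simp
    ultimately show "\<exists>y. (F has_real_derivative y) (at r) \<and> 0 \<le> y" by blast
  qed
  have G: "G s \<ge> G t" if "s \<le> t" "t \<le> T" for s t
    using that(1)
  proof (rule DERIV_nonpos_imp_nonincreasing)
    fix r assume "s \<le> r" "r \<le> t"
    then have r: "r \<le> T" using that by simp
    have "(G has_real_derivative g r - C * exp (\<alpha> * r)) (at r)"
      unfolding G_def using \<alpha> by (auto intro!: derivative_eq_intros der[OF r])
    moreover have "g r - C * exp (\<alpha> * r) \<le> 0" using g[OF r] by simp
    ultimately show "\<exists>y. (G has_real_derivative y) (at r) \<and> y \<le> 0" by blast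
  qed
  have GF: "G s \<le> F s" for s unfolding F_def G_def using C0 \<alpha> by simp
  have bdd: "bdd_below (F ` {..T})"
  proof (rule bdd_belowI2)
    fix s assume "s \<in> {..T}"
    then show "G T \<le> F s" using G[of s T] GF[of s] by simp
  qed
  define l where "l = Inf (F ` {..T})"
  have "(F \<longlongrightarrow> l) at_bot"
  proof (rule order_tendstoI)
    fix a assume "a < l"
    have "a < F s" if "s \<le> T" for s
      using cInf_lower[OF _ bdd, of "F s"] that \<open>a < l\<close> by (auto simp: l_def)
    then show "\<forall>\<^sub>F s in at_bot. a < F s" by (auto simp: eventually_at_bot_linorder)
  next
    fix a assume "l < a"
    then obtain t where t: "t \<le> T" "F t < a"
      using cInf_lessD[of "F ` {..T}" a] by (auto simp: l_def)
    then show "\<forall>\<^sub>F s in at_bot. F s < a"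
      unfolding eventually_at_bot_linorder using F by (meson le_less_trans)
  qed
  then have "((\<lambda>t. F t - C / \<alpha> * exp (\<alpha> * t)) \<longlongrightarrow> l - C / \<alpha> * 0) at_bot"
    by (intro tendsto_intros tendsto_exp_at_bot \<alpha>)
  then show ?thesis by (auto simp: F_def)
qed

text \<open>The function \<open>v\<^sup>2 + z\<^sup>2 - 16 (q\<^sup>2 + p\<^sup>2)\<close> is nondecreasing and tends to \<open>0\<close> at \<open>- \<infinity>\<close>, so the
  solution stays in the cone where the expanding variables \<open>v, z\<close> dominate; there
  \<open>v\<^sup>2 + 4 z\<^sup>2\<close> grows at least like \<open>exp (3 t / 2)\<close>. Two bootstrap steps then sharpen the
  resulting decay as \<open>t \<rightarrow> - \<infinity>\<close>.\<close>

lemma unstable_manifold_asymptotics: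
  fixes v z q p N :: "real \<Rightarrow> real" and d :: real
  assumes d: "d \<ge> 5" and K: "K \<ge> 1" and T1: "T1 \<le> 0"
    and dv: "\<And>t. t \<le> T1 \<Longrightarrow> (v has_real_derivative v t + z t) (at t)"
    and dz: "\<And>t. t \<le> T1 \<Longrightarrow> (z has_real_derivative 3 * z t + q t) (at t)"
    and dq: "\<And>t. t \<le> T1 \<Longrightarrow> (q has_real_derivative - (d - 3) * q t + p t) (at t)"
    and dp: "\<And>t. t \<le> T1 \<Longrightarrow> (p has_real_derivative - (d - 1) * p t + N t) (at t)"
    and lim: "(v \<longlongrightarrow> 0) at_bot" "(z \<longlongrightarrow> 0) at_bot" "(q \<longlongrightarrow> 0) at_bot" "(p \<longlongrightarrow> 0) at_bot"
    and N: "\<And>t. t \<le> T1 \<Longrightarrow> \<bar>N t\<bar> \<le> K * ((\<bar>v t\<bar> + \<bar>z t\<bar>)^2 * (\<bar>z t\<bar> + \<bar>q t\<bar>) + (\<bar>v t\<bar> + \<bar>z t\<bar>)^5)"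
  shows "\<exists>a. ((\<lambda>t. v t * exp (- t)) \<longlongrightarrow> a) at_bot" "\<exists>b. ((\<lambda>t. z t * exp (- 3 * t)) \<longlongrightarrow> b) at_bot"
    "((\<lambda>t. q t * exp (- 3 * t)) \<longlongrightarrow> 0) at_bot"
proof -
  \<comment> \<open>Once \<open>v\<close> and \<open>z\<close> are below \<open>\<kappa>\<close>,
    the nonlinearity is at most
    \<open>(2 * \<bar>z\<bar> + \<bar>q\<bar> + \<bar>v\<bar>) / 20\<close>, small enough to be
    absorbed by the linear part in the cone estimate.\<close>
  define \<kappa> where "\<kappa> = 1 / (20 * K)"
  have \<kappa>: "\<kappa> > 0" "\<kappa> \<le> 1" "K * \<kappa> = 1 / 20" using K by (auto simp: \<kappa>_def field_simps)
  have "((\<lambda>t. \<bar>v t\<bar> + \<bar>z t\<bar>) \<longlongrightarrow> \<bar>0\<bar> + \<bar>0\<bar>) at_bot" by (intro tendsto_intros lim)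
  then have "eventually (\<lambda>t. \<bar>v t\<bar> + \<bar>z t\<bar> < \<kappa>) at_bot"
    using \<kappa> by (intro order_tendstoD(2)[where y = "\<bar>0\<bar> + \<bar>0::real\<bar>"]) auto
  then obtain T2 where T2: "\<And>t. t \<le> T2 \<Longrightarrow> \<bar>v t\<bar> + \<bar>z t\<bar> < \<kappa>" by (auto simp: eventually_at_bot_linorder)
  define T where "T = min T1 T2"
  have T: "t \<le> T1" "t \<le> 0" if "t \<le> T" for t using that T1 by (auto simp: T_def)
  have T0: "T \<le> 0" using T by simp
  have N2: "32 * (N t)^2 \<le> (v t)^2 + (z t)^2 + (q t)^2" if t: "t \<le> T" for t
  proof -
    define m where "m = \<bar>v t\<bar> + \<bar>z t\<bar>"
    have m: "0 \<le> m" "m \<le> \<kappa>" using T2[of t] t by (auto simp: m_def T_def)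
    have "m * m \<le> \<kappa> * 1" using m \<kappa> by (intro mult_mono) auto
    then have m2: "m^2 \<le> \<kappa>" by (simp add: power2_eq_square)
    then have m4: "m^2 * m^2 \<le> \<kappa> * 1" using \<kappa> by (intro mult_mono) auto
    have "\<bar>N t\<bar> \<le> K * (m^2 * (\<bar>z t\<bar> + \<bar>q t\<bar>) + (m^2 * m^2) * m)"
      using N[OF T(1)[OF t]] by (simp add: m_def[symmetric] eval_nat_numeral mult_ac)
    also have "\<dots> \<le> K * (\<kappa> * (\<bar>z t\<bar> + \<bar>q t\<bar>) + (\<kappa> * 1) * m)"
      using K m m2 m4 by (intro mult_left_mono add_mono mult_right_mono) auto
    also have "\<dots> = (2 * \<bar>z t\<bar> + \<bar>q t\<bar> + \<bar>v t\<bar>) / 20"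
      using K by (simp add: m_def \<kappa>_def field_simps)
    finally have "\<bar>N t\<bar>^2 \<le> ((2 * \<bar>z t\<bar> + \<bar>q t\<bar> + \<bar>v t\<bar>) / 20)^2" by (intro power_mono) auto
    also have "\<dots> = (2 * \<bar>z t\<bar> + \<bar>q t\<bar> + \<bar>v t\<bar>)^2 / 400" by (simp add: power_divide)
    also have "(2 * \<bar>z t\<bar> + \<bar>q t\<bar> + \<bar>v t\<bar>)^2 \<le> 6 * (\<bar>z t\<bar>^2 + \<bar>q t\<bar>^2 + \<bar>v t\<bar>^2)"
    proof -
      have "(2 * a + b + c)^2 \<le> 6 * (a^2 + b^2 + c^2)" for a b c :: real
        using zero_le_power2[of "a - 2 * b"] zero_le_power2[of "a - 2 * c"] zero_le_power2[of "b - c"]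
        by (simp add: power2_eq_square algebra_simps)
      then show ?thesis .
    qed
    finally have "(N t)^2 \<le> 6 * ((z t)^2 + (q t)^2 + (v t)^2) / 400" by simp
    also have "\<dots> \<le> ((z t)^2 + (q t)^2 + (v t)^2) / 32"
    proof -
      have "6 * x / 400 \<le> x / 32" if "x \<ge> 0" for x :: real using that by simp
      then show ?thesis by simp
    qed
    finally show ?thesis by (simp add: add_ac)
  qed
  have cone: "16 * ((q t)^2 + (p t)^2) \<le> (v t)^2 + (z t)^2" if t: "t \<le> T" for t
  proof -
    have "(v t)^2 + (z t)^2 - 16 * ((q t)^2 + (p t)^2) \<ge> 0"
    proof (rule nondecreasing_nonneg[OF _ _ _ t])
      fix s assume s: "s \<le> T"
      show "((\<lambda>t. (v t)^2 + (z t)^2 - 16 * ((q t)^2 + (p t)^2)) has_real_derivative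
        2 * v s * (v s + z s) + 2 * z s * (3 * z s + q s)
          - 16 * (2 * q s * (- (d - 3) * q s + p s) + 2 * p s * (- (d - 1) * p s + N s))) (at s)"
        using T[OF s] by (auto intro!: derivative_eq_intros dv dz dq dp)
      \<comment> \<open>Squares and cross products are treated as independent atoms, so that
        positivity of the quadratic form becomes linear: each cross term is absorbed by a completed
        square. The bound \<open>d \<ge> 5\<close> enters as \<open>d - 3 \<ge> 2\<close> and
        \<open>d - 1 \<ge> 4\<close>.\<close>
      have quad: "0 \<le> 2 * a + 2 * ab + 6 * b + 2 * bc + 32 * D3 + 32 * D1 - 32 * ce - 32 * en"
        if "0 \<le> a" "0 \<le> b" "0 \<le> c" "0 \<le> e" "0 \<le> a + b + 2 * ab" "0 \<le> b + c + 2 * bc"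
          "0 \<le> c + e - 2 * ce" "0 \<le> e + n - 2 * en" "32 * n \<le> a + b + c" "2 * c \<le> D3" "4 * e \<le> D1"
        for a b c e n ab bc ce en D1 D3 :: real
        using that by linarith
      have "2 * v s * (v s + z s) + 2 * z s * (3 * z s + q s)
          - 16 * (2 * q s * (- (d - 3) * q s + p s) + 2 * p s * (- (d - 1) * p s + N s))
        = 2 * (v s)^2 + 2 * (v s * z s) + 6 * (z s)^2 + 2 * (z s * q s) + 32 * ((d - 3) * (q s)^2)
          + 32 * ((d - 1) * (p s)^2) - 32 * (q s * p s) - 32 * (p s * N s)"
        by (simp add: algebra_simps power2_eq_square)
      also have "\<dots> \<ge> 0"
        using zero_le_power2[of "v s + z s"] zero_le_power2[of "z s + q s"] zero_le_power2[of "q s - p s"]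
          zero_le_power2[of "p s - N s"] N2[OF s] d
        by (intro quad[where c = "(q s)^2" and e = "(p s)^2" and n = "(N s)^2"])
           (simp_all add: power2_sum power2_diff mult.assoc mult_right_mono)
      finally show "2 * v s * (v s + z s) + 2 * z s * (3 * z s + q s)
          - 16 * (2 * q s * (- (d - 3) * q s + p s) + 2 * p s * (- (d - 1) * p s + N s)) \<ge> 0" .
    next
      have "((\<lambda>t. (v t)^2 + (z t)^2 - 16 * ((q t)^2 + (p t)^2)) \<longlongrightarrow> 0^2 + 0^2 - 16 * (0^2 + 0^2)) at_bot"
        by (intro tendsto_intros lim)
      then show "((\<lambda>t. (v t)^2 + (z t)^2 - 16 * ((q t)^2 + (p t)^2)) \<longlongrightarrow> 0) at_bot" by simp
    qed
    then show ?thesis by simp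
  qed
  \<comment> \<open>The slowest expanding mode would allow the rate 2 for squares. Lowering it to
    3/2 leaves \<open>v^2 / 2\<close>, half of which goes into \<open>(v + 4 z)^2 / 4\<close> to
    absorb the cross term in \<open>v\<close> and \<open>z\<close>; the cone condition controls
    \<open>q\<close> with the other half.\<close>
  define F where "F t = ((v t)^2 + 4 * (z t)^2) * exp (- (3/2) * t)" for t
  have F: "F t \<le> F T" if "t \<le> T" for t
    using that
  proof (rule DERIV_nonneg_imp_nondecreasing)
    fix s assume "t \<le> s" and s: "s \<le> T"
    have F': "(F has_real_derivative (2 * v s * (v s + z s) + 8 * z s * (3 * z s + q s)
        - 3/2 * ((v s)^2 + 4 * (z s)^2)) * exp (- (3/2) * s)) (at s)"
      unfolding F_def using T[OF s]
      by (auto intro!: derivative_eq_intros dv dz simp: algebra_simps)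
    have quad: "0 \<le> (1/2) * a + 2 * ab + 18 * b + 8 * bc"
      if "0 \<le> a" "0 \<le> b" "0 \<le> e" "0 \<le> a + 8 * ab + 16 * b" "0 \<le> b + c + 2 * bc" "16 * c + 16 * e \<le> a + b"
      for a b c e ab bc :: real
      using that by linarith
    have "2 * v s * (v s + z s) + 8 * z s * (3 * z s + q s) - 3/2 * ((v s)^2 + 4 * (z s)^2)
        = (1/2) * (v s)^2 + 2 * (v s * z s) + 18 * (z s)^2 + 8 * (z s * q s)"
      by (simp add: algebra_simps power2_eq_square)
    also have "\<dots> \<ge> 0"
    proof (rule quad[where b = "(z s)^2" and c = "(q s)^2" and e = "(p s)^2"])
      show "0 \<le> (v s)^2 + 8 * (v s * z s) + 16 * (z s)^2"
        using zero_le_power2[of "v s + 4 * z s"] by (simp add: power2_eq_square algebra_simps)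
      show "0 \<le> (z s)^2 + (q s)^2 + 2 * (z s * q s)"
        using zero_le_power2[of "z s + q s"] by (simp add: power2_sum mult.assoc)
    qed (use cone[OF s] in auto)
    finally have "2 * v s * (v s + z s) + 8 * z s * (3 * z s + q s) - 3/2 * ((v s)^2 + 4 * (z s)^2) \<ge> 0" .
    then have "0 \<le> (2 * v s * (v s + z s) + 8 * z s * (3 * z s + q s)
        - 3/2 * ((v s)^2 + 4 * (z s)^2)) * exp (- (3/2) * s)"
      by (intro mult_nonneg_nonneg) auto
    with F' show "\<exists>y. (F has_real_derivative y) (at s) \<and> 0 \<le> y" by blast
  qed
  define B where "B = sqrt (F T)"
  have FT: "F T \<ge> 0" by (simp add: F_def)
  have B0: "B \<ge> 0" using FT by (simp add: B_def)
  have vz: "(v t)^2 + 4 * (z t)^2 \<le> (B * exp (3/4 * t))^2" if "t \<le> T" for t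
  proof -
    have "F t * exp (3/2 * t) \<le> F T * exp (3/2 * t)" using F[OF that] by simp
    then show ?thesis using FT
      by (simp add: F_def B_def power_mult_distrib mult.assoc flip: exp_double exp_add)
  qed
  have B: "\<bar>v t\<bar> \<le> B * exp (3/4 * t)" "\<bar>z t\<bar> \<le> B * exp (3/4 * t)" "\<bar>q t\<bar> \<le> B * exp (3/4 * t)"
    if "t \<le> T" for t
  proof -
    have "B * exp (3/4 * t) \<ge> 0" using B0 by simp
    have "(v t)^2 \<ge> 0" "(z t)^2 \<ge> 0" "(p t)^2 \<ge> 0" by auto
    moreover have "16 * (q t)^2 + 16 * (p t)^2 \<le> (v t)^2 + (z t)^2" using cone[OF that] by simp
    ultimately have "(v t)^2 \<le> (B * exp (3/4 * t))^2" "(z t)^2 \<le> (B * exp (3/4 * t))^2"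
      "(q t)^2 \<le> (B * exp (3/4 * t))^2" using vz[OF that] by linarith+
    with \<open>B * exp (3/4 * t) \<ge> 0\<close> show "\<bar>v t\<bar> \<le> B * exp (3/4 * t)" "\<bar>z t\<bar> \<le> B * exp (3/4 * t)" "\<bar>q t\<bar> \<le> B * exp (3/4 * t)"
      by (auto simp: abs_le_square_iff[symmetric])
  qed
  \<comment> \<open>Two factors of size \<open>exp (3/4 * t)\<close> gain 3/2 over the rate
    \<open>\<beta>\<close> of \<open>z\<close> and \<open>q\<close>. The fifth order term has rate
    15/4, whence \<open>\<beta> \<le> 9/4\<close>.\<close>
  have Nb: "\<bar>N t\<bar> \<le> K * (4 * B^2 * (A + A') + 32 * B^5) * exp ((3/2 + \<beta>) * t)"
    if t: "t \<le> T" and \<beta>: "\<beta> \<le> 9/4" and A: "\<bar>z t\<bar> \<le> A * exp (\<beta> * t)" "\<bar>q t\<bar> \<le> A' * exp (\<beta> * t)" for t \<beta> A A'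
  proof -
    define m where "m = \<bar>v t\<bar> + \<bar>z t\<bar>"
    have m: "0 \<le> m" "m \<le> 2 * B * exp (3/4 * t)" using B[OF t] by (auto simp: m_def)
    have "m^2 \<le> (2 * B * exp (3/4 * t))^2" using m by (intro power_mono) auto
    also have "\<dots> = 4 * B^2 * exp (3/2 * t)"
      by (simp add: power_mult_distrib flip: exp_double)
    finally have m2: "m^2 \<le> 4 * B^2 * exp (3/2 * t)" .
    have "m^5 \<le> (2 * B * exp (3/4 * t))^5" using m by (intro power_mono) auto
    also have "\<dots> = 32 * B^5 * exp (15/4 * t)"
      by (simp add: power_mult_distrib flip: exp_of_nat_mult)
    also have "\<dots> \<le> 32 * B^5 * exp ((3/2 + \<beta>) * t)"
    proof -
      have "15/4 * t \<le> (3/2 + \<beta>) * t" using \<beta> T(2)[OF t] by (intro mult_right_mono_neg) auto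
      then show ?thesis using B0 by (intro mult_left_mono) auto
    qed
    finally have m5: "m^5 \<le> 32 * B^5 * exp ((3/2 + \<beta>) * t)" .
    have "m^2 * (\<bar>z t\<bar> + \<bar>q t\<bar>) \<le> (4 * B^2 * exp (3/2 * t)) * ((A + A') * exp (\<beta> * t))"
      using m2 A by (intro mult_mono) (auto simp: algebra_simps)
    also have "\<dots> = 4 * B^2 * (A + A') * exp ((3/2 + \<beta>) * t)"
      by (simp add: distrib_right distrib_left exp_add)
    finally have "K * (m^2 * (\<bar>z t\<bar> + \<bar>q t\<bar>) + m^5) \<le>
        K * (4 * B^2 * (A + A') * exp ((3/2 + \<beta>) * t) + 32 * B^5 * exp ((3/2 + \<beta>) * t))"
      using m5 K by (intro mult_left_mono add_mono) auto
    with N[OF T(1)[OF t]] show ?thesis by (simp add: m_def algebra_simps)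
  qed
  have step: "\<exists>C. \<forall>t\<le>T. \<bar>q t\<bar> \<le> C * exp (\<alpha> * t)"
    if "\<alpha> > 0" and NC: "\<And>t. t \<le> T \<Longrightarrow> \<bar>N t\<bar> \<le> C * exp (\<alpha> * t)" for C \<alpha>
  proof -
    have "\<bar>p t\<bar> \<le> C / (\<alpha> + (d - 1)) * exp (\<alpha> * t)" if "t \<le> T" for t
      using d by (intro damped_decay[OF _ \<open>\<alpha> > 0\<close> dp[OF T(1)] NC lim(4) that]) auto
    then have "\<bar>q t\<bar> \<le> C / (\<alpha> + (d - 1)) / (\<alpha> + (d - 3)) * exp (\<alpha> * t)" if "t \<le> T" for t
      using d by (intro damped_decay[OF _ \<open>\<alpha> > 0\<close> dq[OF T(1)] _ lim(3) that]) auto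
    then show ?thesis by blast
  qed
  \<comment> \<open>The rates improve from 3/4 to 9/4 and then to 15/4. The value 9/4 is still below
    the exponent 3, so \<open>z\<close> inherits it; 15/4 exceeds 3, so
    \<open>q * exp (- 3 * t)\<close> is integrable, and it is the derivative of
    \<open>z * exp (- 3 * t)\<close>.\<close>
  obtain Cq where Cq: "\<And>t. t \<le> T \<Longrightarrow> \<bar>q t\<bar> \<le> Cq * exp (9/4 * t)"
  proof -
    have "\<bar>N t\<bar> \<le> K * (4 * B^2 * (B + B) + 32 * B^5) * exp (9/4 * t)" if "t \<le> T" for t
      using Nb[OF that _ B(2,3)[OF that]] by simp
    from step[OF _ this] that show thesis by auto
  qed
  obtain Cz where Cz: "\<And>t. t \<le> T \<Longrightarrow> \<bar>z t\<bar> \<le> Cz * exp (9/4 * t)"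
    using growing_decay[OF _ T0 dz[OF T(1)] Cq] by auto
  obtain C where C: "\<And>t. t \<le> T \<Longrightarrow> \<bar>q t\<bar> \<le> C * exp (15/4 * t)"
  proof -
    have "\<bar>N t\<bar> \<le> K * (4 * B^2 * (Cz + Cq) + 32 * B^5) * exp (15/4 * t)" if "t \<le> T" for t
      using Nb[OF that _ Cz[OF that] Cq[OF that]] by simp
    from step[OF _ this] that show thesis by auto
  qed
  have qe: "\<bar>q t * exp (- 3 * t)\<bar> \<le> C * exp (3/4 * t)" if "t \<le> T" for t
  proof -
    have "\<bar>q t\<bar> * exp (- 3 * t) \<le> C * exp (15/4 * t) * exp (- 3 * t)"
      using C[OF that] by simp
    then show ?thesis by (simp add: abs_mult mult.assoc flip: exp_add)
  qed
  have ze: "\<bar>z t * exp (- t)\<bar> \<le> Cz * exp (5/4 * t)" if "t \<le> T" for t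
  proof -
    have "\<bar>z t\<bar> * exp (- t) \<le> Cz * exp (9/4 * t) * exp (- t)"
      using Cz[OF that] by simp
    then show ?thesis by (simp add: abs_mult mult.assoc flip: exp_add)
  qed
  show "((\<lambda>t. q t * exp (- 3 * t)) \<longlongrightarrow> 0) at_bot"
  proof (rule Lim_null_comparison)
    show "\<forall>\<^sub>F t in at_bot. norm (q t * exp (- 3 * t)) \<le> C * exp (3/4 * t)"
      using qe by (auto simp: eventually_at_bot_linorder)
    show "((\<lambda>t. C * exp (3/4 * t)) \<longlongrightarrow> 0) at_bot"
      using tendsto_mult[OF tendsto_const[of C] tendsto_exp_at_bot[of "3/4"]] by simp
  qed
  show "\<exists>b. ((\<lambda>t. z t * exp (- 3 * t)) \<longlongrightarrow> b) at_bot"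
  proof (rule convergent_at_bot[OF _ T0 _ qe])
    show "((\<lambda>t. z t * exp (- 3 * t)) has_real_derivative q t * exp (- 3 * t)) (at t)" if "t \<le> T" for t
      using T[OF that] by (auto intro!: derivative_eq_intros dz simp: algebra_simps)
  qed simp
  show "\<exists>a. ((\<lambda>t. v t * exp (- t)) \<longlongrightarrow> a) at_bot"
  proof (rule convergent_at_bot[OF _ T0 _ ze])
    show "((\<lambda>t. v t * exp (- t)) has_real_derivative z t * exp (- t)) (at t)" if "t \<le> T" for t
      using T[OF that] by (auto intro!: derivative_eq_intros dv simp: algebra_simps)
  qed simp
qed

section \<open>Euler equations and regularity at the origin\<close>

lemma at_within_Ioc_eq_at: "0 < x \<Longrightarrow> x < 1 \<Longrightarrow> at x within {0<..1} = at (x::real)"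
  by (rule at_within_open_subset[of x "{0<..<1}"]) auto

lemma at_within_Ioc_eq_Icc: "0 < x \<Longrightarrow> at x within {0<..1} = at x within {0..1::real}"
  by (rule at_within_nhd[of x "{0<..}"]) auto

lemma at_within_Icc_nontrivial: "x \<in> {0..1} \<Longrightarrow> at x within {0..1::real} \<noteq> bot"
  using connected_imp_perfect[of "{0..1}" x] by (auto simp: trivial_limit_within)

lemma at_within_Ioc_nontrivial: "x \<in> {0<..1} \<Longrightarrow> at x within {0<..1::real} \<noteq> bot"
  using at_within_Icc_nontrivial[of x] by (simp add: at_within_Ioc_eq_Icc)

text \<open>By the mean value theorem the difference quotient at \<open>0\<close> is a value of
  \<open>f'\<close> at an intermediate point, and \<open>f'\<close> is continuous at
  \<open>0\<close>.\<close>

lemma has_real_derivative_extend_at_0: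
  fixes f f' :: "real \<Rightarrow> real"
  assumes f: "continuous_on {0..1} f" and f': "continuous_on {0..1} f'"
    and der: "\<And>x. x \<in> {0<..1} \<Longrightarrow> (f has_real_derivative f' x) (at x within {0<..1})"
    and x: "x \<in> {0..1}"
  shows "(f has_real_derivative f' x) (at x within {0..1})"
proof (cases "x = 0")
  case False
  then have "(f has_real_derivative f' x) (at x within {0<..1})" using der x by auto
  moreover have "at x within {0<..1} = at x within {0..1}"
    using False x by (intro at_within_Ioc_eq_Icc) auto
  ultimately show ?thesis by simp
next
  case True
  have der': "(f has_real_derivative f' y) (at y)" if "0 < y" "y < 1" for y
    using der[of y] that by (simp add: at_within_Ioc_eq_at)
  have lim: "((\<lambda>y. (f y - f 0) / (y - 0)) \<longlongrightarrow> f' 0) (at 0 within {0..1})"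
    unfolding tendsto_iff
  proof (intro allI impI)
    fix e :: real assume "e > 0"
    then obtain \<delta> where \<delta>: "\<delta> > 0" "\<And>y. y \<in> {0..1} \<Longrightarrow> dist y 0 < \<delta> \<Longrightarrow> dist (f' y) (f' 0) < e"
      using f'[unfolded continuous_on_iff, rule_format, of 0 e] by auto
    show "\<forall>\<^sub>F y in at 0 within {0..1}. dist ((f y - f 0) / (y - 0)) (f' 0) < e"
      unfolding eventually_at
    proof (intro exI[of _ \<delta>] conjI ballI impI \<delta>(1))
      fix y :: real assume y: "y \<in> {0..1}" "y \<noteq> 0 \<and> dist y 0 < \<delta>"
      have "continuous_on {0..y} f" using f y(1) by (rule_tac continuous_on_subset[OF f]) auto
      then obtain z where z: "0 < z" "z < y" "f y - f 0 = (y - 0) * f' z"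
      proof -
        have "f differentiable (at x)" if "0 < x" "x < y" for x
          using der'[of x] that y(1) by (auto simp: real_differentiable_def)
        then obtain l z where "0 < z" "z < y" "(f has_real_derivative l) (at z)" "f y - f 0 = (y - 0) * l"
          using MVT[of 0 y f] y \<open>continuous_on {0..y} f\<close> by auto
        moreover from this have "l = f' z" using DERIV_unique der'[of z] y(1) by auto
        ultimately show thesis using that by blast
      qed
      have "dist (f' z) (f' 0) < e" using \<delta>(2)[of z] z y by (auto simp: dist_real_def)
      then show "dist ((f y - f 0) / (y - 0)) (f' 0) < e" using z by simp
    qed
  qed
  then show ?thesis unfolding True has_field_derivative_iff .
qed

text \<open>The equation says that \<open>x powr b * f x\<close> has derivative
  \<open>x powr (b - 1) * g x\<close>, so l'Hopital's rule applies to its quotient by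
  \<open>x powr b\<close>. The limit hypothesis excludes the homogeneous solution
  \<open>x powr (- b)\<close>.\<close>

lemma damped_limit_at_0:
  fixes f g :: "real \<Rightarrow> real"
  assumes b: "b > 0" and g: "continuous_on {0..1} g"
    and der: "\<And>x. x \<in> {0<..1} \<Longrightarrow> (f has_real_derivative f' x) (at x within {0<..1})"
    and eq: "\<And>x. x \<in> {0<..1} \<Longrightarrow> x * f' x + b * f x = g x"
    and lim: "((\<lambda>x. x powr b * f x) \<longlongrightarrow> 0) (at_right 0)"
  shows "(f \<longlongrightarrow> g 0 / b) (at_right 0)"
proof -
  have ev: "\<forall>\<^sub>F x in at_right 0. x \<in> {0<..<1::real}"
    by (rule eventually_at_right_real) simp
  have der': "(f has_real_derivative f' y) (at y)" if "0 < y" "y < 1" for y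
    using der[of y] that by (simp add: at_within_Ioc_eq_at)
  have "((\<lambda>x. (x powr b * f x) / (x powr b)) \<longlongrightarrow> g 0 / b) (at_right 0)"
  proof (rule lhopital_right_0[where f' = "\<lambda>x. x powr (b - 1) * g x" and g' = "\<lambda>x. b * x powr (b - 1)"])
    show "((\<lambda>x. x powr b * f x) \<longlongrightarrow> 0) (at_right 0)" by (rule lim)
    have "((\<lambda>x::real. x powr b) \<longlongrightarrow> 0 powr b) (at_right 0)"
      using b by (intro tendsto_powr') (auto simp: eventually_at_filter)
    then show "((\<lambda>x::real. x powr b) \<longlongrightarrow> 0) (at_right 0)" using b by simp
    show "\<forall>\<^sub>F x::real in at_right 0. x powr b \<noteq> 0"
      using ev by eventually_elim auto
    show "\<forall>\<^sub>F x::real in at_right 0. b * x powr (b - 1) \<noteq> 0"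
      using ev by eventually_elim (use b in auto)
    show "\<forall>\<^sub>F x in at_right 0. ((\<lambda>x. x powr b * f x) has_real_derivative x powr (b - 1) * g x) (at x)"
      using ev
    proof eventually_elim
      case (elim x)
      have "x powr b = x powr (b - 1) * x" using elim by (simp add: powr_diff)
      moreover have "g x = x * f' x + b * f x" using eq[of x] elim by simp
      ultimately show ?case using elim
        by (auto intro!: derivative_eq_intros der' simp: algebra_simps)
    qed
    show "\<forall>\<^sub>F x in at_right 0. ((\<lambda>x. x powr b) has_real_derivative b * x powr (b - 1)) (at x)"
      using ev by eventually_elim (auto intro!: derivative_eq_intros)
    have "(g \<longlongrightarrow> g 0) (at_right 0)"
      using g by (auto simp: continuous_on_def at_within_Icc_at_right dest: bspec[of _ _ 0])
    then have "((\<lambda>x. g x / b) \<longlongrightarrow> g 0 / b) (at_right 0)" by (intro tendsto_intros) (use b in auto)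
    moreover have "\<forall>\<^sub>F x in at_right 0. g x / b = x powr (b - 1) * g x / (b * x powr (b - 1))"
      using ev by eventually_elim auto
    ultimately show "((\<lambda>x. x powr (b - 1) * g x / (b * x powr (b - 1))) \<longlongrightarrow> g 0 / b) (at_right 0)"
      by (rule Lim_transform_eventually)
  qed
  moreover have "\<forall>\<^sub>F x in at_right 0. (x powr b * f x) / (x powr b) = f x"
    using ev by eventually_elim auto
  ultimately show ?thesis by (rule Lim_transform_eventually)
qed

lemma continuous_on_extend_at_0:
  fixes f :: "real \<Rightarrow> real"
  assumes "continuous_on {0<..1} f" "(f \<longlongrightarrow> l) (at_right 0)"
  shows "continuous_on {0..1} (\<lambda>x. if x = 0 then l else f x)"
proof -
  have "continuous (at x within {0..1}) (\<lambda>x. if x = 0 then l else f x)" if "x \<in> {0..1}" for x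
  proof (cases "x = 0")
    case True
    have "((\<lambda>x. if x = 0 then l else f x) \<longlongrightarrow> l) (at_right 0)"
      using assms(2) by (rule Lim_transform_eventually) (auto simp: eventually_at_filter)
    then show ?thesis using True by (simp add: continuous_within at_within_Icc_at_right)
  next
    case False
    have isCont_within: "continuous (at x within {0<..1}) f"
      using assms(1) False that by (auto simp: continuous_on_eq_continuous_within)
    have "continuous (at x within {0<..1}) (\<lambda>x. if x = 0 then l else f x)"
      by (rule continuous_transform_within[OF isCont_within, of 1]) (use False that in auto)
    moreover have "at x within {0<..1} = at x within {0..1}"
      using False that by (intro at_within_Ioc_eq_Icc) auto
    ultimately show ?thesis by simp
  qed
  then show ?thesis by (simp add: continuous_on_eq_continuous_within)
qed

text \<open>The solution of the Euler equation \<open>x f' + b f = g\<close> that is not too singular at \<open>0\<close> is as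
  smooth as \<open>g\<close>, because \<open>f'\<close> solves the same equation with \<open>b + 1\<close> and \<open>g'\<close>.\<close>

lemma euler_equation_regularity:
  fixes F G :: "nat \<Rightarrow> real \<Rightarrow> real" and g :: "real \<Rightarrow> real"
  assumes "b > 0" and "C_k_on k {0..1} g"
    and "\<And>j x. x \<in> {0<..1} \<Longrightarrow> (F j has_real_derivative F (Suc j) x) (at x within {0<..1})"
    and "\<And>x. x \<in> {0<..1} \<Longrightarrow> x * F 1 x + b * F 0 x = g x"
    and "((\<lambda>x. x powr b * F 0 x) \<longlongrightarrow> 0) (at_right 0)"
  shows "C_k_on k {0..1} (\<lambda>x. if x = 0 then g 0 / b else F 0 x)"
  using assms
proof (induction k arbitrary: b g F)
  case 0
  have "continuous_on {0<..1} (F 0)"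
    using 0(3) by (rule DERIV_continuous_on)
  moreover have "(F 0 \<longlongrightarrow> g 0 / b) (at_right 0)"
    using damped_limit_at_0[OF 0(1) _ 0(3)[of _ 0] _ 0(5), of g] 0(2,4) by simp
  ultimately show ?case by (simp add: continuous_on_extend_at_0)
next
  case (Suc k)
  obtain g' where g': "\<And>x. x \<in> {0..1} \<Longrightarrow> (g has_real_derivative g' x) (at x within {0..1})"
    "C_k_on k {0..1} g'"
    by (rule C_k_on_SucE_real[OF Suc.prems(2)]) (rule that)
  let ?f = "\<lambda>x. if x = 0 then g 0 / b else F 0 x"
  let ?f' = "\<lambda>x. if x = 0 then g' 0 / (b + 1) else F 1 x"
  have cont: "continuous_on {0..1} g" using C_k_on_continuous[OF Suc.prems(2)] .
  have lim: "(F 0 \<longlongrightarrow> g 0 / b) (at_right 0)"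
    using damped_limit_at_0[OF Suc.prems(1) cont Suc.prems(3)[of _ 0] _ Suc.prems(5)]
      Suc.prems(4) by simp
  have ev: "\<forall>\<^sub>F x in at_right 0. x \<in> {0<..<1::real}"
    by (rule eventually_at_right_real) simp
  have C': "C_k_on k {0..1} (\<lambda>x. if x = 0 then g' 0 / (b + 1) else (\<lambda>j. F (Suc j)) 0 x)"
  proof (rule Suc.IH[of "b + 1" g' "\<lambda>j. F (Suc j)"])
    show "x * F (Suc 1) x + (b + 1) * F (Suc 0) x = g' x" if x: "x \<in> {0<..1}" for x
    proof -
      have "((\<lambda>x. x * F 1 x + b * F 0 x) has_real_derivative
          (x * F (Suc 1) x + F 1 x) + b * F 1 x) (at x within {0<..1})"
        using Suc.prems(3)[OF x, of 0] Suc.prems(3)[OF x, of 1]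
        by (auto intro!: derivative_eq_intros)
      moreover have "(g has_real_derivative g' x) (at x within {0<..1})"
        by (rule DERIV_subset[OF g'(1)]) (use x in auto)
      then have "((\<lambda>x. x * F 1 x + b * F 0 x) has_real_derivative g' x) (at x within {0<..1})"
        by (rule has_field_derivative_transform_within[where d = 1]) (use x Suc.prems(4) in auto)
      moreover have "at x within {0<..1} \<noteq> bot"
        using x by (rule at_within_Ioc_nontrivial)
      ultimately show ?thesis
        using vector_derivative_unique_within[of x "{0<..1}"]
        by (auto simp: has_real_derivative_iff_has_vector_derivative algebra_simps)
    qed
    \<comment> \<open>The growth condition for \<open>f'\<close> with exponent \<open>b + 1\<close>
      follows from the equation itself: \<open>x * f' = g - b * f\<close>, and the right-hand side
      stays bounded near \<open>0\<close>.\<close>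
    have "((\<lambda>x. x powr b * (g x - b * F 0 x)) \<longlongrightarrow> 0 powr b * (g 0 - b * (g 0 / b))) (at_right 0)"
      using Suc.prems(1) cont lim
      by (intro tendsto_intros tendsto_powr')
         (auto simp: eventually_at_filter continuous_on_def at_within_Icc_at_right dest: bspec[of _ _ 0])
    moreover have "\<forall>\<^sub>F x in at_right 0. x powr b * (g x - b * F 0 x) = x powr (b + 1) * F (Suc 0) x"
      using ev
    proof eventually_elim
      case (elim x)
      then have "g x - b * F 0 x = x * F (Suc 0) x" using Suc.prems(4)[of x] by simp
      then show ?case using elim by (simp add: powr_add)
    qed
    ultimately show "((\<lambda>x. x powr (b + 1) * F (Suc 0) x) \<longlongrightarrow> 0) (at_right 0)"
      using Suc.prems(1) Lim_transform_eventually by fastforce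
  qed (use Suc.prems g' in auto)
  show ?case
  proof (rule C_k_on_SucI_real)
    show "C_k_on k {0..1} ?f'" unfolding One_nat_def using C' .
    then have "continuous_on {0..1} ?f'" by (rule C_k_on_continuous)
    moreover have "continuous_on {0..1} ?f"
      using lim Suc.prems(3) by (intro continuous_on_extend_at_0 DERIV_continuous_on)
    moreover have "(?f has_real_derivative ?f' x) (at x within {0<..1})" if "x \<in> {0<..1}" for x
    proof -
      have "(F 0 has_real_derivative ?f' x) (at x within {0<..1})"
        using Suc.prems(3)[OF that, of 0] that by simp
      then show ?thesis
        by (rule has_field_derivative_transform_within[where d = 1]) (use that in auto)
    qed
    ultimately show "(?f has_real_derivative ?f' x) (at x within {0..1})" if "x \<in> {0..1}" for x
      using that by (intro has_real_derivative_extend_at_0[where f' = ?f'])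
  qed
qed

text \<open>Transfers one order of smoothness from \<open>(0,1]\<close> to \<open>[0,1]\<close>:
  continuity of \<open>f\<close> and of the extended derivative makes the latter the derivative at
  \<open>0\<close> too.\<close>

lemma C_k_on_extension_SucI:
  assumes f: "continuous_on {0..1} f" and g: "C_k_on k {0..1} g"
    and eq: "\<And>s. s \<in> {0<..1} \<Longrightarrow> f s = F s"
    and der: "\<And>s. s \<in> {0<..1} \<Longrightarrow> (F has_real_derivative g s) (at s within {0<..1})"
  shows "C_k_on (Suc k) {0..1} f"
proof (rule C_k_on_SucI_real[OF _ g])
  have "(f has_real_derivative g s) (at s within {0<..1})" if "s \<in> {0<..1}" for s
    by (rule has_field_derivative_transform_within[OF der[OF that], of 1]) (use that eq in auto)
  then show "(f has_real_derivative g s) (at s within {0..1})" if "s \<in> {0..1}" for s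
    using has_real_derivative_extend_at_0[OF f C_k_on_continuous[OF g] _ that] by blast
qed

lemma tendsto_at_right_0_of_at_bot:
  assumes "((\<lambda>t. f ((exp t)\<^sup>2)) \<longlongrightarrow> l) at_bot"
  shows "(f \<longlongrightarrow> l) (at_right (0::real))"
proof -
  have "filterlim (\<lambda>s::real. ln s / 2) at_bot (at_right 0)"
    using filterlim_tendsto_pos_mult_at_bot[OF tendsto_const[of "1/2"] _ ln_at_0] by simp
  from filterlim_compose[OF assms this]
  have "((\<lambda>s. f ((exp (ln s / 2))\<^sup>2)) \<longlongrightarrow> l) (at_right 0)" .
  moreover have "\<forall>\<^sub>F s in at_right (0::real). f ((exp (ln s / 2))\<^sup>2) = f s"
    unfolding eventually_at_filter by (simp add: exp_double[symmetric])
  ultimately show ?thesis by (rule Lim_transform_eventually)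
qed

section \<open>The Laplacian of equivariant maps\<close>

lemma open_line_preimage_ball: "open {t::real. (y::'a::real_normed_vector) + t *\<^sub>R b \<in> ball 0 1}"
  unfolding vimage_def[symmetric] by (intro open_vimage continuous_intros) auto

lemma partial_deriv_eqI:
  assumes eq: "\<And>z. z \<in> ball 0 1 \<Longrightarrow> f z = g z" and y: "y \<in> ball 0 1"
    and der: "((\<lambda>t. g (y + t *\<^sub>R b)) has_vector_derivative D) (at 0)"
  shows "partial_deriv b f y = D"
proof -
  have "((\<lambda>t. f (y + t *\<^sub>R b)) has_vector_derivative D) (at 0)"
    by (rule has_vector_derivative_transform_within_open[OF der open_line_preimage_ball[of y b]])
       (use eq y in auto)
  then show ?thesis unfolding partial_deriv_def by (rule vector_derivative_at)
qed

text \<open>\<open>G\<close> is differentiable only within \<open>[0,1]\<close>, and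
  \<open>y = 0\<close> lands on the endpoint \<open>0\<close>. The chain rule is therefore applied
  within the open set of those \<open>t\<close> whose point lies in the ball; its image stays in
  \<open>[0,1]\<close>.\<close>

lemma has_real_derivative_radial:
  fixes y b :: "'a::real_inner"
  assumes G: "\<And>s. s \<in> {0..1} \<Longrightarrow> (G has_real_derivative G' s) (at s within {0..1})"
    and y: "y \<in> ball 0 1"
  shows "((\<lambda>t. G ((y + t *\<^sub>R b) \<bullet> (y + t *\<^sub>R b))) has_real_derivative 2 * (b \<bullet> y) * G' (y \<bullet> y)) (at 0)"
proof -
  let ?T = "{t::real. y + t *\<^sub>R b \<in> ball 0 1}"
  let ?\<sigma> = "\<lambda>t::real. (y + t *\<^sub>R b) \<bullet> (y + t *\<^sub>R b)"
  have le1: "z \<bullet> z \<in> {0..1}" if "z \<in> ball 0 1" for z :: 'a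
    using that by (simp add: dot_square_norm power_le_one)
  have at: "at 0 within ?T = at 0"
    using y open_line_preimage_ball[of y b] by (intro at_within_open) auto
  have "(?\<sigma> has_real_derivative 2 * (b \<bullet> y)) (at 0 within ?T)"
    unfolding at by (auto intro!: derivative_eq_intros simp: has_field_derivative_def inner_commute)
  moreover have "(G has_real_derivative G' (y \<bullet> y)) (at (?\<sigma> 0) within ?\<sigma> ` ?T)"
    using le1[OF y] y by (auto intro!: DERIV_subset[OF G] le1)
  ultimately have "(G \<circ> ?\<sigma> has_real_derivative G' (y \<bullet> y) * (2 * (b \<bullet> y))) (at 0 within ?T)"
    by (intro DERIV_image_chain)
  then show ?thesis unfolding at by (simp add: o_def mult_ac)
qed

text \<open>The result has the same form as \<open>f\<close>, with \<open>G\<close> and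
  \<open>H\<close> replaced by explicit combinations of their derivatives, so the lemma can be
  applied a second time to reach the bilaplacian.\<close>

lemma laplacian_equivariant:
  fixes f :: "real ^ 'n \<Rightarrow> (real ^ 'n) \<times> real"
  assumes G: "\<And>s. s \<in> {0..1} \<Longrightarrow> (G has_real_derivative G1 s) (at s within {0..1})"
      "\<And>s. s \<in> {0..1} \<Longrightarrow> (G1 has_real_derivative G2 s) (at s within {0..1})"
    and H: "\<And>s. s \<in> {0..1} \<Longrightarrow> (H has_real_derivative H1 s) (at s within {0..1})"
      "\<And>s. s \<in> {0..1} \<Longrightarrow> (H1 has_real_derivative H2 s) (at s within {0..1})"
    and f: "\<And>x. x \<in> ball 0 1 \<Longrightarrow> f x = (G (x \<bullet> x) *\<^sub>R x, H (x \<bullet> x))"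
    and x: "x \<in> ball 0 1"
  shows "laplacian f x =
    ((4 * (x \<bullet> x) * G2 (x \<bullet> x) + (2 * real CARD('n) + 4) * G1 (x \<bullet> x)) *\<^sub>R x,
     4 * (x \<bullet> x) * H2 (x \<bullet> x) + 2 * real CARD('n) * H1 (x \<bullet> x))"
proof -
  note rad = has_real_derivative_radial
  define P where "P b y = ((2 * (b \<bullet> y) * G1 (y \<bullet> y)) *\<^sub>R y + G (y \<bullet> y) *\<^sub>R b, 2 * (b \<bullet> y) * H1 (y \<bullet> y))"
    for b y :: "real ^ 'n"
  have P: "partial_deriv b f y = P b y" if y: "y \<in> ball 0 1" for b y
  proof (rule partial_deriv_eqI[OF f y])
    show "((\<lambda>t. (G ((y + t *\<^sub>R b) \<bullet> (y + t *\<^sub>R b)) *\<^sub>R (y + t *\<^sub>R b), H ((y + t *\<^sub>R b) \<bullet> (y + t *\<^sub>R b))))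
        has_vector_derivative P b y) (at 0)"
      unfolding P_def
      by (rule has_vector_derivative_Pair)
         (auto intro!: derivative_eq_intros rad[OF G(1) y] rad[OF H(1) y]
            simp flip: has_real_derivative_iff_has_vector_derivative)
  qed
  have PP: "partial_deriv b (partial_deriv b f) x =
      ((2 * G1 (x \<bullet> x)) *\<^sub>R x + (4 * (b \<bullet> x)\<^sup>2 * G2 (x \<bullet> x)) *\<^sub>R x + (4 * G1 (x \<bullet> x)) *\<^sub>R ((b \<bullet> x) *\<^sub>R b),
       2 * H1 (x \<bullet> x) + 4 * (b \<bullet> x)\<^sup>2 * H2 (x \<bullet> x))"
    (is "_ = (?A, ?B)") if b: "b \<in> Basis" for b
  proof (rule partial_deriv_eqI[OF P x])
    have bb: "b \<bullet> b = 1" using b by simp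
    have lin: "((\<lambda>t. b \<bullet> (x + t *\<^sub>R b)) has_real_derivative 1) (at 0)"
      using bb by (auto intro!: derivative_eq_intros simp: inner_right_distrib)
    show "((\<lambda>t. P b (x + t *\<^sub>R b)) has_vector_derivative (?A, ?B)) (at 0)"
      unfolding P_def
    proof (rule has_vector_derivative_Pair)
      show "((\<lambda>t. (2 * (b \<bullet> (x + t *\<^sub>R b)) * G1 ((x + t *\<^sub>R b) \<bullet> (x + t *\<^sub>R b))) *\<^sub>R (x + t *\<^sub>R b)
          + G ((x + t *\<^sub>R b) \<bullet> (x + t *\<^sub>R b)) *\<^sub>R b) has_vector_derivative ?A) (at 0)"
      proof -
        have 1: "((\<lambda>t. 2 * (b \<bullet> (x + t *\<^sub>R b)) * G1 ((x + t *\<^sub>R b) \<bullet> (x + t *\<^sub>R b)))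
            has_real_derivative 2 * G1 (x \<bullet> x) + 4 * (b \<bullet> x)\<^sup>2 * G2 (x \<bullet> x)) (at 0)"
          using DERIV_mult[OF DERIV_cmult[OF lin, of 2] rad[OF G(2) x], of b]
          by (simp add: power2_eq_square mult_ac)
        have 2: "((\<lambda>t. x + t *\<^sub>R b) has_vector_derivative b) (at 0)"
          by (auto intro!: derivative_eq_intros)
        have 3: "((\<lambda>t. b) has_vector_derivative 0) (at 0)"
          by (auto intro!: derivative_eq_intros)
        have "(4 * G1 (x \<bullet> x)) *\<^sub>R (b \<bullet> x) *\<^sub>R b
            = (2 * (b \<bullet> x) * G1 (x \<bullet> x)) *\<^sub>R b + (2 * (b \<bullet> x) * G1 (x \<bullet> x)) *\<^sub>R b"
          unfolding scaleR_left_distrib[symmetric] by simp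
        then have eq: "(2 * (b \<bullet> x) * G1 (x \<bullet> x)) *\<^sub>R b + (2 * G1 (x \<bullet> x) + 4 * (b \<bullet> x)\<^sup>2 * G2 (x \<bullet> x)) *\<^sub>R x
            + (2 * (b \<bullet> x) * G1 (x \<bullet> x)) *\<^sub>R b = ?A"
          by (simp only: scaleR_left_distrib add_ac)
        from has_vector_derivative_add[OF has_vector_derivative_scaleR[OF 1 2]
            has_vector_derivative_scaleR[OF rad[OF G(1) x, where b = b] 3]]
        show ?thesis
          unfolding scaleR_zero_left scaleR_zero_right add_0_left add_0_right eq .
      qed
      show "((\<lambda>t. 2 * (b \<bullet> (x + t *\<^sub>R b)) * H1 ((x + t *\<^sub>R b) \<bullet> (x + t *\<^sub>R b))) has_vector_derivative ?B) (at 0)"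
        unfolding has_real_derivative_iff_has_vector_derivative[symmetric]
        using DERIV_mult[OF DERIV_cmult[OF lin, of 2] rad[OF H(2) x], of b]
        by (simp add: power2_eq_square mult_ac)
    qed
  qed
  have sq: "(\<Sum>b\<in>Basis. (b \<bullet> x)\<^sup>2) = x \<bullet> x"
    by (subst euclidean_inner) (simp add: power2_eq_square inner_commute)
  have rep: "(\<Sum>b\<in>Basis. (b \<bullet> x) *\<^sub>R b) = x"
    using euclidean_representation[of x] by (simp add: inner_commute)
  have 1: "(\<Sum>b\<in>(Basis::(real ^ 'n) set). (2 * G1 (x \<bullet> x)) *\<^sub>R x) = (real CARD('n) * (2 * G1 (x \<bullet> x))) *\<^sub>R x"
    unfolding sum_constant_scaleR by simp
  have 2: "(\<Sum>b\<in>Basis. (4 * (b \<bullet> x)\<^sup>2 * G2 (x \<bullet> x)) *\<^sub>R x) = (4 * (x \<bullet> x) * G2 (x \<bullet> x)) *\<^sub>R x"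
    by (simp only: scaleR_sum_left[symmetric] sum_distrib_right[symmetric] sum_distrib_left[symmetric] sq)
  have 3: "(\<Sum>b\<in>Basis. (4 * G1 (x \<bullet> x)) *\<^sub>R ((b \<bullet> x) *\<^sub>R b)) = (4 * G1 (x \<bullet> x)) *\<^sub>R x"
    by (simp only: scaleR_sum_right[symmetric] rep)
  have 4: "(\<Sum>b\<in>(Basis::(real ^ 'n) set). 2 * H1 (x \<bullet> x)) = real CARD('n) * (2 * H1 (x \<bullet> x))"
    by simp
  have 5: "(\<Sum>b\<in>Basis. 4 * (b \<bullet> x)\<^sup>2 * H2 (x \<bullet> x)) = 4 * (x \<bullet> x) * H2 (x \<bullet> x)"
    by (simp only: sum_distrib_right[symmetric] sum_distrib_left[symmetric] sq)
  have "laplacian f x = (\<Sum>b\<in>Basis.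
      ((2 * G1 (x \<bullet> x)) *\<^sub>R x + (4 * (b \<bullet> x)\<^sup>2 * G2 (x \<bullet> x)) *\<^sub>R x + (4 * G1 (x \<bullet> x)) *\<^sub>R ((b \<bullet> x) *\<^sub>R b),
       2 * H1 (x \<bullet> x) + 4 * (b \<bullet> x)\<^sup>2 * H2 (x \<bullet> x)))"
    unfolding laplacian_def using PP by (rule sum.cong[OF refl])
  also have "\<dots> = ((real CARD('n) * (2 * G1 (x \<bullet> x))) *\<^sub>R x + (4 * (x \<bullet> x) * G2 (x \<bullet> x)) *\<^sub>R x
        + (4 * G1 (x \<bullet> x)) *\<^sub>R x,
       real CARD('n) * (2 * H1 (x \<bullet> x)) + 4 * (x \<bullet> x) * H2 (x \<bullet> x))"
    by (simp only: sum_prod sum.distrib 1 2 3 4 5)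
  also have "\<dots> = ((4 * (x \<bullet> x) * G2 (x \<bullet> x) + (2 * real CARD('n) + 4) * G1 (x \<bullet> x)) *\<^sub>R x,
     4 * (x \<bullet> x) * H2 (x \<bullet> x) + 2 * real CARD('n) * H1 (x \<bullet> x))"
    unfolding scaleR_left_distrib[symmetric]
    by (intro arg_cong2[of _ _ _ _ Pair] arg_cong2[of _ _ _ _ scaleR]) (simp_all add: distrib_right)
  finally show ?thesis .
qed

section \<open>Regularity of the profile\<close>

lemma exp_power_chain_derivative:
  fixes F :: "real \<Rightarrow> real"
  assumes "(F has_real_derivative F') (at ((exp t)\<^sup>2))"
  shows "((\<lambda>t. exp t ^ n * F ((exp t)\<^sup>2)) has_real_derivative
    real n * (exp t ^ n * F ((exp t)\<^sup>2)) + 2 * (exp t ^ (n + 2) * F')) (at t)"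
proof -
  have "((\<lambda>t. (exp t)\<^sup>2) has_real_derivative 2 * (exp t)\<^sup>2) (at t)"
    by (auto intro!: derivative_eq_intros simp: power2_eq_square)
  with assms have A: "((\<lambda>t. F ((exp t)\<^sup>2)) has_real_derivative F' * (2 * (exp t)\<^sup>2)) (at t)"
    by (rule DERIV_chain2)
  have "((\<lambda>t. exp t ^ n) has_real_derivative real n * exp t ^ n) (at t)"
    unfolding exp_of_nat_mult[symmetric] by (auto intro!: derivative_eq_intros)
  from DERIV_mult[OF this A] show ?thesis by (simp add: power_add power2_eq_square algebra_simps)
qed

lemma exp_square_bounds: "t < 0 \<Longrightarrow> 0 < (exp t)\<^sup>2" "t < 0 \<Longrightarrow> (exp t)\<^sup>2 < (1::real)"
  by (auto simp: power_less_one_iff)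

lemma DERIV_unique_transfer:
  assumes "\<And>t. t < 0 \<Longrightarrow> f t = g t" "(f has_real_derivative a) (at t)" "(g has_real_derivative b) (at t)" "t < (0::real)"
  shows "a = b"
proof -
  have "(g has_real_derivative a) (at t)"
    by (rule has_field_derivative_transform_within_open[OF assms(2), of "{..<0}"]) (use assms in auto)
  then show ?thesis using assms(3) by (rule DERIV_unique)
qed

text \<open>\<open>A\<close>, \<open>B\<close> stand for \<open>sin v\<close>, \<open>cos v\<close>,
  and the \<open>S\<close>, \<open>C\<close> for their first four derivatives in
  \<open>t = ln r\<close>. With \<open>D = d/dt\<close>, the left bracket is
  \<open>(D - 1) (D - 3) (D + d - 3) (D + d - 1)\<close> applied to \<open>sin v\<close>, the right
  one \<open>D (D - 2) (D + d - 4) (D + d - 2)\<close> applied to \<open>cos v\<close>: these are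
  \<open>r^4\<close> times the bilaplacian on degree one harmonics and on radial functions. The
  equation says that the component along the tangent direction \<open>(cos v, - sin v)\<close>
  vanishes.\<close>

lemma cos_sin_bilaplacian_identity:
  fixes A B v1 v2 v3 v4 d :: real
  assumes "A^2 + B^2 = 1"
    and "v4 = 6 * v3 - 11 * v2 + 6 * v1 + 6 * v1^2 * (v2 - v1) + 2 * (d - 1) * (v1^3 - (v3 - 3 * v2 + 2 * v1))
      - (d - 1) * ((d - (B^2 - A^2) - 4) * (v2 - v1) + (2 * A * B) * v1^2)
      + (d - 3) * (d - 1) * ((B^2 - A^2) + 2) * v1 - 3 / 2 * (d - 3) * (d - 1) * (2 * A * B)"
    and S: "S1 = B * v1" "S2 = - A * v1^2 + B * v2" "S3 = - B * v1^3 - 3 * A * v1 * v2 + B * v3"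
      "S4 = A * v1^4 - 6 * B * v1^2 * v2 - A * (3 * v2^2 + 4 * v1 * v3) + B * v4"
    and C: "C1 = - A * v1" "C2 = - B * v1^2 - A * v2" "C3 = A * v1^3 - 3 * B * v1 * v2 - A * v3"
      "C4 = B * v1^4 + 6 * A * v1^2 * v2 - B * (3 * v2^2 + 4 * v1 * v3) - A * v4"
  shows "B * (S4 + (2 * d - 8) * S3 + ((d - 1) * (d - 3) - 4 * (2 * d - 4) + 3) * S2
      + (3 * (2 * d - 4) - 4 * (d - 1) * (d - 3)) * S1 + 3 * (d - 1) * (d - 3) * A)
    = A * (C4 + (2 * d - 8) * C3 + ((d - 4) * (d - 2) - 2 * (2 * d - 6)) * C2 - 2 * (d - 4) * (d - 2) * C1)"
proof -
  \<comment> \<open>Only the combinations \<open>B * S - A * C\<close> simplify under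
    \<open>A^2 + B^2 = 1\<close>. The excess of the left operator over the right one has order two
    and is kept separately.\<close>
  have X: "B * S1 - A * C1 = v1" "B * S2 - A * C2 = v2" "B * S3 - A * C3 = v3 - v1^3"
    "B * S4 - A * C4 = v4 - 6 * v1^2 * v2"
    unfolding S C using assms(1) by algebra+
  have "B * (S4 + (2 * d - 8) * S3 + ((d - 1) * (d - 3) - 4 * (2 * d - 4) + 3) * S2
      + (3 * (2 * d - 4) - 4 * (d - 1) * (d - 3)) * S1 + 3 * (d - 1) * (d - 3) * A)
    - A * (C4 + (2 * d - 8) * C3 + ((d - 4) * (d - 2) - 2 * (2 * d - 6)) * C2 - 2 * (d - 4) * (d - 2) * C1)
    = (B * S4 - A * C4) + (2 * d - 8) * (B * S3 - A * C3)
      + ((d - 4) * (d - 2) - 2 * (2 * d - 6)) * (B * S2 - A * C2) - 2 * (d - 4) * (d - 2) * (B * S1 - A * C1)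
      + ((d - 1) * (d - 3) - 4 * (2 * d - 4) + 3 - ((d - 4) * (d - 2) - 2 * (2 * d - 6))) * (B * S2)
      + (3 * (2 * d - 4) - 4 * (d - 1) * (d - 3) + 2 * (d - 4) * (d - 2)) * (B * S1)
      + 3 * (d - 1) * (d - 3) * (A * B)"
    by algebra
  also have "\<dots> = 0"
    unfolding X unfolding S(1,2) using assms(1,2) by algebra
  finally show ?thesis by simp
qed

text \<open>The profile is \<open>\<psi> r = r * \<Phi> 0 (r\<^sup>2)\<close>, \<open>\<Phi> k\<close> is the \<open>k\<close>-th derivative of \<open>\<Phi> 0\<close>, and
  \<open>p, \<dots>, p4\<close> are \<open>\<psi>\<close> and its first four derivatives.\<close>

locale biharmonic_profile =
  fixes \<Phi> :: "nat \<Rightarrow> real \<Rightarrow> real" and d :: real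
  assumes d: "5 \<le> d" "d \<le> 7"
    and chain: "\<And>k s. s \<in> {0<..1} \<Longrightarrow> (\<Phi> k has_real_derivative \<Phi> (Suc k) s) (at s within {0<..1})"
    and small: "((\<lambda>r. r * \<Phi> 0 (r^2)) \<longlongrightarrow> 0) (at_right 0)"
    and ode: "\<And>r p p1 p2 p3 p4. 0 < r \<Longrightarrow> r < 1 \<Longrightarrow>
      p = r * \<Phi> 0 (r^2) \<Longrightarrow>
      p1 = \<Phi> 0 (r^2) + 2 * r^2 * \<Phi> 1 (r^2) \<Longrightarrow>
      p2 = 6 * r * \<Phi> 1 (r^2) + 4 * r^3 * \<Phi> 2 (r^2) \<Longrightarrow>
      p3 = 6 * \<Phi> 1 (r^2) + 24 * r^2 * \<Phi> 2 (r^2) + 8 * r^4 * \<Phi> 3 (r^2) \<Longrightarrow>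
      p4 = 60 * r * \<Phi> 2 (r^2) + 80 * r^3 * \<Phi> 3 (r^2) + 16 * r^5 * \<Phi> 4 (r^2) \<Longrightarrow>
      p4 = 6 * p1^2 * p2 + 2 * (d - 1) / r * (p1^3 - p3)
        - (d - 1) / r^2 * ((d - cos (2 * p) - 4) * p2 + sin (2 * p) * p1^2)
        + (d - 3) * (d - 1) / r^3 * (cos (2 * p) + 2) * p1
        - 3 * (d - 3) * (d - 1) / (2 * r^4) * sin (2 * p)"
begin

text \<open>With \<open>r = exp t\<close> these are the monomials
  \<open>r^n \<Phi>\<^sub>k(r^2)\<close>. Differentiation in \<open>t\<close> maps them to
  combinations of themselves, which is the source of the integer coefficients below.\<close>

definition E :: "nat \<Rightarrow> nat \<Rightarrow> real \<Rightarrow> real" where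
  "E n k t = exp t ^ n * \<Phi> k ((exp t)\<^sup>2)"

lemma E_derivative:
  assumes "t < 0"
  shows "(E n k has_real_derivative real n * E n k t + 2 * E (n + 2) (Suc k) t) (at t)"
  unfolding E_def[abs_def]
  using chain[of "(exp t)\<^sup>2" k] exp_square_bounds[OF assms]
  by (intro exp_power_chain_derivative) (simp add: at_within_Ioc_eq_at)

definition V0 where "V0 t = E 1 0 t"
definition V1 where "V1 t = E 1 0 t + 2 * E 3 1 t"
definition V2 where "V2 t = E 1 0 t + 8 * E 3 1 t + 4 * E 5 2 t"
definition V3 where "V3 t = E 1 0 t + 26 * E 3 1 t + 36 * E 5 2 t + 8 * E 7 3 t"
definition V4 where "V4 t = E 1 0 t + 80 * E 3 1 t + 232 * E 5 2 t + 128 * E 7 3 t + 16 * E 9 4 t"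

lemmas V_defs = V0_def V1_def V2_def V3_def V4_def

lemma V_derivative:
  assumes "t < 0"
  shows "(V0 has_real_derivative V1 t) (at t)" "(V1 has_real_derivative V2 t) (at t)"
    "(V2 has_real_derivative V3 t) (at t)" "(V3 has_real_derivative V4 t) (at t)"
proof -
  note E' = E_derivative[OF assms]
  show "(V0 has_real_derivative V1 t) (at t)" "(V1 has_real_derivative V2 t) (at t)"
    "(V2 has_real_derivative V3 t) (at t)" "(V3 has_real_derivative V4 t) (at t)"
    unfolding V_defs[abs_def]
    using E'[of 1 0] E'[of 3 1] E'[of 5 2] E'[of 7 3]
    by (auto intro!: derivative_eq_intros simp: eval_nat_numeral)
qed

text \<open>Multiplying the equation by \<open>r^4\<close> removes all explicit powers of
  \<open>r\<close> once \<open>r^k\<close> times the \<open>k\<close>-th derivative is expressed by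
  \<open>t\<close>-derivatives.\<close>

lemma V_ode:
  assumes "t < 0"
  shows "V4 t = 6 * V3 t - 11 * V2 t + 6 * V1 t + 6 * (V1 t)^2 * (V2 t - V1 t)
    + 2 * (d - 1) * ((V1 t)^3 - (V3 t - 3 * V2 t + 2 * V1 t))
    - (d - 1) * ((d - cos (2 * V0 t) - 4) * (V2 t - V1 t) + sin (2 * V0 t) * (V1 t)^2)
    + (d - 3) * (d - 1) * (cos (2 * V0 t) + 2) * V1 t
    - 3 / 2 * (d - 3) * (d - 1) * sin (2 * V0 t)"
proof -
  define r where "r = exp t"
  have r: "0 < r" "r < 1" using assms by (auto simp: r_def)
  define p p1 p2 p3 p4 where "p = r * \<Phi> 0 (r^2)"
    and "p1 = \<Phi> 0 (r^2) + 2 * r^2 * \<Phi> 1 (r^2)"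
    and "p2 = 6 * r * \<Phi> 1 (r^2) + 4 * r^3 * \<Phi> 2 (r^2)"
    and "p3 = 6 * \<Phi> 1 (r^2) + 24 * r^2 * \<Phi> 2 (r^2) + 8 * r^4 * \<Phi> 3 (r^2)"
    and "p4 = 60 * r * \<Phi> 2 (r^2) + 80 * r^3 * \<Phi> 3 (r^2) + 16 * r^5 * \<Phi> 4 (r^2)"
  note p = this
  have V: "V0 t = p" "V1 t = r * p1" "V2 t = r * p1 + r^2 * p2" "V3 t = r * p1 + 3 * r^2 * p2 + r^3 * p3"
    "V4 t = r * p1 + 7 * r^2 * p2 + 6 * r^3 * p3 + r^4 * p4"
    unfolding V_defs p E_def r_def[symmetric] by (simp_all add: algebra_simps eval_nat_numeral)
  define c s where "c = cos (2 * p)" and "s = sin (2 * p)"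
  have "r^4 * p4 = r^4 * (6 * p1^2 * p2 + 2 * (d - 1) / r * (p1^3 - p3)
        - (d - 1) / r^2 * ((d - c - 4) * p2 + s * p1^2)
        + (d - 3) * (d - 1) / r^3 * (c + 2) * p1 - 3 * (d - 3) * (d - 1) / (2 * r^4) * s)"
    using ode[OF r p] by (simp add: c_def s_def)
  also have "\<dots> = 6 * r^4 * p1^2 * p2 + 2 * (d - 1) * r^3 * (p1^3 - p3)
        - (d - 1) * r^2 * ((d - c - 4) * p2 + s * p1^2)
        + (d - 3) * (d - 1) * r * (c + 2) * p1 - 3 / 2 * (d - 3) * (d - 1) * s"
    using r by (simp add: field_simps eval_nat_numeral)
  finally show ?thesis
    unfolding V c_def[symmetric] s_def[symmetric] by algebra
qed

text \<open>The linearized operator factors as \<open>(D - 1) (D - 3) (D + d - 3) (D + d - 1)\<close> with \<open>D = r d/dr\<close>;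
  the variables below are obtained from \<open>V0\<close> by applying these factors in turn.\<close>

definition Z where "Z t = 2 * E 3 1 t"
definition Q where "Q t = 4 * E 5 2 t"
definition P where "P t = 8 * E 7 3 t + 4 * (d + 2) * E 5 2 t"
definition N where "N t = 16 * E 9 4 t + (64 + 16 * d) * E 7 3 t + 4 * (d + 2) * (d + 4) * E 5 2 t"

lemma ZQP_eq: "V1 t = V0 t + Z t" "V2 t = V0 t + 4 * Z t + Q t"
  "V3 t = V0 t + 13 * Z t + 9 * Q t + (P t - (d + 2) * Q t)"
  by (simp_all add: V_defs Z_def Q_def P_def)

lemma ZQP_derivative:
  assumes "t < 0"
  shows "(V0 has_real_derivative V0 t + Z t) (at t)" "(Z has_real_derivative 3 * Z t + Q t) (at t)"
    "(Q has_real_derivative - (d - 3) * Q t + P t) (at t)"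
    "(P has_real_derivative - (d - 1) * P t + N t) (at t)"
proof -
  note E' = E_derivative[OF assms]
  show "(V0 has_real_derivative V0 t + Z t) (at t)" "(Z has_real_derivative 3 * Z t + Q t) (at t)"
    "(Q has_real_derivative - (d - 3) * Q t + P t) (at t)"
    "(P has_real_derivative - (d - 1) * P t + N t) (at t)"
    unfolding V0_def[abs_def] Z_def[abs_def] Q_def[abs_def] P_def[abs_def] N_def
    using E'[of 1 0] E'[of 3 1] E'[of 5 2] E'[of 7 3]
    by (auto intro!: derivative_eq_intros simp: eval_nat_numeral algebra_simps)
qed

text \<open>The nonlinearity \<open>N\<close> divided by \<open>r^5\<close>. The argument
  \<open>h\<close> takes the value \<open>s \<phi>''\<close>: it is kept apart from \<open>s\<close>
  because \<open>\<phi>''\<close> alone is not yet known to be bounded near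
  \<open>0\<close>.\<close>

definition RHS :: "real \<Rightarrow> real \<Rightarrow> real \<Rightarrow> real \<Rightarrow> real" where
  "RHS s f f1 h =
     6 * (f + 2 * s * f1)^2 * (4 * h + 6 * f1)
     - 4 * (d - 1) * f^2 * trig_ser 2 (4 * s * f^2) * (4 * h + 6 * f1)
     + (d - 1) * (f + 2 * s * f1)^2 * (4 * f1 + 8 * f^3 * trig_ser 3 (4 * s * f^2))
     + (d - 3) * (d - 1) * (f^5 * (16 * trig_ser 4 (4 * s * f^2) - 48 * trig_ser 5 (4 * s * f^2))
         - 8 * f^2 * trig_ser 2 (4 * s * f^2) * f1)"

text \<open>The resonant term \<open>r\<^sup>3\<close>, which would produce a logarithm, is absent: each term either contains
  a factor \<open>Z\<close> or \<open>Q\<close> or is of fifth order.\<close>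

lemma N_eq:
  assumes "t < 0"
  shows "N t = 6 * (V0 t + Z t)^2 * (3 * Z t + Q t)
     - 4 * (d - 1) * (V0 t)^2 * trig_ser 2 (4 * (V0 t)^2) * (3 * Z t + Q t)
     + (d - 1) * (V0 t + Z t)^2 * (2 * Z t + 8 * (V0 t)^3 * trig_ser 3 (4 * (V0 t)^2))
     + (d - 3) * (d - 1) * ((V0 t)^5 * (16 * trig_ser 4 (4 * (V0 t)^2) - 48 * trig_ser 5 (4 * (V0 t)^2))
         - 4 * (V0 t)^2 * trig_ser 2 (4 * (V0 t)^2) * Z t)"
proof -
  define v z q e2 e3 e4 e5 where "v = V0 t" and "z = Z t" and "q = Q t"
    and "e2 = trig_ser 2 (4 * v^2)" and "e3 = trig_ser 3 (4 * v^2)"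
    and "e4 = trig_ser 4 (4 * v^2)" and "e5 = trig_ser 5 (4 * v^2)"
  note df = this
  define c s where "c = cos (2 * v)" and "s = sin (2 * v)"
  \<comment> \<open>The short expansions serve in the terms with a factor \<open>z\<close> or
    \<open>q\<close> and in \<open>2 * v - s\<close>, which is multiplied by a square. In
    \<open>(c - 1) * v - 3 / 2 * (s - 2 * v)\<close> the long ones are needed: the cubic terms
    \<open>-2 v^3\<close> and \<open>+2 v^3\<close> cancel and fifth order remains.\<close>
  have "c = 1 - 4 * v^2 * e2" "s = 2 * v - 8 * v^3 * e3" "c = 1 - 2 * v^2 + 16 * v^4 * e4"
    "s = 2 * v - 4 / 3 * v^3 + 32 * v^5 * e5"
    using trig_ser_taylor[of "2 * v"] by (simp_all add: df c_def s_def power_mult_distrib)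
  note cs = this
  have "N t = V4 t + (2 * d - 8) * V3 t + ((d - 1) * (d - 3) - 4 * (2 * d - 4) + 3) * V2 t
      + (3 * (2 * d - 4) - 4 * (d - 1) * (d - 3)) * V1 t + 3 * (d - 1) * (d - 3) * V0 t"
    unfolding N_def V_defs by algebra
  also have "\<dots> = 6 * (V1 t)^2 * (V2 t - V1 t) - (d - 1) * (1 - c) * (V2 t - V1 t)
      + (d - 1) * (V1 t)^2 * (2 * V1 t - s)
      + (d - 3) * (d - 1) * ((c - 1) * (V1 t - V0 t) + ((c - 1) * V0 t - 3 / 2 * (s - 2 * V0 t)))"
    unfolding V_ode[OF assms] v_def[symmetric] c_def[symmetric] s_def[symmetric] by algebra
  also have "\<dots> = 6 * (v + z)^2 * (3 * z + q) - (d - 1) * (1 - c) * (3 * z + q)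
      + (d - 1) * (v + z)^2 * (2 * z + (2 * v - s))
      + (d - 3) * (d - 1) * ((c - 1) * z + ((c - 1) * v - 3 / 2 * (s - 2 * v)))"
    unfolding ZQP_eq df by algebra
  also have "1 - c = 4 * v^2 * e2" using cs by simp
  also have "2 * v - s = 8 * v^3 * e3" using cs by simp
  also have "(c - 1) * z = - (4 * v^2 * e2) * z" using cs(1) by simp
  also have "(c - 1) * v - 3 / 2 * (s - 2 * v) = v^5 * (16 * e4 - 48 * e5)"
    unfolding cs(3) cs(4) by (simp add: algebra_simps eval_nat_numeral)
  finally show ?thesis unfolding df by (simp add: algebra_simps)
qed

lemma N_eq_RHS:
  assumes "t < 0"
  shows "N t = exp t ^ 5 * RHS ((exp t)^2) (\<Phi> 0 ((exp t)^2)) (\<Phi> 1 ((exp t)^2)) ((exp t)^2 * \<Phi> 2 ((exp t)^2))"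
proof -
  define r f f1 f2 where "r = exp t" and "f = \<Phi> 0 (r^2)" and "f1 = \<Phi> 1 (r^2)" and "f2 = \<Phi> 2 (r^2)"
  note df = this
  have V: "V0 t = r * f" "Z t = 2 * r^3 * f1" "Q t = 4 * r^5 * f2"
    by (simp_all add: V0_def Z_def Q_def E_def df)
  have arg: "4 * (r * f)^2 = 4 * r^2 * f^2" by (simp add: power_mult_distrib)
  show ?thesis
    unfolding N_eq[OF assms] V arg RHS_def df(2-4)[symmetric] df(1)[symmetric] by algebra
qed


section \<open>Decay at the origin and the limits of the profile and its derivatives\<close>

lemma V0_tendsto: "(V0 \<longlongrightarrow> 0) at_bot"
proof -
  have "filterlim (exp :: real \<Rightarrow> real) (at_right 0) at_bot"
    unfolding at_within_def filterlim_inf filterlim_principal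
    using exp_at_bot by (auto simp: at_within_def)
  from filterlim_compose[OF small this] show ?thesis
    by (simp add: V0_def[abs_def] E_def)
qed

lemma V_tendsto: "(V1 \<longlongrightarrow> 0) at_bot" "(V2 \<longlongrightarrow> 0) at_bot" "(V3 \<longlongrightarrow> 0) at_bot"
proof -
  have cont: "continuous_on {..<0} V4"
    unfolding V4_def[abs_def]
    by (intro continuous_intros continuous_at_imp_continuous_on ballI DERIV_isCont[OF E_derivative]) auto
  \<comment> \<open>The range of \<open>d\<close> bounds the coefficients \<open>d - 1\<close> and
    \<open>(d - 3) * (d - 1)\<close> by 6 and 24; 1000 is a generous common constant. The term
    \<open>sin (2 * V0 t)\<close> must be estimated by \<open>V0\<close> in the last summand, where
    no derivative accompanies it.\<close>
  have bd: "\<bar>V4 t\<bar> \<le> 1000 * (\<bar>V1 t\<bar>^2 * \<bar>V2 t\<bar> + \<bar>V1 t\<bar>^3 + \<bar>V3 t\<bar> + \<bar>V2 t\<bar>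
      + \<bar>V1 t\<bar>^2 + \<bar>V1 t\<bar> + \<bar>V0 t\<bar>)" if t: "t < 0" for t
  proof -
    define c s where "c = cos (2 * V0 t)" and "s = sin (2 * V0 t)"
    define a0 a1 a2 a3 where "a0 = \<bar>V0 t\<bar>" and "a1 = \<bar>V1 t\<bar>" and "a2 = \<bar>V2 t\<bar>" and "a3 = \<bar>V3 t\<bar>"
    note df = this
    have c: "\<bar>c\<bar> \<le> 1" and s1: "\<bar>s\<bar> \<le> 1" by (auto simp: c_def s_def)
    have s: "\<bar>s\<bar> \<le> 2 * a0" using abs_sin_x_le_abs_x[of "2 * V0 t"] by (simp add: s_def df)
    have a: "a0 \<ge> 0" "a1 \<ge> 0" "a2 \<ge> 0" "a3 \<ge> 0" by (auto simp: df)
    have e: "\<bar>V2 t - V1 t\<bar> \<le> a2 + a1" unfolding df by linarith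
    have 1: "\<bar>6 * V3 t - 11 * V2 t + 6 * V1 t\<bar> \<le> 6 * a3 + 11 * a2 + 6 * a1" unfolding df by linarith
    have "\<bar>6 * (V1 t)^2 * (V2 t - V1 t)\<bar> = 6 * a1^2 * \<bar>V2 t - V1 t\<bar>" by (simp add: abs_mult df)
    also have "\<dots> \<le> 6 * a1^2 * (a2 + a1)" using e by (intro mult_left_mono) auto
    finally have 2: "\<bar>6 * (V1 t)^2 * (V2 t - V1 t)\<bar> \<le> 6 * (a1^2 * a2) + 6 * a1^3"
      by (simp add: algebra_simps eval_nat_numeral)
    have "\<bar>(V1 t)^3 - (V3 t - 3 * V2 t + 2 * V1 t)\<bar> \<le> \<bar>(V1 t)^3\<bar> + (a3 + 3 * a2 + 2 * a1)"
      unfolding df by linarith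
    also have "\<bar>(V1 t)^3\<bar> = a1^3" by (simp add: df power_abs)
    finally have "2 * (d - 1) * \<bar>(V1 t)^3 - (V3 t - 3 * V2 t + 2 * V1 t)\<bar> \<le> 12 * (a1^3 + (a3 + 3 * a2 + 2 * a1))"
      using d a by (intro mult_mono) auto
    then have 3: "\<bar>2 * (d - 1) * ((V1 t)^3 - (V3 t - 3 * V2 t + 2 * V1 t))\<bar> \<le> 12 * a1^3 + 12 * a3 + 36 * a2 + 24 * a1"
      using d by (simp add: abs_mult)
    have "\<bar>(d - c - 4) * (V2 t - V1 t) + s * (V1 t)^2\<bar> \<le> \<bar>d - c - 4\<bar> * \<bar>V2 t - V1 t\<bar> + \<bar>s\<bar> * a1^2"
      using abs_triangle_ineq[of "(d - c - 4) * (V2 t - V1 t)" "s * (V1 t)^2"] by (simp add: abs_mult df)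
    also have "\<dots> \<le> 4 * (a2 + a1) + 1 * a1^2"
      using e s1 c d by (intro add_mono mult_mono) auto
    finally have "(d - 1) * \<bar>(d - c - 4) * (V2 t - V1 t) + s * (V1 t)^2\<bar> \<le> 6 * (4 * (a2 + a1) + 1 * a1^2)"
      using d a by (intro mult_mono) auto
    then have 4: "\<bar>(d - 1) * ((d - c - 4) * (V2 t - V1 t) + s * (V1 t)^2)\<bar> \<le> 24 * a2 + 24 * a1 + 6 * a1^2"
      using d by (simp add: abs_mult)
    have dd: "0 \<le> (d - 3) * (d - 1)" "(d - 3) * (d - 1) \<le> 4 * 6"
      using d by (simp, intro mult_mono) auto
    have "(d - 3) * (d - 1) * (\<bar>c + 2\<bar> * a1) \<le> (4 * 6) * (3 * a1)"
      by (rule mult_mono[OF dd(2)]) (use c a in \<open>auto intro: mult_right_mono\<close>)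
    then have 5: "\<bar>(d - 3) * (d - 1) * (c + 2) * V1 t\<bar> \<le> 72 * a1"
      using d by (simp add: abs_mult df mult.assoc)
    have "(d - 3) * (d - 1) * \<bar>s\<bar> \<le> (4 * 6) * (2 * a0)"
      by (rule mult_mono[OF dd(2)]) (use s a in auto)
    moreover have "\<bar>3 / 2 * (d - 3) * (d - 1) * s\<bar> = 3 / 2 * ((d - 3) * (d - 1) * \<bar>s\<bar>)"
    proof -
      have "\<bar>3 / 2 * (D * s)\<bar> = 3 / 2 * (D * \<bar>s\<bar>)" if "D \<ge> 0" for D
        using that by (simp add: abs_mult)
      from this[OF dd(1)] show ?thesis by (simp only: mult.assoc)
    qed
    ultimately have 6: "\<bar>3 / 2 * (d - 3) * (d - 1) * s\<bar> \<le> 72 * a0" by linarith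
    have tri: "\<bar>x1 + x2 + x3 - x4 + x5 - x6\<bar> \<le> b1 + b2 + b3 + b4 + b5 + b6"
      if "\<bar>x1\<bar> \<le> b1" "\<bar>x2\<bar> \<le> b2" "\<bar>x3\<bar> \<le> b3" "\<bar>x4\<bar> \<le> b4" "\<bar>x5\<bar> \<le> b5" "\<bar>x6\<bar> \<le> b6"
      for x1 x2 x3 x4 x5 x6 b1 b2 b3 b4 b5 b6 :: real using that by linarith
    have "a1^2 * a2 \<ge> 0" "a1^3 \<ge> 0" "a1^2 \<ge> 0" using a by auto
    with tri[OF 1 2 3 4 5 6] a have "\<bar>V4 t\<bar> \<le> 1000 * (a1^2 * a2) + 1000 * a1^3 + 1000 * a3 + 1000 * a2
      + 1000 * a1^2 + 1000 * a1 + 1000 * a0"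
      unfolding V_ode[OF t] c_def[symmetric] s_def[symmetric] by linarith
    then show ?thesis by (simp add: df algebra_simps)
  qed
  show "(V1 \<longlongrightarrow> 0) at_bot" "(V2 \<longlongrightarrow> 0) at_bot" "(V3 \<longlongrightarrow> 0) at_bot"
    using derivatives_tendsto_zero[OF _ V_derivative cont V0_tendsto bd] by auto
qed

lemma ZQP_tendsto: "(Z \<longlongrightarrow> 0) at_bot" "(Q \<longlongrightarrow> 0) at_bot" "(P \<longlongrightarrow> 0) at_bot"
proof -
  have "Z = (\<lambda>t. V1 t - V0 t)" "Q = (\<lambda>t. V2 t - 4 * V1 t + 3 * V0 t)"
    "P = (\<lambda>t. V3 t + (d - 7) * V2 t - 4 * (d - 3) * V1 t + 3 * V1 t + 3 * (d - 3) * V0 t)"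
    by (auto simp: V_defs Z_def Q_def P_def algebra_simps)
  moreover have "((\<lambda>t. V1 t - V0 t) \<longlongrightarrow> 0 - 0) at_bot"
    "((\<lambda>t. V2 t - 4 * V1 t + 3 * V0 t) \<longlongrightarrow> 0 - 4 * 0 + 3 * 0) at_bot"
    "((\<lambda>t. V3 t + (d - 7) * V2 t - 4 * (d - 3) * V1 t + 3 * V1 t + 3 * (d - 3) * V0 t) \<longlongrightarrow>
      0 + (d - 7) * 0 - 4 * (d - 3) * 0 + 3 * 0 + 3 * (d - 3) * 0) at_bot"
    by (intro tendsto_intros V0_tendsto V_tendsto)+
  ultimately show "(Z \<longlongrightarrow> 0) at_bot" "(Q \<longlongrightarrow> 0) at_bot" "(P \<longlongrightarrow> 0) at_bot"
    by simp_all
qed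

text \<open>For \<open>\<bar>V0 t\<bar> \<le> 1\<close> the arguments of \<open>trig_ser\<close> lie
  in \<open>[0,4]\<close>, where the series are bounded by compactness; the rest is counting factors
  in \<open>N_eq\<close>.\<close>

lemma N_bound:
  "\<exists>K\<ge>1. \<forall>t<0. \<bar>V0 t\<bar> \<le> 1 \<longrightarrow>
    \<bar>N t\<bar> \<le> K * ((\<bar>V0 t\<bar> + \<bar>Z t\<bar>)^2 * (\<bar>Z t\<bar> + \<bar>Q t\<bar>) + (\<bar>V0 t\<bar> + \<bar>Z t\<bar>)^5)"
proof -
  have "\<exists>C. \<forall>x\<in>{0..4}. \<bar>trig_ser k x\<bar> \<le> C" for k
  proof -
    have "compact (trig_ser k ` {0..4})"
      by (intro compact_continuous_image C_k_on_continuous[OF C_k_on_trig_ser]) auto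
    from compact_imp_bounded[OF this] show ?thesis by (auto simp: bounded_iff)
  qed
  then obtain Ck where Ck: "\<And>k x. x \<in> {0..4} \<Longrightarrow> \<bar>trig_ser k x\<bar> \<le> Ck k" by metis
  define C where "C = 1 + \<bar>Ck 2\<bar> + \<bar>Ck 3\<bar> + \<bar>Ck 4\<bar> + \<bar>Ck 5\<bar>"
  have C1: "C \<ge> 1" by (simp add: C_def)
  have C: "\<bar>trig_ser k x\<bar> \<le> C" if "x \<in> {0..4}" "k \<in> {2,3,4,5}" for k x
    using Ck[OF that(1), of k] that(2) by (auto simp: C_def)
  have "\<bar>N t\<bar> \<le> 2000 * C * ((\<bar>V0 t\<bar> + \<bar>Z t\<bar>)^2 * (\<bar>Z t\<bar> + \<bar>Q t\<bar>) + (\<bar>V0 t\<bar> + \<bar>Z t\<bar>)^5)"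
    if t: "t < 0" and small: "\<bar>V0 t\<bar> \<le> 1" for t
  proof -
    define v z q e2 e3 e4 e5 where "v = V0 t" and "z = Z t" and "q = Q t"
      and "e2 = trig_ser 2 (4 * v^2)" and "e3 = trig_ser 3 (4 * v^2)"
      and "e4 = trig_ser 4 (4 * v^2)" and "e5 = trig_ser 5 (4 * v^2)"
    note df = this
    have "4 * v^2 \<in> {0..4}" using small by (simp add: df abs_square_le_1)
    then have e: "\<bar>e2\<bar> \<le> C" "\<bar>e3\<bar> \<le> C" "\<bar>e4\<bar> \<le> C" "\<bar>e5\<bar> \<le> C" unfolding df by (auto intro: C)
    define m w where "m = \<bar>v\<bar> + \<bar>z\<bar>" and "w = \<bar>z\<bar> + \<bar>q\<bar>"
    have mw: "m \<ge> 0" "w \<ge> 0" "\<bar>v\<bar> \<le> m" "\<bar>v + z\<bar> \<le> m" "\<bar>z\<bar> \<le> w" unfolding m_def w_def by linarith+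
    have "\<bar>3 * z + q\<bar> \<le> 3 * \<bar>z\<bar> + 3 * \<bar>q\<bar>" by linarith
    then have w3: "\<bar>3 * z + q\<bar> \<le> 3 * w" by (simp add: w_def)
    have y2: "\<bar>v + z\<bar>^2 \<le> m^2" and v2: "\<bar>v\<bar>^2 \<le> m^2" and v3: "\<bar>v\<bar>^3 \<le> m^3" and v5: "\<bar>v\<bar>^5 \<le> m^5"
      by (rule power_mono[OF mw(4) abs_ge_zero] power_mono[OF mw(3) abs_ge_zero])+
    have d': "\<bar>d - 1\<bar> \<le> 6" "\<bar>(d - 3) * (d - 1)\<bar> \<le> 4 * 6"
      unfolding abs_mult using d by (simp, intro mult_mono) auto
    have "\<bar>v + z\<bar>^2 * \<bar>3 * z + q\<bar> \<le> m^2 * (3 * w)"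
      using y2 mw w3 by (intro mult_mono) auto
    then have 1: "\<bar>6 * (v + z)^2 * (3 * z + q)\<bar> \<le> 18 * (m^2 * w)"
      by (simp add: abs_mult mult_ac)
    have "\<bar>d - 1\<bar> * (\<bar>v\<bar>^2 * (\<bar>e2\<bar> * \<bar>3 * z + q\<bar>)) \<le> 6 * (m^2 * (C * (3 * w)))"
      by (intro mult_mono' d'(1) v2 e(1) w3 mult_nonneg_nonneg abs_ge_zero zero_le_power)
    moreover have "\<bar>4 * (d - 1) * v^2 * e2 * (3 * z + q)\<bar>
        = 4 * (\<bar>d - 1\<bar> * (\<bar>v\<bar>^2 * (\<bar>e2\<bar> * \<bar>3 * z + q\<bar>)))"
      by (simp only: abs_mult power_abs abs_numeral mult.assoc)
    moreover have "6 * (m^2 * (C * (3 * w))) = 18 * (C * (m^2 * w))" by simp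
    ultimately have 2: "\<bar>4 * (d - 1) * v^2 * e2 * (3 * z + q)\<bar> \<le> 72 * (C * (m^2 * w))"
      by linarith
    have "\<bar>2 * z + 8 * v^3 * e3\<bar> \<le> \<bar>2 * z\<bar> + \<bar>8 * v^3 * e3\<bar>" by (rule abs_triangle_ineq)
    also have "\<dots> \<le> 2 * w + 8 * (m^3 * C)"
    proof -
      have "\<bar>8 * v^3 * e3\<bar> = 8 * (\<bar>v\<bar>^3 * \<bar>e3\<bar>)" by (simp only: abs_mult power_abs abs_numeral mult.assoc)
      moreover have "\<bar>v\<bar>^3 * \<bar>e3\<bar> \<le> m^3 * C"
        by (intro mult_mono' v3 e(2) abs_ge_zero zero_le_power)
      moreover have "\<bar>2 * z\<bar> \<le> 2 * w" using mw(5) by (simp add: abs_mult)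
      ultimately show ?thesis by linarith
    qed
    finally have "\<bar>d - 1\<bar> * (\<bar>v + z\<bar>^2 * \<bar>2 * z + 8 * v^3 * e3\<bar>) \<le> 6 * (m^2 * (2 * w + 8 * (m^3 * C)))"
      by (intro mult_mono' d'(1) y2 mult_nonneg_nonneg abs_ge_zero zero_le_power)
    moreover have "\<bar>(d - 1) * (v + z)^2 * (2 * z + 8 * v^3 * e3)\<bar>
        = \<bar>d - 1\<bar> * (\<bar>v + z\<bar>^2 * \<bar>2 * z + 8 * v^3 * e3\<bar>)"
      by (simp only: abs_mult power_abs mult.assoc)
    moreover have "6 * (m^2 * (2 * w + 8 * (m^3 * C))) = 12 * (m^2 * w) + 48 * (C * m^5)"
      by algebra
    ultimately have 3: "\<bar>(d - 1) * (v + z)^2 * (2 * z + 8 * v^3 * e3)\<bar> \<le> 12 * (m^2 * w) + 48 * (C * m^5)"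
      by linarith
    have "\<bar>16 * e4 - 48 * e5\<bar> \<le> 64 * C" using e by linarith
    then have 41: "\<bar>v\<bar>^5 * \<bar>16 * e4 - 48 * e5\<bar> \<le> m^5 * (64 * C)"
      by (intro mult_mono' v5 abs_ge_zero zero_le_power)
    have "\<bar>v\<bar>^2 * (\<bar>e2\<bar> * \<bar>z\<bar>) \<le> m^2 * (C * w)" by (intro mult_mono' v2 e(1) mw(5) mult_nonneg_nonneg abs_ge_zero zero_le_power)
    then have "\<bar>v^5 * (16 * e4 - 48 * e5)\<bar> + \<bar>4 * v^2 * e2 * z\<bar> \<le> m^5 * (64 * C) + 4 * (m^2 * (C * w))"
    proof -
      have "\<bar>v^5 * (16 * e4 - 48 * e5)\<bar> = \<bar>v\<bar>^5 * \<bar>16 * e4 - 48 * e5\<bar>"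
        "\<bar>4 * v^2 * e2 * z\<bar> = 4 * (\<bar>v\<bar>^2 * (\<bar>e2\<bar> * \<bar>z\<bar>))"
        by (simp_all only: abs_mult power_abs abs_numeral mult.assoc)
      moreover note 41 \<open>\<bar>v\<bar>^2 * (\<bar>e2\<bar> * \<bar>z\<bar>) \<le> m^2 * (C * w)\<close>
      ultimately show ?thesis by linarith
    qed
    then have "\<bar>v^5 * (16 * e4 - 48 * e5) - 4 * v^2 * e2 * z\<bar> \<le> m^5 * (64 * C) + 4 * (m^2 * (C * w))"
      by linarith
    then have "\<bar>(d - 3) * (d - 1)\<bar> * \<bar>v^5 * (16 * e4 - 48 * e5) - 4 * v^2 * e2 * z\<bar>
        \<le> (4 * 6) * (m^5 * (64 * C) + 4 * (m^2 * (C * w)))"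
      by (intro mult_mono' d'(2) abs_ge_zero)
    then have 4: "\<bar>(d - 3) * (d - 1) * (v^5 * (16 * e4 - 48 * e5) - 4 * v^2 * e2 * z)\<bar>
        \<le> 1536 * (C * m^5) + 96 * (C * (m^2 * w))"
    proof -
      have "(4 * 6) * (m^5 * (64 * C) + 4 * (m^2 * (C * w))) = 1536 * (C * m^5) + 96 * (C * (m^2 * w))"
        by algebra
      with \<open>\<bar>(d - 3) * (d - 1)\<bar> * _ \<le> _\<close> show ?thesis
        unfolding abs_mult[of "(d - 3) * (d - 1)"] by linarith
    qed
    have tri: "\<bar>x1 - x2 + x3 + x4\<bar> \<le> b1 + b2 + b3 + b4"
      if "\<bar>x1\<bar> \<le> b1" "\<bar>x2\<bar> \<le> b2" "\<bar>x3\<bar> \<le> b3" "\<bar>x4\<bar> \<le> b4"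
      for x1 x2 x3 x4 b1 b2 b3 b4 :: real using that by linarith
    have pos: "m^2 * w \<ge> 0" "m^5 \<ge> 0" using mw by auto
    have "0 \<le> C * m^5" by (rule mult_nonneg_nonneg) (use pos C1 in simp_all)
    moreover have "1 * (m^2 * w) \<le> C * (m^2 * w)"
      by (rule mult_right_mono) (use pos C1 in simp_all)
    moreover note pos
    ultimately have "\<bar>N t\<bar> \<le> 2000 * (C * (m^2 * w)) + 2000 * (C * m^5)"
      using tri[OF 1 2 3 4] unfolding N_eq[OF t] df(1-3)[symmetric] df(4-7)[symmetric] by linarith
    then have "\<bar>N t\<bar> \<le> 2000 * C * (m^2 * w + m^5)" by (simp only: distrib_left mult.assoc)
    then show ?thesis by (simp only: df(1-3) m_def w_def)
  qed
  then show ?thesis using C1 by (intro exI[of _ "2000 * C"]) auto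
qed

lemma asymptotics:
  "\<exists>a. ((\<lambda>t. V0 t * exp (- t)) \<longlongrightarrow> a) at_bot" "\<exists>b. ((\<lambda>t. Z t * exp (- 3 * t)) \<longlongrightarrow> b) at_bot"
  "((\<lambda>t. Q t * exp (- 3 * t)) \<longlongrightarrow> 0) at_bot"
proof -
  obtain K where K: "K \<ge> 1" "\<And>t. t < 0 \<Longrightarrow> \<bar>V0 t\<bar> \<le> 1 \<Longrightarrow>
    \<bar>N t\<bar> \<le> K * ((\<bar>V0 t\<bar> + \<bar>Z t\<bar>)^2 * (\<bar>Z t\<bar> + \<bar>Q t\<bar>) + (\<bar>V0 t\<bar> + \<bar>Z t\<bar>)^5)"
    using N_bound by blast
  have "eventually (\<lambda>t. \<bar>V0 t\<bar> < 1) at_bot"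
    using tendstoD[OF V0_tendsto, of 1] by (simp add: dist_real_def)
  then obtain T where T: "\<And>t. t \<le> T \<Longrightarrow> \<bar>V0 t\<bar> < 1" by (auto simp: eventually_at_bot_linorder)
  have neg: "t < 0" "\<bar>V0 t\<bar> \<le> 1" if "t \<le> min T (-1)" for t
    using that T[of t] by auto
  note * = unstable_manifold_asymptotics[OF d(1) K(1) _ ZQP_derivative[OF neg(1)] V0_tendsto ZQP_tendsto
      K(2)[OF neg]]
  show "\<exists>a. ((\<lambda>t. V0 t * exp (- t)) \<longlongrightarrow> a) at_bot" "\<exists>b. ((\<lambda>t. Z t * exp (- 3 * t)) \<longlongrightarrow> b) at_bot"
    "((\<lambda>t. Q t * exp (- 3 * t)) \<longlongrightarrow> 0) at_bot"
    by (rule *[of "min T (-1)"]; simp)+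
qed

lemma \<Phi>_limits:
  "\<exists>a. (\<Phi> 0 \<longlongrightarrow> a) (at_right 0)" "\<exists>b. (\<Phi> 1 \<longlongrightarrow> b) (at_right 0)"
  "((\<lambda>s. s * \<Phi> 2 s) \<longlongrightarrow> 0) (at_right 0)"
proof -
  have e: "exp (- 3 * t) = inverse (exp t ^ 3)" for t :: real
    by (simp add: exp_minus flip: exp_of_nat_mult)
  have "V0 t * exp (- t) = \<Phi> 0 ((exp t)\<^sup>2)" "Z t * exp (- 3 * t) = 2 * \<Phi> 1 ((exp t)\<^sup>2)"
    "Q t * exp (- 3 * t) = 4 * ((exp t)\<^sup>2 * \<Phi> 2 ((exp t)\<^sup>2))" for t
    unfolding e by (simp_all add: V0_def Z_def Q_def E_def exp_minus field_simps eval_nat_numeral)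
  note eq = this
  obtain a b where "((\<lambda>t. \<Phi> 0 ((exp t)\<^sup>2)) \<longlongrightarrow> a) at_bot" "((\<lambda>t. 2 * \<Phi> 1 ((exp t)\<^sup>2)) \<longlongrightarrow> b) at_bot"
    "((\<lambda>t. 4 * ((exp t)\<^sup>2 * \<Phi> 2 ((exp t)\<^sup>2))) \<longlongrightarrow> 0) at_bot"
    using asymptotics unfolding eq by blast
  note lim = this
  show "\<exists>a. (\<Phi> 0 \<longlongrightarrow> a) (at_right 0)"
    using tendsto_at_right_0_of_at_bot[OF lim(1)] by blast
  have "((\<lambda>t. \<Phi> 1 ((exp t)\<^sup>2)) \<longlongrightarrow> b / 2) at_bot"
    using tendsto_divide[OF lim(2) tendsto_const[of 2]] by simp
  from tendsto_at_right_0_of_at_bot[OF this] show "\<exists>b. (\<Phi> 1 \<longlongrightarrow> b) (at_right 0)" by blast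
  have "((\<lambda>t. (exp t)\<^sup>2 * \<Phi> 2 ((exp t)\<^sup>2)) \<longlongrightarrow> 0) at_bot"
    using tendsto_divide[OF lim(3) tendsto_const[of 4]] by simp
  then show "((\<lambda>s. s * \<Phi> 2 s) \<longlongrightarrow> 0) (at_right 0)"
    by (rule tendsto_at_right_0_of_at_bot[of "\<lambda>s. s * \<Phi> 2 s"])
qed

text \<open>\<open>W 0\<close> is the inner Euler operator \<open>\<theta> + d/2 + 1\<close> applied
  to \<open>\<phi>''\<close>, and \<open>W j\<close> is its \<open>j\<close>-th derivative. On the
  cylinder \<open>P\<close> equals \<open>8 r^5\<close> times \<open>W 0\<close>.\<close>

definition W :: "nat \<Rightarrow> real \<Rightarrow> real" where
  "W j s = s * \<Phi> (3 + j) s + (d / 2 + 1 + real j) * \<Phi> (2 + j) s"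

lemma W_derivative:
  assumes "s \<in> {0<..1}"
  shows "(W j has_real_derivative W (Suc j) s) (at s within {0<..1})"
  unfolding W_def[abs_def]
  using chain[OF assms, of "3 + j"] chain[OF assms, of "2 + j"]
  by (auto intro!: derivative_eq_intros simp: algebra_simps eval_nat_numeral)

lemma \<Phi>_continuous: "continuous_on {0<..1} (\<Phi> k)"
  using chain by (rule DERIV_continuous_on)

text \<open>This is \<open>N_eq_RHS\<close> divided by \<open>16 r^5\<close>. The differential
  equation is only available for \<open>s < 1\<close>; the endpoint \<open>s = 1\<close> follows by
  continuity.\<close>

lemma W_equation:
  assumes "s \<in> {0<..1}"
  shows "s * W 1 s + (d / 2 + 2) * W 0 s = RHS s (\<Phi> 0 s) (\<Phi> 1 s) (s * \<Phi> 2 s) / 16"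
    (is "?l s = ?r s")
proof -
  have open_case: "?l s = ?r s" if s: "s \<in> {0<..1}" "s \<noteq> 1" for s
  proof -
    define t where "t = ln s / 2"
    have t: "t < 0" "(exp t)\<^sup>2 = s" using s by (auto simp: t_def exp_double[symmetric])
    have "exp t ^ 5 * (16 * ?l s) = N t"
      unfolding N_def E_def t(2) W_def
      by (simp add: t(2)[symmetric] algebra_simps eval_nat_numeral)
    also have "\<dots> = exp t ^ 5 * (16 * ?r s)"
      unfolding N_eq_RHS[OF t(1)] t(2) by simp
    finally show ?thesis by simp
  qed
  have trig: "continuous_on {0<..1} (\<lambda>s. trig_ser k (4 * s * (\<Phi> 0 s)\<^sup>2))" for k
    by (rule continuous_on_compose2[OF C_k_on_continuous[OF C_k_on_trig_ser[of 0 UNIV k]]])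
       (auto intro!: continuous_intros \<Phi>_continuous)
  have "continuous_on {0<..1} (\<lambda>s. ?l s - ?r s)"
    unfolding W_def RHS_def by (intro continuous_intros \<Phi>_continuous trig) auto
  then have lim: "((\<lambda>s. ?l s - ?r s) \<longlongrightarrow> ?l 1 - ?r 1) (at 1 within {0<..1})"
    unfolding continuous_on_def by (rule bspec) simp
  have zero: "\<forall>\<^sub>F s in at 1 within {0<..1}. ?l s - ?r s = 0"
    unfolding eventually_at_filter
  proof (intro always_eventually allI impI)
    fix s :: real assume "s \<noteq> 1" "s \<in> {0<..1}"
    then have "?l s = ?r s" by (intro open_case)
    then show "?l s - ?r s = 0" by (simp only: right_minus_eq)
  qed
  have "?l 1 - ?r 1 = 0"
    by (rule tendsto_unique[OF at_within_Ioc_nontrivial lim tendsto_eventually[OF zero]]) simp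
  then show ?thesis using open_case[OF assms] by (cases "s = 1") simp_all
qed

definition \<phi> :: "real \<Rightarrow> real" where
  "\<phi> s = (if s = 0 then Lim (at_right 0) (\<Phi> 0) else \<Phi> 0 s)"

definition \<phi>1 :: "real \<Rightarrow> real" where
  "\<phi>1 s = (if s = 0 then Lim (at_right 0) (\<Phi> 1) else \<Phi> 1 s)"

text \<open>The continuous extension of \<open>s \<phi>''\<close>; its value \<open>0\<close> at
  \<open>s = 0\<close> is the limit found in \<open>\<Phi>_limits\<close>.\<close>

definition \<eta> :: "real \<Rightarrow> real" where
  "\<eta> s = (if s = 0 then 0 else s * \<Phi> 2 s)"

lemma continuous_extensions:
  "continuous_on {0..1} \<phi>" "continuous_on {0..1} \<phi>1" "continuous_on {0..1} \<eta>"
proof -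
  have "(\<Phi> 0 \<longlongrightarrow> Lim (at_right 0) (\<Phi> 0)) (at_right 0)" "(\<Phi> 1 \<longlongrightarrow> Lim (at_right 0) (\<Phi> 1)) (at_right 0)"
    using \<Phi>_limits(1,2) by (auto simp: tendsto_Lim)
  from this[THEN continuous_on_extend_at_0[OF \<Phi>_continuous]]
  show "continuous_on {0..1} \<phi>" "continuous_on {0..1} \<phi>1"
    unfolding \<phi>_def[abs_def] \<phi>1_def[abs_def] .
  show "continuous_on {0..1} \<eta>"
    unfolding \<eta>_def[abs_def]
    by (rule continuous_on_extend_at_0) (auto intro!: continuous_intros \<Phi>_continuous \<Phi>_limits)
qed

text \<open>All three functions enter the right-hand side, hence the joint induction. If they are of
  class \<open>C^k\<close>, inverting one Euler operator makes \<open>w\<close>, and the other makes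
  \<open>\<phi>''\<close>, of class \<open>C^k\<close>; the derivatives of the three functions are
  combinations of \<open>\<phi>'\<close>, \<open>\<phi>''\<close> and \<open>w\<close>.\<close>

lemma extensions_smooth:
  "C_k_on k {0..1} \<phi> \<and> C_k_on k {0..1} \<phi>1 \<and> C_k_on k {0..1} \<eta>"
proof (induction k)
  case 0
  then show ?case using continuous_extensions by simp
next
  case (Suc k)
  define g where "g s = RHS s (\<phi> s) (\<phi>1 s) (\<eta> s) / 16" for s
  have cmul: "C_k_on k {0..1} (\<lambda>s. c * f s)" if "C_k_on k {0..1} f" for c and f :: "real \<Rightarrow> real"
    by (intro C_k_on_mult C_k_on_const that)
  have trig: "C_k_on k {0..1} (\<lambda>s. trig_ser j (4 * s * (\<phi> s)\<^sup>2))" for j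
    using Suc by (intro C_k_on_compose[OF C_k_on_trig_ser[of k UNIV j]] C_k_on_mult C_k_on_const
        C_k_on_ident C_k_on_power) auto
  have "C_k_on k {0..1} (\<lambda>s. (1 / 16) * RHS s (\<phi> s) (\<phi>1 s) (\<eta> s))"
    unfolding RHS_def using Suc
    by (intro C_k_on_mult C_k_on_const C_k_on_add C_k_on_diff C_k_on_power C_k_on_ident trig) auto
  then have g: "C_k_on k {0..1} g" by (simp add: g_def[abs_def])
  define w where "w s = (if s = 0 then g 0 / (d / 2 + 2) else W 0 s)" for s
  have geq: "g s = RHS s (\<Phi> 0 s) (\<Phi> 1 s) (s * \<Phi> 2 s) / 16" if "s \<in> {0<..1}" for s
    using that by (simp add: g_def \<phi>_def \<phi>1_def \<eta>_def)
  have ev: "\<forall>\<^sub>F x in at_right 0. x \<in> {0<..<1::real}"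
    by (rule eventually_at_right_real) simp
  have pow0: "((\<lambda>x::real. x powr c) \<longlongrightarrow> 0) (at_right 0)" if "c > 0" for c
  proof -
    have "((\<lambda>x::real. x powr c) \<longlongrightarrow> 0 powr c) (at_right 0)"
      using that by (intro tendsto_powr') (auto simp: eventually_at_filter)
    then show ?thesis by simp
  qed
  have "C_k_on k {0..1} (\<lambda>s. if s = 0 then g 0 / (d / 2 + 2) else W 0 s)"
  proof (rule euler_equation_regularity[OF _ g, where F = W])
    show "s * W 1 s + (d / 2 + 2) * W 0 s = g s" if "s \<in> {0<..1}" for s
      using W_equation[OF that] geq[OF that] by simp
    \<comment> \<open>The growth condition for the outer operator comes from \<open>P\<close>
      tending to \<open>0\<close>, since \<open>s powr (5/2) * W 0 s = P / 8\<close>; the required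
      power \<open>d / 2 + 2\<close> is larger than \<open>5/2\<close>.\<close>
    have "((\<lambda>t. ((exp t)\<^sup>2) powr (5/2) * W 0 ((exp t)\<^sup>2)) \<longlongrightarrow> 0) at_bot"
    proof -
      have "((exp t)\<^sup>2) powr (5/2) * W 0 ((exp t)\<^sup>2) = P t / 8" for t
      proof -
        have "((exp t)\<^sup>2) powr (5/2) = exp t ^ 5"
          by (simp add: powr_def flip: exp_of_nat_mult)
        then show ?thesis
          by (simp add: P_def E_def W_def algebra_simps eval_nat_numeral)
      qed
      then have "(\<lambda>t. ((exp t)\<^sup>2) powr (5/2) * W 0 ((exp t)\<^sup>2)) = (\<lambda>t. P t / 8)" by (rule ext)
      then show ?thesis using tendsto_divide[OF ZQP_tendsto(3) tendsto_const[of 8]] by (simp only:) simp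
    qed
    then have "((\<lambda>s. s powr (5/2) * W 0 s) \<longlongrightarrow> 0) (at_right 0)"
      by (rule tendsto_at_right_0_of_at_bot[of "\<lambda>s. s powr (5/2) * W 0 s"])
    then have "((\<lambda>s. s powr (d / 2 - 1 / 2) * (s powr (5/2) * W 0 s)) \<longlongrightarrow> 0 * 0) (at_right 0)"
      using d by (intro tendsto_mult pow0) auto
    then show "((\<lambda>s. s powr (d / 2 + 2) * W 0 s) \<longlongrightarrow> 0) (at_right 0)"
      by (simp add: mult.assoc[symmetric] powr_add[symmetric] add.commute)
  qed (use d W_derivative in auto)
  then have w: "C_k_on k {0..1} w" by (simp add: w_def[abs_def])
  define \<phi>2 where "\<phi>2 s = (if s = 0 then w 0 / (d / 2 + 1) else \<Phi> 2 s)" for s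
  have "C_k_on k {0..1} (\<lambda>s. if s = 0 then w 0 / (d / 2 + 1) else (\<lambda>j. \<Phi> (2 + j)) 0 s)"
  proof (rule euler_equation_regularity[OF _ w, where F = "\<lambda>j. \<Phi> (2 + j)"])
    show "(\<Phi> (2 + j) has_real_derivative \<Phi> (2 + Suc j) s) (at s within {0<..1})" if "s \<in> {0<..1}" for j s
      using chain[OF that, of "2 + j"] by simp
    show "s * \<Phi> (2 + 1) s + (d / 2 + 1) * \<Phi> (2 + 0) s = w s" if "s \<in> {0<..1}" for s
      using that by (simp add: w_def W_def)
    have "((\<lambda>s. s powr (d / 2) * (s * \<Phi> 2 s)) \<longlongrightarrow> 0) (at_right 0)"
      using tendsto_mult[OF pow0[of "d / 2"] \<Phi>_limits(3)] d by simp
    moreover have "\<forall>\<^sub>F s in at_right 0. s powr (d / 2) * (s * \<Phi> 2 s) = s powr (d / 2 + 1) * \<Phi> (2 + 0) s"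
      using ev by eventually_elim (simp add: powr_add)
    ultimately show "((\<lambda>s. s powr (d / 2 + 1) * \<Phi> (2 + 0) s) \<longlongrightarrow> 0) (at_right 0)"
      by (rule Lim_transform_eventually)
  qed (use d in auto)
  then have \<phi>2: "C_k_on k {0..1} \<phi>2" unfolding \<phi>2_def[abs_def] add_0_right .
  have "C_k_on (Suc k) {0..1} \<phi>"
  proof (rule C_k_on_extension_SucI[OF continuous_extensions(1), of k \<phi>1 "\<Phi> 0"])
    show "(\<Phi> 0 has_real_derivative \<phi>1 s) (at s within {0<..1})" if "s \<in> {0<..1}" for s
      using chain[OF that, of 0] that by (simp add: \<phi>1_def)
  qed (use Suc in \<open>auto simp: \<phi>_def\<close>)
  moreover have "C_k_on (Suc k) {0..1} \<phi>1"
  proof (rule C_k_on_extension_SucI[OF continuous_extensions(2) \<phi>2, of "\<Phi> 1"])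
    show "(\<Phi> 1 has_real_derivative \<phi>2 s) (at s within {0<..1})" if "s \<in> {0<..1}" for s
      using chain[OF that, of 1] that by (simp add: \<phi>2_def numeral_2_eq_2)
  qed (auto simp: \<phi>1_def)
  moreover have "C_k_on (Suc k) {0..1} \<eta>"
  \<comment> \<open>The derivative of \<open>s \<phi>''\<close> is
    \<open>\<phi>'' + s \<phi>'''\<close>, and \<open>w = s \<phi>''' + (d/2 + 1) \<phi>''\<close>
    eliminates the uncontrolled \<open>\<phi>'''\<close>.\<close>
  proof (rule C_k_on_extension_SucI[OF continuous_extensions(3), of k "\<lambda>s. w s - d / 2 * \<phi>2 s" "\<lambda>s. s * \<Phi> 2 s"])
    show "C_k_on k {0..1} (\<lambda>s. w s - d / 2 * \<phi>2 s)" by (intro C_k_on_diff w cmul \<phi>2)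
    show "((\<lambda>s. s * \<Phi> 2 s) has_real_derivative w s - d / 2 * \<phi>2 s) (at s within {0<..1})"
      if "s \<in> {0<..1}" for s
      using chain[OF that, of 2] that
      by (auto intro!: derivative_eq_intros simp: w_def W_def \<phi>2_def algebra_simps eval_nat_numeral)
  qed (auto simp: \<eta>_def)
  ultimately show ?case by blast
qed

section \<open>The biharmonic equation\<close>

text \<open>\<open>sin \<psi> / r\<close> and, next, \<open>cos \<psi>\<close> as functions of
  \<open>s = r^2\<close>. Through \<open>trig_ser\<close> neither a division nor a square root
  occurs, so smoothness at \<open>s = 0\<close> is immediate.\<close>

definition G where "G s = \<phi> s * trig_ser 1 (s * (\<phi> s)\<^sup>2)"
definition H where "H s = trig_ser 0 (s * (\<phi> s)\<^sup>2)"

lemma G_H_smooth: "C_infinity_on {0..1} G" "C_infinity_on {0..1} H"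
proof -
  have \<phi>: "C_k_on k {0..1} \<phi>" for k using extensions_smooth by blast
  have "C_k_on k {0..1} (\<lambda>s. trig_ser j (s * (\<phi> s)\<^sup>2))" for k j
    using \<phi> by (intro C_k_on_compose[OF C_k_on_trig_ser[of k UNIV j]] C_k_on_mult C_k_on_ident C_k_on_power) auto
  with \<phi> show "C_infinity_on {0..1} G" "C_infinity_on {0..1} H"
    unfolding C_infinity_on_def G_def[abs_def] H_def[abs_def] by (auto intro: C_k_on_mult)
qed

lemma sin_cos_eq:
  assumes "0 \<le> r"
  shows "sin (r * \<phi> (r\<^sup>2)) = r * G (r\<^sup>2)" "cos (r * \<phi> (r\<^sup>2)) = H (r\<^sup>2)"
  using sin_eq_trig_ser[of "r * \<phi> (r\<^sup>2)"] cos_eq_trig_ser[of "r * \<phi> (r\<^sup>2)"]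
  by (simp_all add: G_def H_def power_mult_distrib)

text \<open>The brackets are the two coefficients of the bilaplacian of \<open>(G x, H)\<close>. The
  identity says that it is parallel to the map itself.\<close>

lemma bilaplacian_profile_identity:
  assumes G': "g 0 = G" "\<And>k s. s \<in> {0..1} \<Longrightarrow> (g k has_real_derivative g (Suc k) s) (at s within {0..1})"
    and H': "h 0 = H" "\<And>k s. s \<in> {0..1} \<Longrightarrow> (h k has_real_derivative h (Suc k) s) (at s within {0..1})"
    and s: "0 < s" "s < 1"
  shows "H s * (16 * s^2 * g 4 s + (16 * d + 64) * s * g 3 s + (2 * d + 4) * (2 * d + 8) * g 2 s)
    = G s * (16 * s^2 * h 4 s + (16 * d + 32) * s * h 3 s + 2 * d * (2 * d + 4) * h 2 s)"
proof -
  define t where "t = ln s / 2"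
  have t: "t < 0" "(exp t)\<^sup>2 = s" using s by (auto simp: t_def exp_double[symmetric])
  define r where "r = exp t"
  have r: "r > 0" "r^2 = s" using t by (auto simp: r_def)
  define g' where "g' n k t = exp t ^ n * g k ((exp t)\<^sup>2)" for n k t
  define h' where "h' n k t = exp t ^ n * h k ((exp t)\<^sup>2)" for n k t
  have dg: "(g' n k has_real_derivative real n * g' n k t + 2 * g' (n + 2) (Suc k) t) (at t)" if "t < 0" for n k t
    unfolding g'_def[abs_def] using G'(2)[of "(exp t)\<^sup>2" k] exp_square_bounds[OF that]
    by (intro exp_power_chain_derivative) (simp add: at_within_Icc_at)
  have dh: "(h' n k has_real_derivative real n * h' n k t + 2 * h' (n + 2) (Suc k) t) (at t)" if "t < 0" for n k t
    unfolding h'_def[abs_def] using H'(2)[of "(exp t)\<^sup>2" k] exp_square_bounds[OF that]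
    by (intro exp_power_chain_derivative) (simp add: at_within_Icc_at)
  have V0: "V0 t = exp t * \<phi> ((exp t)\<^sup>2)" for t by (simp add: V0_def E_def \<phi>_def)
  let ?A = "\<lambda>t. sin (V0 t)" and ?B = "\<lambda>t. cos (V0 t)"
  have S0: "?A t = g' 1 0 t" and C0: "?B t = h' 0 0 t" for t
    unfolding V0 using sin_cos_eq[of "exp t"] by (simp_all add: g'_def h'_def G'(1) H'(1))
  note V' = V_derivative
  \<comment> \<open>Differentiating the identities for \<open>sin\<close> and \<open>cos\<close> of
    \<open>V0\<close> on both sides expresses the trigonometric derivatives through the derivatives
    of \<open>G\<close> and \<open>H\<close>, with the same coefficients as in \<open>V1\<close> to
    \<open>V4\<close> for the sine.\<close>
  have S1: "?B t * V1 t = g' 1 0 t + 2 * g' 3 1 t" if "t < 0" for t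
    using S0 by (rule DERIV_unique_transfer)
      (use that dg[OF that, of 1 0] in \<open>auto intro!: derivative_eq_intros V' simp: eval_nat_numeral\<close>)
  have S2: "- ?A t * (V1 t)^2 + ?B t * V2 t = g' 1 0 t + 8 * g' 3 1 t + 4 * g' 5 2 t" if "t < 0" for t
    using S1 by (rule DERIV_unique_transfer)
      (use that dg[OF that, of 1 0] dg[OF that, of 3 1] in
        \<open>auto intro!: derivative_eq_intros V' simp: eval_nat_numeral algebra_simps\<close>)
  have S3: "- ?B t * (V1 t)^3 - 3 * ?A t * V1 t * V2 t + ?B t * V3 t
      = g' 1 0 t + 26 * g' 3 1 t + 36 * g' 5 2 t + 8 * g' 7 3 t" if "t < 0" for t
    using S2 by (rule DERIV_unique_transfer)
      (use that dg[OF that, of 1 0] dg[OF that, of 3 1] dg[OF that, of 5 2] in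
        \<open>auto intro!: derivative_eq_intros V' simp: eval_nat_numeral algebra_simps\<close>)
  have S4: "?A t * (V1 t)^4 - 6 * ?B t * (V1 t)^2 * V2 t - ?A t * (3 * (V2 t)^2 + 4 * V1 t * V3 t) + ?B t * V4 t
      = g' 1 0 t + 80 * g' 3 1 t + 232 * g' 5 2 t + 128 * g' 7 3 t + 16 * g' 9 4 t" if "t < 0" for t
    using S3 by (rule DERIV_unique_transfer)
      (use that dg[OF that, of 1 0] dg[OF that, of 3 1] dg[OF that, of 5 2] dg[OF that, of 7 3] in
        \<open>auto intro!: derivative_eq_intros V' simp: eval_nat_numeral algebra_simps\<close>)
  have C1: "- ?A t * V1 t = 2 * h' 2 1 t" if "t < 0" for t
    using C0 by (rule DERIV_unique_transfer)
      (use that dh[OF that, of 0 0] in \<open>auto intro!: derivative_eq_intros V' simp: eval_nat_numeral\<close>)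
  have C2: "- ?B t * (V1 t)^2 - ?A t * V2 t = 4 * h' 2 1 t + 4 * h' 4 2 t" if "t < 0" for t
    using C1 by (rule DERIV_unique_transfer)
      (use that dh[OF that, of 2 1] in
        \<open>auto intro!: derivative_eq_intros V' simp: eval_nat_numeral algebra_simps\<close>)
  have C3: "?A t * (V1 t)^3 - 3 * ?B t * V1 t * V2 t - ?A t * V3 t
      = 8 * h' 2 1 t + 24 * h' 4 2 t + 8 * h' 6 3 t" if "t < 0" for t
    using C2 by (rule DERIV_unique_transfer)
      (use that dh[OF that, of 2 1] dh[OF that, of 4 2] in
        \<open>auto intro!: derivative_eq_intros V' simp: eval_nat_numeral algebra_simps\<close>)
  have C4: "?B t * (V1 t)^4 + 6 * ?A t * (V1 t)^2 * V2 t - ?B t * (3 * (V2 t)^2 + 4 * V1 t * V3 t) - ?A t * V4 t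
      = 16 * h' 2 1 t + 112 * h' 4 2 t + 96 * h' 6 3 t + 16 * h' 8 4 t" if "t < 0" for t
    using C3 by (rule DERIV_unique_transfer)
      (use that dh[OF that, of 2 1] dh[OF that, of 4 2] dh[OF that, of 6 3] in
        \<open>auto intro!: derivative_eq_intros V' simp: eval_nat_numeral algebra_simps\<close>)
  define S1' S2' S3' S4' C1' C2' C3' C4' where "S1' = ?B t * V1 t"
    and "S2' = - ?A t * (V1 t)^2 + ?B t * V2 t"
    and "S3' = - ?B t * (V1 t)^3 - 3 * ?A t * V1 t * V2 t + ?B t * V3 t"
    and "S4' = ?A t * (V1 t)^4 - 6 * ?B t * (V1 t)^2 * V2 t - ?A t * (3 * (V2 t)^2 + 4 * V1 t * V3 t) + ?B t * V4 t"
    and "C1' = - ?A t * V1 t" and "C2' = - ?B t * (V1 t)^2 - ?A t * V2 t"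
    and "C3' = ?A t * (V1 t)^3 - 3 * ?B t * V1 t * V2 t - ?A t * V3 t"
    and "C4' = ?B t * (V1 t)^4 + 6 * ?A t * (V1 t)^2 * V2 t - ?B t * (3 * (V2 t)^2 + 4 * V1 t * V3 t) - ?A t * V4 t"
  note df = this
  have ode': "V4 t = 6 * V3 t - 11 * V2 t + 6 * V1 t + 6 * (V1 t)^2 * (V2 t - V1 t)
      + 2 * (d - 1) * ((V1 t)^3 - (V3 t - 3 * V2 t + 2 * V1 t))
      - (d - 1) * ((d - ((?B t)^2 - (?A t)^2) - 4) * (V2 t - V1 t) + (2 * ?A t * ?B t) * (V1 t)^2)
      + (d - 3) * (d - 1) * (((?B t)^2 - (?A t)^2) + 2) * V1 t - 3 / 2 * (d - 3) * (d - 1) * (2 * ?A t * ?B t)"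
    using V_ode[OF t(1)] unfolding cos_double sin_double .
  have id: "?B t * (S4' + (2 * d - 8) * S3' + ((d - 1) * (d - 3) - 4 * (2 * d - 4) + 3) * S2'
      + (3 * (2 * d - 4) - 4 * (d - 1) * (d - 3)) * S1' + 3 * (d - 1) * (d - 3) * ?A t)
    = ?A t * (C4' + (2 * d - 8) * C3' + ((d - 4) * (d - 2) - 2 * (2 * d - 6)) * C2' - 2 * (d - 4) * (d - 2) * C1')"
    by (rule cos_sin_bilaplacian_identity[OF _ ode' df]) simp
  have "S4' + (2 * d - 8) * S3' + ((d - 1) * (d - 3) - 4 * (2 * d - 4) + 3) * S2'
      + (3 * (2 * d - 4) - 4 * (d - 1) * (d - 3)) * S1' + 3 * (d - 1) * (d - 3) * ?A t
    = r^5 * (16 * s^2 * g 4 s + (16 * d + 64) * s * g 3 s + (2 * d + 4) * (2 * d + 8) * g 2 s)"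
    unfolding df unfolding S1[OF t(1)] S2[OF t(1)] S3[OF t(1)] S4[OF t(1)] unfolding S0 g'_def r_def[symmetric] r(2)[symmetric]
    by algebra
  moreover have "C4' + (2 * d - 8) * C3' + ((d - 4) * (d - 2) - 2 * (2 * d - 6)) * C2' - 2 * (d - 4) * (d - 2) * C1'
    = r^4 * (16 * s^2 * h 4 s + (16 * d + 32) * s * h 3 s + 2 * d * (2 * d + 4) * h 2 s)"
    unfolding df unfolding C1[OF t(1)] C2[OF t(1)] C3[OF t(1)] C4[OF t(1)] unfolding h'_def r_def[symmetric] r(2)[symmetric]
    by algebra
  moreover have "?A t = r * G s" "?B t = H s"
    unfolding S0 C0 by (simp_all add: g'_def h'_def G'(1) H'(1) t(2) r_def)
  \<comment> \<open>The sine side carries \<open>r^5\<close> from its bracket, the cosine side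
    \<open>r^4\<close> from its bracket and one more \<open>r\<close> from
    \<open>sin (V0 t) = r * G s\<close>.\<close>
  ultimately have "r^5 * (H s * (16 * s^2 * g 4 s + (16 * d + 64) * s * g 3 s + (2 * d + 4) * (2 * d + 8) * g 2 s))
    = r^5 * (G s * (16 * s^2 * h 4 s + (16 * d + 32) * s * h 3 s + 2 * d * (2 * d + 4) * h 2 s))"
    using id by (simp only: eval_nat_numeral power_Suc power_0 mult_ac)
  then show ?thesis using r(1) by simp
qed

end

section \<open>From the given profile to the map on the ball\<close>

lemma iterated_deriv_eq:
  fixes f :: "real \<Rightarrow> real"
  assumes P0: "\<And>r. r \<in> {0<..<1} \<Longrightarrow> f r = P 0 r"
    and P: "\<And>k r. k < n \<Longrightarrow> r \<in> {0<..<1} \<Longrightarrow> (P k has_real_derivative P (Suc k) r) (at r)"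
  shows "k \<le> n \<Longrightarrow> r \<in> {0<..<1} \<Longrightarrow> (deriv ^^ k) f r = P k r"
proof (induction k arbitrary: r)
  case 0
  then show ?case using P0 by simp
next
  case (Suc k)
  have "(P k has_real_derivative P (Suc k) r) (at r)"
    using Suc.prems by (intro P) auto
  then have "((deriv ^^ k) f has_real_derivative P (Suc k) r) (at r)"
  proof (rule has_field_derivative_transform_within_open)
    show "P k y = (deriv ^^ k) f y" if "y \<in> {0<..<1}" for y
      using Suc.IH[OF _ that] Suc.prems(1) by simp
  qed (use Suc.prems(2) in simp_all)
  then show ?case unfolding funpow.simps(2) comp_def by (rule DERIV_imp_deriv)
qed

theorem theorem1:
  fixes \<psi> :: "real \<Rightarrow> real" and u :: "real ^ 'n \<Rightarrow> (real ^ 'n) \<times> real" and d :: nat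
  assumes d: "d \<in> {5, 6, 7}" "CARD('n) = d"
    and cont: "continuous_on {0..1} \<psi>"
    and smooth: "C_infinity_on {0<..1} \<psi>"
    and zero: "\<psi> 0 = 0"
    and ode: "\<And>r. r \<in> {0<..<1} \<Longrightarrow>
      (deriv ^^ 4) \<psi> r =
        6 * (deriv \<psi> r)^2 * (deriv ^^ 2) \<psi> r
        + 2 * (real d - 1) / r * ((deriv \<psi> r)^3 - (deriv ^^ 3) \<psi> r)
        - (real d - 1) / r^2 *
            ((real d - cos (2 * \<psi> r) - 4) * (deriv ^^ 2) \<psi> r + sin (2 * \<psi> r) * (deriv \<psi> r)^2)
        + (real d - 3) * (real d - 1) / r^3 * (cos (2 * \<psi> r) + 2) * deriv \<psi> r
        - 3 * (real d - 3) * (real d - 1) / (2 * r^4) * sin (2 * \<psi> r)"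
    and u: "u = Upsilon \<psi>"
  shows "u \<in> cball 0 1 \<rightarrow> sphere 0 1 \<and> C_infinity_on (cball 0 1) u \<and> biharmonic_map_on (ball 0 1) u"
proof -
  \<comment> \<open>This is \<open>\<psi> r / r\<close> in the variable \<open>s = r^2\<close>, the
    function \<open>\<Phi> 0\<close> of the locale; away from \<open>0\<close> it inherits
    smoothness by composition with powers.\<close>
  have \<psi>: "C_k_on k {0<..1} (\<lambda>s. s powr (- 1 / 2) * \<psi> (s powr (1 / 2)))" for k
  proof (rule C_k_on_mult[OF C_k_on_powr C_k_on_compose[OF _ C_k_on_powr]])
    show "C_k_on k {0<..1} \<psi>" using smooth by (simp add: C_infinity_on_def)
    show "(\<lambda>s. s powr (1 / 2)) ` {0<..1} \<subseteq> {0<..1::real}" by (auto simp: powr_le1)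
  qed
  then have \<psi>_smooth: "C_infinity_on {0<..1} (\<lambda>s. s powr (- 1 / 2) * \<psi> (s powr (1 / 2)))"
    by (simp add: C_infinity_on_def)
  obtain \<Phi> where \<Phi>0: "\<Phi> 0 = (\<lambda>s. s powr (- 1 / 2) * \<psi> (s powr (1 / 2)))"
    and \<Phi>: "\<And>k s. s \<in> {0<..1} \<Longrightarrow> (\<Phi> k has_real_derivative \<Phi> (Suc k) s) (at s within {0<..1})"
    using C_infinity_on_derivative_chain[OF \<psi>_smooth at_within_Ioc_nontrivial] by blast
  have \<psi>_eq: "\<psi> r = r * \<Phi> 0 (r\<^sup>2)" if "r > 0" for r
  proof -
    have "(r\<^sup>2) powr (1 / 2) = r" "(r\<^sup>2) powr (- 1 / 2) = inverse r"
      using that by (simp_all add: powr_half_sqrt powr_minus)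
    then show ?thesis using that by (simp add: \<Phi>0)
  qed
  have ball1: "0 < r\<^sup>2" "r\<^sup>2 < 1" if "r \<in> {0<..<1}" for r :: real
    using that by (auto simp: power_less_one_iff)
  \<comment> \<open>The derivatives of \<open>r * \<Phi> 0 (r^2)\<close> of order 0 to 4; the final
    branch serves only for order 4.\<close>
  define P where "P k = (if k = 0 then (\<lambda>r. r * \<Phi> 0 (r\<^sup>2))
    else if k = Suc 0 then (\<lambda>r. \<Phi> 0 (r\<^sup>2) + 2 * r\<^sup>2 * \<Phi> 1 (r\<^sup>2))
    else if k = 2 then (\<lambda>r. 6 * r * \<Phi> 1 (r\<^sup>2) + 4 * r^3 * \<Phi> 2 (r\<^sup>2))
    else if k = 3 then (\<lambda>r. 6 * \<Phi> 1 (r\<^sup>2) + 24 * r\<^sup>2 * \<Phi> 2 (r\<^sup>2) + 8 * r^4 * \<Phi> 3 (r\<^sup>2))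
    else (\<lambda>r. 60 * r * \<Phi> 2 (r\<^sup>2) + 80 * r^3 * \<Phi> 3 (r\<^sup>2) + 16 * r^5 * \<Phi> 4 (r\<^sup>2)))" for k :: nat
  have d\<Phi>: "((\<lambda>r. \<Phi> k (r\<^sup>2)) has_real_derivative \<Phi> (Suc k) (r\<^sup>2) * (2 * r)) (at r)"
    if "r \<in> {0<..<1}" for k r
  proof (rule DERIV_chain2[of "\<Phi> k"])
    show "(\<Phi> k has_real_derivative \<Phi> (Suc k) (r\<^sup>2)) (at (r\<^sup>2))"
      using \<Phi>[of "r\<^sup>2" k] ball1[OF that] by (simp add: at_within_Ioc_eq_at)
    show "((\<lambda>r. r\<^sup>2) has_real_derivative 2 * r) (at r)"
      by (auto intro!: derivative_eq_intros)
  qed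
  have P: "(P k has_real_derivative P (Suc k) r) (at r)" if "k < 4" "r \<in> {0<..<1}" for k r
  proof -
    have "k = 0 \<or> k = 1 \<or> k = 2 \<or> k = 3" using that(1) by auto
    then show ?thesis
      using d\<Phi>[OF that(2), of 0] d\<Phi>[OF that(2), of 1] d\<Phi>[OF that(2), of 2] d\<Phi>[OF that(2), of 3]
      by (elim disjE) (auto intro!: derivative_eq_intros simp: P_def eval_nat_numeral algebra_simps)
  qed
  have deriv_\<psi>: "(deriv ^^ k) \<psi> r = P k r" if "k \<le> 4" "r \<in> {0<..<1}" for k r
    by (rule iterated_deriv_eq[where P = P, OF _ P that]) (auto simp: P_def \<psi>_eq)
  interpret biharmonic_profile \<Phi> "real d"
  proof
    show "5 \<le> real d" "real d \<le> 7" using d by auto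
    show "(\<Phi> k has_real_derivative \<Phi> (Suc k) s) (at s within {0<..1})" if "s \<in> {0<..1}" for k s
      using \<Phi>[OF that] .
    have "(\<psi> \<longlongrightarrow> \<psi> 0) (at 0 within {0..1})"
      using cont unfolding continuous_on_def by (rule bspec) simp
    then have "(\<psi> \<longlongrightarrow> 0) (at_right 0)" by (simp add: at_within_Icc_at_right zero)
    then show "((\<lambda>r. r * \<Phi> 0 (r\<^sup>2)) \<longlongrightarrow> 0) (at_right 0)"
      by (rule Lim_transform_eventually) (auto simp: eventually_at_filter \<psi>_eq)
  next
    fix r p p1 p2 p3 p4 :: real
    assume r: "0 < r" "r < 1" and p: "p = r * \<Phi> 0 (r^2)"
      "p1 = \<Phi> 0 (r^2) + 2 * r^2 * \<Phi> 1 (r^2)"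
      "p2 = 6 * r * \<Phi> 1 (r^2) + 4 * r^3 * \<Phi> 2 (r^2)"
      "p3 = 6 * \<Phi> 1 (r^2) + 24 * r^2 * \<Phi> 2 (r^2) + 8 * r^4 * \<Phi> 3 (r^2)"
      "p4 = 60 * r * \<Phi> 2 (r^2) + 80 * r^3 * \<Phi> 3 (r^2) + 16 * r^5 * \<Phi> 4 (r^2)"
    have "\<psi> r = p" "deriv \<psi> r = p1" "(deriv ^^ 2) \<psi> r = p2" "(deriv ^^ 3) \<psi> r = p3" "(deriv ^^ 4) \<psi> r = p4"
      using deriv_\<psi>[of 0 r] deriv_\<psi>[of 1 r] deriv_\<psi>[of 2 r] deriv_\<psi>[of 3 r] deriv_\<psi>[of 4 r] r
      by (simp_all add: P_def p)
    with ode[of r] r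
    show "p4 = 6 * p1^2 * p2 + 2 * (real d - 1) / r * (p1^3 - p3)
        - (real d - 1) / r^2 * ((real d - cos (2 * p) - 4) * p2 + sin (2 * p) * p1^2)
        + (real d - 3) * (real d - 1) / r^3 * (cos (2 * p) + 2) * p1
        - 3 * (real d - 3) * (real d - 1) / (2 * r^4) * sin (2 * p)"
      by simp
  qed
  have u_eq: "u x = (G (x \<bullet> x) *\<^sub>R x, H (x \<bullet> x))" for x
  proof (cases "x = 0")
    case True
    then show ?thesis using sin_cos_eq[of 0] by (simp add: u Upsilon_def)
  next
    case False
    then have "\<psi> (norm x) = norm x * \<phi> ((norm x)\<^sup>2)" by (simp add: \<psi>_eq \<phi>_def)
    with False sin_cos_eq[of "norm x"] show ?thesis
      by (simp add: u Upsilon_def dot_square_norm)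
  qed
  have norm_u: "norm (u x) = 1" for x
    by (cases "x = 0") (simp_all add: u Upsilon_def norm_Pair abs_mult mult.assoc)
  have smooth_u: "C_infinity_on (cball 0 1) u"
  proof -
    have sq: "C_k_on k (cball 0 1) (\<lambda>x::real ^ 'n. x \<bullet> x)" for k
      by (intro C_k_on_inner C_k_on_ident)
    have im: "(\<lambda>x::real ^ 'n. x \<bullet> x) ` cball 0 1 \<subseteq> {0..1}"
      by (auto simp: dot_square_norm power_le_one)
    have "C_k_on k (cball 0 1) (\<lambda>x::real ^ 'n. (G (x \<bullet> x) *\<^sub>R x, H (x \<bullet> x)))" for k
    proof (intro C_k_on_Pair C_k_on_scaleR C_k_on_ident)
      show "C_k_on k (cball 0 1) (\<lambda>x::real ^ 'n. G (x \<bullet> x))"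
        by (rule C_k_on_compose[where g = G, OF _ sq im]) (use G_H_smooth in \<open>simp add: C_infinity_on_def\<close>)
      show "C_k_on k (cball 0 1) (\<lambda>x::real ^ 'n. H (x \<bullet> x))"
        by (rule C_k_on_compose[where g = H, OF _ sq im]) (use G_H_smooth in \<open>simp add: C_infinity_on_def\<close>)
    qed
    moreover have "u = (\<lambda>x. (G (x \<bullet> x) *\<^sub>R x, H (x \<bullet> x)))" using u_eq by (rule ext)
    ultimately show ?thesis by (simp add: C_infinity_on_def)
  qed
  obtain g where g: "g 0 = G" "\<And>k s. s \<in> {0..1} \<Longrightarrow> (g k has_real_derivative g (Suc k) s) (at s within {0..1})"
    using C_infinity_on_derivative_chain[OF G_H_smooth(1) at_within_Icc_nontrivial] by blast
  obtain h where h: "h 0 = H" "\<And>k s. s \<in> {0..1} \<Longrightarrow> (h k has_real_derivative h (Suc k) s) (at s within {0..1})"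
    using C_infinity_on_derivative_chain[OF G_H_smooth(2) at_within_Icc_nontrivial] by blast
  have CARD: "real CARD('n) = real d" using assms(2) by simp
  have lap1: "laplacian u x = ((4 * (x \<bullet> x) * g 2 (x \<bullet> x) + (2 * real d + 4) * g 1 (x \<bullet> x)) *\<^sub>R x,
      4 * (x \<bullet> x) * h 2 (x \<bullet> x) + 2 * real d * h 1 (x \<bullet> x))" if "x \<in> ball 0 1" for x
    using laplacian_equivariant[OF g(2)[of _ 0] g(2)[of _ "Suc 0"] h(2)[of _ 0] h(2)[of _ "Suc 0"]
        u_eq[folded g(1) h(1)] that]
    by (simp add: CARD numeral_2_eq_2)
  define M where "M s = 16 * s^2 * g 4 s + (16 * real d + 64) * s * g 3 s + (2 * real d + 4) * (2 * real d + 8) * g 2 s" for s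
  define K where "K s = 16 * s^2 * h 4 s + (16 * real d + 32) * s * h 3 s + 2 * real d * (2 * real d + 4) * h 2 s" for s
  have lap2: "laplacian (laplacian u) x = (M (x \<bullet> x) *\<^sub>R x, K (x \<bullet> x))" if "x \<in> ball 0 1" for x
  proof -
    \<comment> \<open>First and second derivatives of the coefficients in \<open>lap1\<close>, which
      take the place of \<open>G\<close> and \<open>H\<close> in the second application.\<close>
    let ?g1 = "\<lambda>s. 4 * s * g 3 s + (2 * real d + 8) * g 2 s" and ?g2 = "\<lambda>s. 4 * s * g 4 s + (2 * real d + 12) * g 3 s"
    let ?h1 = "\<lambda>s. 4 * s * h 3 s + (2 * real d + 4) * h 2 s" and ?h2 = "\<lambda>s. 4 * s * h 4 s + (2 * real d + 8) * h 3 s"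
    have "laplacian (laplacian u) x =
      ((4 * (x \<bullet> x) * ?g2 (x \<bullet> x) + (2 * real CARD('n) + 4) * ?g1 (x \<bullet> x)) *\<^sub>R x,
       4 * (x \<bullet> x) * ?h2 (x \<bullet> x) + 2 * real CARD('n) * ?h1 (x \<bullet> x))"
    proof (rule laplacian_equivariant[OF _ _ _ _ lap1 that])
      fix s :: real assume s: "s \<in> {0..1}"
      note gs = g(2)[OF s, of 1] g(2)[OF s, of 2] g(2)[OF s, of 3]
      note hs = h(2)[OF s, of 1] h(2)[OF s, of 2] h(2)[OF s, of 3]
      show "((\<lambda>s. 4 * s * g 2 s + (2 * real d + 4) * g 1 s) has_real_derivative ?g1 s) (at s within {0..1})"
        "(?g1 has_real_derivative ?g2 s) (at s within {0..1})"
        "((\<lambda>s. 4 * s * h 2 s + 2 * real d * h 1 s) has_real_derivative ?h1 s) (at s within {0..1})"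
        "(?h1 has_real_derivative ?h2 s) (at s within {0..1})"
        using gs hs by (auto intro!: derivative_eq_intros simp: eval_nat_numeral algebra_simps)
    qed
    moreover have "4 * (x \<bullet> x) * ?g2 (x \<bullet> x) + (2 * real CARD('n) + 4) * ?g1 (x \<bullet> x) = M (x \<bullet> x)"
      "4 * (x \<bullet> x) * ?h2 (x \<bullet> x) + 2 * real CARD('n) * ?h1 (x \<bullet> x) = K (x \<bullet> x)"
      unfolding M_def K_def CARD by algebra+
    ultimately show ?thesis by (simp only:)
  qed
  have "laplacian (laplacian u) x \<bullet> w = 0" if x: "x \<in> ball 0 1" and w: "w \<in> tangent_sphere (u x)" for x w
  proof -
    define s where "s = x \<bullet> x"
    obtain a b where ab: "w = (a, b)" by (cases w)
    define y where "y = x \<bullet> a"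
    have tan: "G s * y + H s * b = 0"
      using w by (simp add: tangent_sphere_def u_eq ab s_def y_def inner_Pair)
    have "M s * y + K s * b = 0"
    \<comment> \<open>At the origin \<open>y = 0\<close> and \<open>H 0 = 1\<close>, so tangency
      forces \<open>b = 0\<close>. The profile identity is needed only for
      \<open>s > 0\<close>.\<close>
    proof (cases "x = 0")
      case True
      then show ?thesis using tan sin_cos_eq[of 0] by (simp add: s_def y_def)
    next
      case False
      then have s: "0 < s" "s < 1" using x by (auto simp: s_def dot_square_norm power_less_one_iff)
      have id: "H s * M s = G s * K s"
        unfolding M_def K_def by (rule bilaplacian_profile_identity[OF g h s])
      have "(norm (u x))\<^sup>2 = 1" by (simp add: norm_u)
      then have "s * (G s)\<^sup>2 + (H s)\<^sup>2 = 1"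
        by (simp add: u_eq norm_Pair s_def dot_square_norm power_mult_distrib mult.commute)
      \<comment> \<open>By \<open>id\<close> and \<open>tan\<close> both \<open>G s\<close> and
        \<open>H s\<close> annihilate \<open>M s * y + K s * b\<close>; the unit length of
        \<open>u x\<close> shows that they do not both vanish.\<close>
      moreover have "(s * (G s)\<^sup>2 + (H s)\<^sup>2) * (M s * y + K s * b) = 0"
        using id tan by algebra
      ultimately show ?thesis by simp
    qed
    then show ?thesis using lap2[OF x] by (simp add: ab s_def y_def inner_Pair)
  qed
  moreover have "C_infinity_on (ball 0 1) u"
    using smooth_u C_k_on_subset[of _ "cball 0 1" u "ball 0 1"] by (auto simp: C_infinity_on_def)
  ultimately have "biharmonic_map_on (ball 0 1) u"
    unfolding biharmonic_map_on_def by (auto simp: norm_u)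
  with smooth_u norm_u show ?thesis by auto
qed

end
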